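(* Let $D=\mathbb T^d$, let $\rho_0$ be a smooth density on $D$ with $\int_D\rho_0\,dx=1$ and $0<C_1^{-1}\le \rho_0\le C_1<\infty$ on $D$ for some $C_1>1$, and let $\mathsf G$ be the weighted Riemannian metric $\mathsf G_X(\xi,\eta)=\int_D \xi(x)\cdot\eta(x)\,\rho_0(x)\,dx$ on the group $\mathsf{SDiff}(D)$ of smooth volume-preserving diffeomorphisms of $D$. Let $X=X_t$ be a geodesic of $(\mathsf{SDiff}(D),\mathsf G)$ with $X_0=\mathrm{Id}$, and put $u_t=\dot X_t\circ X_t^{-1}$ and $\rho_t=\rho_0\circ X_t^{-1}$. Then there exists a scalar pressure field $p=p(t,x)$ such that: (I) $\rho_0\,\ddot X=-\nabla p\circ X$; (II) $p=-\Delta_\rho^{-1}\,\nabla\cdot(u\cdot\nabla u)$, where $\rho=\rho_t$; (III) $(u,\rho,p)$ solves the inhomogeneous incompressible Euler equations $$\partial_t(\rho u)+\nabla\cdot(\rho u\otimes u)+\nabla p=0,\qquad \nabla\cdot u=0,\qquad \partial_t\rho+u\cdot\nabla\rho=0 .$$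
   Context: $\mathsf{SDiff}(D)$ is the group of smooth diffeomorphisms $X$ of $D=\mathbb T^d$ with $\det\nabla X=1$. Its tangent space at $X$ is $T_X\mathsf{SDiff}(D)=\{v\circ X: v \text{ a smooth divergence-free vector field on } D\}$. A geodesic of $(\mathsf{SDiff}(D),\mathsf G)$ is a smooth curve $t\mapsto X_t\in\mathsf{SDiff}(D)$ that is a critical point of the energy $\frac12\int \mathsf G_{X_t}(\dot X_t,\dot X_t)\,dt$ among smooth curves in $\mathsf{SDiff}(D)$ with the same endpoints; equivalently $\ddot X_t$ is $\mathsf G$-orthogonal to $T_{X_t}\mathsf{SDiff}(D)$ for all $t$. For a smooth positive density $\rho$ on $D$ bounded above and away from $0$, $\Delta_\rho\varphi:=\nabla\cdot(\rho^{-1}\nabla\varphi)$, and $\Delta_\rho^{-1}f$ denotes, for smooth $f$ of zero mean, the unique zero-mean smooth solution $\varphi$ of $\Delta_\rho\varphi=f$. *)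

theory Defs
  imports "HOL-Analysis.Analysis"
begin

text \<open>
  The torus is \<open>D = R^d / Z^d\<close> with \<open>d = CARD('n)\<close>. Functions and vector fields on \<open>D\<close> are
  \<open>Z^d\<close>-periodic functions on \<open>real ^ 'n\<close>, integrals over \<open>D\<close> are integrals over the
  fundamental domain \<open>cbox 0 1\<close>, and maps \<open>D \<rightarrow> D\<close> are represented by their lifts
  \<open>real ^ 'n \<Rightarrow> real ^ 'n\<close>, two lifts of the same map differing by lattice vectors.
\<close>

definition int_lattice :: "(real ^ 'n) set" where
  "int_lattice = {k. \<forall>i. k $ i \<in> \<int>}"

definition periodic :: "(real ^ 'n \<Rightarrow> 'b) \<Rightarrow> bool" where
  "periodic f \<longleftrightarrow> (\<forall>x. \<forall>k\<in>int_lattice. f (x + k) = f x)"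

definition torus_map :: "(real ^ 'n \<Rightarrow> real ^ 'n) \<Rightarrow> bool" where
  "torus_map F \<longleftrightarrow> (\<forall>x. \<forall>k\<in>int_lattice. F (x + k) - F x \<in> int_lattice)"

definition torus_eq :: "(real ^ 'n \<Rightarrow> real ^ 'n) \<Rightarrow> (real ^ 'n \<Rightarrow> real ^ 'n) \<Rightarrow> bool" where
  "torus_eq F G \<longleftrightarrow> (\<forall>x. F x - G x \<in> int_lattice)"

definition torus_integral :: "(real ^ 'n \<Rightarrow> real) \<Rightarrow> real" where
  "torus_integral f = integral (cbox 0 1) f"

text \<open>
  Below, \<open>S\<close> is always convex with nonempty interior (a product of nondegenerate intervals and
  full spaces), so that derivatives within \<open>S\<close> are unique; at boundary points they are one-sided.
\<close>

primrec Ck_on :: "nat \<Rightarrow> 'a::euclidean_space set \<Rightarrow> ('a \<Rightarrow> 'b::real_normed_vector) \<Rightarrow> bool" where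
  "Ck_on 0 S f \<longleftrightarrow> continuous_on S f"
| "Ck_on (Suc m) S f \<longleftrightarrow>
     (\<exists>f'. (\<forall>x\<in>S. (f has_derivative f' x) (at x within S)) \<and> (\<forall>v. Ck_on m S (\<lambda>x. f' x v)))"

definition smooth_on :: "'a::euclidean_space set \<Rightarrow> ('a \<Rightarrow> 'b::real_normed_vector) \<Rightarrow> bool" where
  "smooth_on S f \<longleftrightarrow> (\<forall>m. Ck_on m S f)"

subsection \<open>Differential operators\<close>

definition grad :: "(real ^ 'n \<Rightarrow> real) \<Rightarrow> real ^ 'n \<Rightarrow> real ^ 'n" where
  "grad f x = (\<chi> i. frechet_derivative f (at x) (axis i 1))"

definition divg :: "(real ^ 'n \<Rightarrow> real ^ 'n) \<Rightarrow> real ^ 'n \<Rightarrow> real" where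
  "divg v x = (\<Sum>i\<in>UNIV. frechet_derivative v (at x) (axis i 1) $ i)"

definition divg_tensor :: "(real ^ 'n \<Rightarrow> real ^ 'n ^ 'n) \<Rightarrow> real ^ 'n \<Rightarrow> real ^ 'n" where
  "divg_tensor M x = (\<chi> i. divg (\<lambda>y. M y $ i) x)"

definition tensor :: "real ^ 'n \<Rightarrow> real ^ 'n \<Rightarrow> real ^ 'n ^ 'n" where
  "tensor v w = (\<chi> i j. v $ i * w $ j)"

text \<open>\<open>advect v w\<close> is the vector field \<open>v \<cdot> \<nabla>w\<close>.\<close>

definition advect :: "(real ^ 'n \<Rightarrow> real ^ 'n) \<Rightarrow> (real ^ 'n \<Rightarrow> real ^ 'n) \<Rightarrow> real ^ 'n \<Rightarrow> real ^ 'n" where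
  "advect v w x = frechet_derivative w (at x) (v x)"

definition weighted_laplacian ::
    "(real ^ 'n \<Rightarrow> real) \<Rightarrow> (real ^ 'n \<Rightarrow> real) \<Rightarrow> real ^ 'n \<Rightarrow> real" where
  "weighted_laplacian \<rho> \<phi> = divg (\<lambda>x. inverse (\<rho> x) *\<^sub>R grad \<phi> x)"

definition weighted_poisson_solution ::
    "(real ^ 'n \<Rightarrow> real) \<Rightarrow> (real ^ 'n \<Rightarrow> real) \<Rightarrow> (real ^ 'n \<Rightarrow> real) \<Rightarrow> bool" where
  "weighted_poisson_solution \<rho> f \<phi> \<longleftrightarrow>
     smooth_on UNIV \<phi> \<and> periodic \<phi> \<and> torus_integral \<phi> = 0 \<and>
     (\<forall>x. weighted_laplacian \<rho> \<phi> x = f x)"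

definition inv_weighted_laplacian ::
    "(real ^ 'n \<Rightarrow> real) \<Rightarrow> (real ^ 'n \<Rightarrow> real) \<Rightarrow> real ^ 'n \<Rightarrow> real" where
  "inv_weighted_laplacian \<rho> f = (THE \<phi>. weighted_poisson_solution \<rho> f \<phi>)"

subsection \<open>The group of volume-preserving diffeomorphisms and its geodesics\<close>

definition SDiff :: "(real ^ 'n \<Rightarrow> real ^ 'n) set" where
  "SDiff = {F. bij F \<and> smooth_on UNIV F \<and> smooth_on UNIV (inv F) \<and>
               torus_map F \<and> torus_map (inv F) \<and>
               (\<forall>x. det (matrix (frechet_derivative F (at x))) = 1)}"

text \<open>A smooth curve in the group is a family that is jointly smooth in time and space.\<close>

definition smooth_curve :: "real set \<Rightarrow> (real \<Rightarrow> real ^ 'n \<Rightarrow> real ^ 'n) \<Rightarrow> bool" where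
  "smooth_curve I X \<longleftrightarrow>
     smooth_on (I \<times> UNIV) (\<lambda>(t, x). X t x) \<and> (\<forall>t\<in>I. X t \<in> SDiff)"

definition time_deriv ::
    "real set \<Rightarrow> (real \<Rightarrow> real ^ 'n \<Rightarrow> 'b::real_normed_vector) \<Rightarrow> real \<Rightarrow> real ^ 'n \<Rightarrow> 'b" where
  "time_deriv I f t x = vector_derivative (\<lambda>\<tau>. f \<tau> x) (at t within I)"

text \<open>
  Tangent vectors at \<open>X\<close> are maps \<open>v \<circ> X\<close> from the torus to \<open>real ^ 'n\<close>; the expression for the
  metric does not involve the base point.
\<close>

definition weighted_metric ::
    "(real ^ 'n \<Rightarrow> real) \<Rightarrow> (real ^ 'n \<Rightarrow> real ^ 'n) \<Rightarrow> (real ^ 'n \<Rightarrow> real ^ 'n) \<Rightarrow> real" where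
  "weighted_metric \<rho>0 \<xi> \<eta> = torus_integral (\<lambda>x. (\<xi> x \<bullet> \<eta> x) * \<rho>0 x)"

definition energy ::
    "(real ^ 'n \<Rightarrow> real) \<Rightarrow> real \<Rightarrow> real \<Rightarrow> (real \<Rightarrow> real ^ 'n \<Rightarrow> real ^ 'n) \<Rightarrow> real" where
  "energy \<rho>0 a b X = 1 / 2 * integral {a..b}
     (\<lambda>t. weighted_metric \<rho>0 (time_deriv {a..b} X t) (time_deriv {a..b} X t))"

text \<open>
  A smooth variation \<open>Y s\<close> of \<open>X\<close> through curves in the group that agrees with \<open>X\<close> at all times of
  \<open>I\<close> outside the open interval \<open>(a, b)\<close>.
\<close>

definition variation ::
    "real set \<Rightarrow> real \<Rightarrow> real \<Rightarrow> (real \<Rightarrow> real ^ 'n \<Rightarrow> real ^ 'n) \<Rightarrow> real \<Rightarrow>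
     (real \<Rightarrow> real \<Rightarrow> real ^ 'n \<Rightarrow> real ^ 'n) \<Rightarrow> bool" where
  "variation I a b X \<epsilon> Y \<longleftrightarrow>
     smooth_on ({-\<epsilon><..<\<epsilon>} \<times> I \<times> UNIV) (\<lambda>(s, t, x). Y s t x) \<and>
     (\<forall>s\<in>{-\<epsilon><..<\<epsilon>}. \<forall>t\<in>I. Y s t \<in> SDiff) \<and>
     (\<forall>t\<in>I. torus_eq (Y 0 t) (X t)) \<and>
     (\<forall>s\<in>{-\<epsilon><..<\<epsilon>}. \<forall>t\<in>I - {a<..<b}. torus_eq (Y s t) (X t))"

text \<open>
  Critical points of the energy on an arbitrary nondegenerate time interval \<open>I\<close>. If \<open>I = {a..b}\<close>
  is compact, variations over this \<open>a\<close>, \<open>b\<close> are exactly those with fixed endpoints, and variations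
  over smaller intervals are a special case of them.
\<close>

definition geodesic ::
    "real set \<Rightarrow> (real ^ 'n \<Rightarrow> real) \<Rightarrow> (real \<Rightarrow> real ^ 'n \<Rightarrow> real ^ 'n) \<Rightarrow> bool" where
  "geodesic I \<rho>0 X \<longleftrightarrow>
     smooth_curve I X \<and>
     (\<forall>a b \<epsilon> Y. a < b \<and> {a..b} \<subseteq> I \<and> 0 < \<epsilon> \<and> variation I a b X \<epsilon> Y \<longrightarrow>
        ((\<lambda>s. energy \<rho>0 a b (Y s)) has_real_derivative 0) (at 0))"

subsection \<open>The inhomogeneous incompressible Euler equations\<close>

definition smooth_torus_field ::
    "real set \<Rightarrow> (real \<Rightarrow> real ^ 'n \<Rightarrow> 'b::real_normed_vector) \<Rightarrow> bool" where
  "smooth_torus_field I f \<longleftrightarrow>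
     smooth_on (I \<times> UNIV) (\<lambda>(t, x). f t x) \<and> (\<forall>t\<in>I. periodic (f t))"

definition inhomogeneous_euler ::
    "real set \<Rightarrow> (real \<Rightarrow> real ^ 'n \<Rightarrow> real ^ 'n) \<Rightarrow> (real \<Rightarrow> real ^ 'n \<Rightarrow> real) \<Rightarrow>
     (real \<Rightarrow> real ^ 'n \<Rightarrow> real) \<Rightarrow> bool" where
  "inhomogeneous_euler I u \<rho> p \<longleftrightarrow>
     smooth_torus_field I u \<and> smooth_torus_field I \<rho> \<and> smooth_torus_field I p \<and>
     (\<forall>t\<in>I. \<forall>x.
        time_deriv I (\<lambda>\<tau> y. \<rho> \<tau> y *\<^sub>R u \<tau> y) t x
          + divg_tensor (\<lambda>y. \<rho> t y *\<^sub>R tensor (u t y) (u t y)) x + grad (p t) x = 0 \<and>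
        divg (u t) x = 0 \<and>
        time_deriv I \<rho> t x + u t x \<bullet> grad (\<rho> t) x = 0)"

end

theory Submission
  imports Defs
begin

text \<open>
  No elliptic theory is needed. For \<open>k\<close> in the lattice and \<open>e\<close> orthogonal to \<open>k\<close>, the shears
  \<open>y \<mapsto> y + r cos (2\<pi> k \<bullet> y + \<theta>) e\<close> are an explicit one-parameter group of volume-preserving maps,
  and their generators span the divergence-free trigonometric fields. Composing them with \<open>X\<close>, with
  \<open>r = s \<chi>(t)\<close> for a cutoff \<open>\<chi>\<close>, gives variations along which the energy is exactly quadratic in \<open>s\<close>;
  criticality then says that the force \<open>w = (\<rho>\<^sub>0 X'') \<circ> X\<^sup>-\<^sup>1\<close> is orthogonal to all these modes. By completeness
  of the Fourier modes \<open>w\<close> is curl free with zero mean, so the Poincare lemma gives \<open>w = - \<nabla>p\<close> with \<open>p\<close>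
  periodic. In the same way \<open>\<nabla> \<cdot> u = 0\<close> is derived in weak form from the invariance of
  \<open>\<integral> f \<circ> X\<^sub>t\<close>, and the Poisson equation in (II) is the divergence of \<open>\<partial>\<^sub>t u + u \<cdot> \<nabla>u = - \<rho>\<^sup>-\<^sup>1 \<nabla>p\<close>; its solution
  exists because \<open>p\<close> does, and is unique by the energy identity.
\<close>

subsection \<open>Calculus of smooth functions\<close>

text \<open>Shears serve because their flows are explicit: varying along a general divergence-free
  field would mean solving an ODE inside the group, while composition with a shear visibly stays in
  \<open>SDiff\<close>. Two properties of the flow are not part of the definition of a geodesic and
  have to be earned. \<open>SDiff\<close> makes each \<open>inv (X t)\<close> smooth in space only,
  whereas the Eulerian fields need joint smoothness in time and space up to the end points of
  \<open>I\<close>; determinant one makes Cramer's rule free of divisions, which drives an induction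
  on the order. Moreover, lifts represent torus maps only modulo the lattice, so
  \<open>X t (x + k) = X t x + k\<close> has to come from connectedness and the value at time 0.
  Testing against Fourier modes spares two computations: the derivative of a determinant, and the
  exchange of divergence and time derivative for \<open>u\<close>. The mode \<open>k = 0\<close> has
  a task of its own: it gives the zero mean of the force, without which the potential would be
  periodic only up to a linear function.\<close>

lemma Ck_on_cong:
  assumes "\<And>x. x \<in> S \<Longrightarrow> f x = g x"
  shows "Ck_on m S f \<longleftrightarrow> Ck_on m S g"
proof -
  have "Ck_on m S g" if "Ck_on m S f" "\<And>x. x \<in> S \<Longrightarrow> f x = g x" for f g :: "'a \<Rightarrow> 'b"
  proof (cases m)
    case 0
    with that show ?thesis by (simp cong: continuous_on_cong)
  next
    case (Suc k)
    with that(1) obtain f' where f': "\<forall>x\<in>S. (f has_derivative f' x) (at x within S)"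
        "\<forall>v. Ck_on k S (\<lambda>x. f' x v)"
      by auto
    have "\<forall>x\<in>S. (g has_derivative f' x) (at x within S)"
      using f'(1) that(2) has_derivative_transform[of _ S g f] by metis
    with f'(2) Suc show ?thesis by auto
  qed
  with assms show ?thesis by metis
qed

lemma Ck_on_continuous: "Ck_on m S f \<Longrightarrow> continuous_on S f"
  by (cases m) (auto simp: continuous_on_eq_continuous_within intro: has_derivative_continuous)

lemma Ck_on_SucD: "Ck_on (Suc m) S f \<Longrightarrow> Ck_on m S f"
proof (induction m arbitrary: f)
  case 0
  then show ?case using Ck_on_continuous[of "Suc 0" S f] by simp
next
  case (Suc m)
  from Suc.prems obtain f' where f': "\<forall>x\<in>S. (f has_derivative f' x) (at x within S)"
      "\<forall>v. Ck_on (Suc m) S (\<lambda>x. f' x v)"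
    by auto
  have "\<forall>v. Ck_on m S (\<lambda>x. f' x v)"
    using Suc.IH f'(2) by blast
  with f'(1) show ?case by auto
qed

lemma Ck_on_const: "Ck_on m S (\<lambda>x. c)"
proof (induction m arbitrary: c)
  case (Suc m)
  then show ?case by (auto intro!: exI[of _ "\<lambda>x v. 0"])
qed auto

lemma Ck_on_compose_linear:
  assumes "bounded_linear h"
  shows "Ck_on m S f \<Longrightarrow> Ck_on m S (\<lambda>x. h (f x))"
proof (induction m arbitrary: f)
  case 0
  then show ?case
    using assms by (auto intro: bounded_linear.continuous_on)
next
  case (Suc m)
  then obtain f' where f': "\<forall>x\<in>S. (f has_derivative f' x) (at x within S)"
      "\<forall>v. Ck_on m S (\<lambda>x. f' x v)"
    by auto
  with Suc.IH show ?case
    by (auto intro!: exI[of _ "\<lambda>x v. h (f' x v)"] bounded_linear.has_derivative[OF assms])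
qed

lemma Ck_on_ident: "Ck_on m S (\<lambda>x. x)"
  by (cases m) (auto intro!: exI[of _ "\<lambda>x v. v"] Ck_on_const)

lemma Ck_on_add: "Ck_on m S f \<Longrightarrow> Ck_on m S g \<Longrightarrow> Ck_on m S (\<lambda>x. f x + g x)"
proof (induction m arbitrary: f g)
  case 0
  then show ?case by (auto intro: continuous_on_add)
next
  case (Suc m)
  then obtain f' g' where "\<forall>x\<in>S. (f has_derivative f' x) (at x within S)"
      "\<forall>v. Ck_on m S (\<lambda>x. f' x v)" "\<forall>x\<in>S. (g has_derivative g' x) (at x within S)"
      "\<forall>v. Ck_on m S (\<lambda>x. g' x v)"
    by auto
  with Suc.IH show ?case
    by (auto intro!: exI[of _ "\<lambda>x v. f' x v + g' x v"] has_derivative_add)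
qed

lemma Ck_on_bilinear:
  assumes "bounded_bilinear bl"
  shows "Ck_on m S f \<Longrightarrow> Ck_on m S g \<Longrightarrow> Ck_on m S (\<lambda>x. bl (f x) (g x))"
proof (induction m arbitrary: f g)
  case 0
  then show ?case using bounded_bilinear.continuous_on[OF assms] by auto
next
  case (Suc m)
  then obtain f' g' where "\<forall>x\<in>S. (f has_derivative f' x) (at x within S)"
      "\<forall>v. Ck_on m S (\<lambda>x. f' x v)" "\<forall>x\<in>S. (g has_derivative g' x) (at x within S)"
      "\<forall>v. Ck_on m S (\<lambda>x. g' x v)"
    by auto
  moreover have "Ck_on m S f" "Ck_on m S g"
    using Suc.prems Ck_on_SucD by blast+
  ultimately show ?case
    by (auto intro!: exI[of _ "\<lambda>x v. bl (f x) (g' x v) + bl (f' x v) (g x)"]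
        bounded_bilinear.FDERIV[OF assms] Ck_on_add Suc.IH)
qed

lemma Ck_on_sum:
  assumes "\<And>i. i \<in> A \<Longrightarrow> Ck_on m S (f i)"
  shows "Ck_on m S (\<lambda>x. \<Sum>i\<in>A. f i x)"
proof (cases "finite A")
  case True
  then show ?thesis using assms
    by (induction A rule: finite_induct) (auto intro: Ck_on_add Ck_on_const)
qed (simp add: Ck_on_const)

lemma Ck_on_prod:
  fixes f :: "'i \<Rightarrow> 'a::euclidean_space \<Rightarrow> real"
  assumes "\<And>i. i \<in> A \<Longrightarrow> Ck_on m S (f i)"
  shows "Ck_on m S (\<lambda>x. \<Prod>i\<in>A. f i x)"
proof (cases "finite A")
  case True
  then show ?thesis using assms
    by (induction A rule: finite_induct)
      (auto intro: Ck_on_bilinear[OF bounded_bilinear_mult] Ck_on_const)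
qed (simp add: Ck_on_const)

lemma Ck_on_compose:
  fixes f :: "'b::euclidean_space \<Rightarrow> 'c::real_normed_vector"
  shows "Ck_on m T f \<Longrightarrow> Ck_on m S g \<Longrightarrow> g ` S \<subseteq> T \<Longrightarrow> Ck_on m S (\<lambda>x. f (g x))"
proof (induction m arbitrary: f g)
  case 0
  then show ?case by (auto intro: continuous_on_compose2)
next
  case (Suc m)
  then obtain f' g' where f': "\<forall>x\<in>T. (f has_derivative f' x) (at x within T)"
      "\<forall>v. Ck_on m T (\<lambda>x. f' x v)" and g': "\<forall>x\<in>S. (g has_derivative g' x) (at x within S)"
      "\<forall>v. Ck_on m S (\<lambda>x. g' x v)"
    by auto
  \<comment> \<open>In \<open>f' (g x) (g' x v)\<close> the direction varies with \<open>x\<close>,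
    while \<open>Ck_on\<close> controls derivatives in fixed directions only; expanding the
    direction in the basis reduces to those.\<close>
  have "Ck_on m S (\<lambda>x. f' (g x) (g' x v))" for v
  proof -
    have "f' (g x) (g' x v) = (\<Sum>b\<in>Basis. (g' x v \<bullet> b) *\<^sub>R f' (g x) b)" if "x \<in> S" for x
    proof -
      have "linear (f' (g x))"
        using f'(1) that Suc.prems(3) has_derivative_linear by blast
      then have "f' (g x) (\<Sum>b\<in>Basis. (g' x v \<bullet> b) *\<^sub>R b) = (\<Sum>b\<in>Basis. (g' x v \<bullet> b) *\<^sub>R f' (g x) b)"
        by (simp add: linear_sum linear_cmul)
      then show ?thesis by (simp add: euclidean_representation)
    qed
    moreover have "Ck_on m S (\<lambda>x. \<Sum>b\<in>Basis. (g' x v \<bullet> b) *\<^sub>R f' (g x) b)"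
    proof (intro Ck_on_sum Ck_on_bilinear[OF bounded_bilinear_scaleR])
      fix b :: 'b
      show "Ck_on m S (\<lambda>x. g' x v \<bullet> b)"
        using g'(2) by (intro Ck_on_compose_linear[OF bounded_linear_inner_left]) blast
      show "Ck_on m S (\<lambda>x. f' (g x) b)"
        using Suc.IH[of "\<lambda>x. f' x b" g] f'(2) Ck_on_SucD[OF Suc.prems(2)] Suc.prems(3) by blast
    qed
    ultimately show ?thesis
      using Ck_on_cong[of S "\<lambda>x. f' (g x) (g' x v)"
          "\<lambda>x. \<Sum>b\<in>Basis. (g' x v \<bullet> b) *\<^sub>R f' (g x) b" m] by blast
  qed
  moreover have "\<forall>x\<in>S. ((\<lambda>x. f (g x)) has_derivative (\<lambda>v. f' (g x) (g' x v))) (at x within S)"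
  proof
    fix x assume x: "x \<in> S"
    show "((\<lambda>x. f (g x)) has_derivative (\<lambda>v. f' (g x) (g' x v))) (at x within S)"
      by (rule has_derivative_in_compose2[of T f f' g S]) (use f'(1) g'(1) Suc.prems(3) x in blast)+
  qed
  ultimately show ?case
    unfolding Ck_on.simps by (intro exI[of _ "\<lambda>x v. f' (g x) (g' x v)"]) simp
qed

lemma Ck_on_componentwise:
  fixes f :: "'a::euclidean_space \<Rightarrow> 'b::euclidean_space"
  assumes "\<And>b. b \<in> Basis \<Longrightarrow> Ck_on m S (\<lambda>x. f x \<bullet> b)"
  shows "Ck_on m S f"
proof -
  have "Ck_on m S (\<lambda>x. \<Sum>b\<in>Basis. (f x \<bullet> b) *\<^sub>R b)"
    by (intro Ck_on_sum Ck_on_bilinear[OF bounded_bilinear_scaleR] assms Ck_on_const)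
  then show ?thesis by (simp add: euclidean_representation)
qed

lemma Ck_on_Pair:
  fixes f :: "'a::euclidean_space \<Rightarrow> 'b::euclidean_space" and g :: "'a \<Rightarrow> 'c::euclidean_space"
  assumes "Ck_on m S f" "Ck_on m S g"
  shows "Ck_on m S (\<lambda>x. (f x, g x))"
proof -
  have "Ck_on m S (\<lambda>x. (f x, 0) + (0, g x))"
    using assms
    by (intro Ck_on_add Ck_on_compose_linear[of "\<lambda>a. (a, 0)"] Ck_on_compose_linear[of "\<lambda>a. (0, a)"])
      (auto intro!: bounded_linear_Pair bounded_linear_zero bounded_linear_ident)
  then show ?thesis by simp
qed

lemma Ck_on_vec:
  assumes "\<And>i. Ck_on m S (\<lambda>x. f x $ i)"
  shows "Ck_on m S (f :: _ \<Rightarrow> real ^ 'n)"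
  by (rule Ck_on_componentwise) (use assms in \<open>auto simp: Basis_vec_def inner_axis\<close>)

lemma Ck_on_SucI_real:
  fixes f :: "real \<Rightarrow> real"
  assumes "\<And>x. x \<in> S \<Longrightarrow> (f has_real_derivative f' x) (at x within S)" "Ck_on m S f'"
  shows "Ck_on (Suc m) S f"
proof -
  have "Ck_on m S (\<lambda>x. f' x * v)" for v
    using assms(2) by (intro Ck_on_bilinear[OF bounded_bilinear_mult] Ck_on_const)
  with assms(1) show ?thesis
    by (auto intro!: exI[of _ "\<lambda>x v. f' x * v"] simp: has_field_derivative_def)
qed

lemma Ck_on_inverse:
  fixes f :: "'a::euclidean_space \<Rightarrow> real"
  shows "Ck_on m S f \<Longrightarrow> (\<And>x. x \<in> S \<Longrightarrow> f x \<noteq> 0) \<Longrightarrow> Ck_on m S (\<lambda>x. inverse (f x))"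
proof (induction m arbitrary: f)
  case 0
  then show ?case by (auto intro: continuous_on_inverse)
next
  case (Suc m)
  then obtain f' where f': "\<forall>x\<in>S. (f has_derivative f' x) (at x within S)"
      "\<forall>v. Ck_on m S (\<lambda>x. f' x v)"
    by auto
  have i: "Ck_on m S (\<lambda>x. inverse (f x))"
    using Suc Ck_on_SucD by blast
  have "Ck_on m S (\<lambda>x. - (inverse (f x) * f' x v * inverse (f x)))" for v
    using i f'(2)
    by (intro Ck_on_compose_linear[OF bounded_linear_minus[OF bounded_linear_ident]]
        Ck_on_bilinear[OF bounded_bilinear_mult]) auto
  with f'(1) Suc.prems show ?case
    by (auto intro!: exI[of _ "\<lambda>x v. - (inverse (f x) * f' x v * inverse (f x))"]
        has_derivative_inverse)
qed

text \<open>Differentiating a cosine only advances its phase by \<open>pi / 2\<close>; keeping the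
  phase \<open>c\<close> arbitrary closes the induction without a companion statement for the
  sine.\<close>

lemma Ck_on_cos_shift: "Ck_on m S (\<lambda>x::real. cos (x + c))"
proof (induction m arbitrary: c S)
  case 0
  show ?case by (auto intro!: continuous_intros)
next
  case (Suc m)
  show ?case
  proof (rule Ck_on_SucI_real[OF _ Suc[of _ "c + pi / 2"]])
    fix x assume "x \<in> S"
    have "cos (x + (c + pi / 2)) = - sin (x + c)"
      by (simp add: add.assoc[symmetric] cos_add)
    then show "((\<lambda>x. cos (x + c)) has_real_derivative cos (x + (c + pi / 2))) (at x within S)"
      by (auto intro!: derivative_eq_intros)
  qed
qed

lemma smooth_on_continuous: "smooth_on S f \<Longrightarrow> continuous_on S f"
  unfolding smooth_on_def using Ck_on_continuous by blast

lemma smooth_on_const: "smooth_on S (\<lambda>x. c)"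
  unfolding smooth_on_def by (simp add: Ck_on_const)

lemma smooth_on_ident: "smooth_on S (\<lambda>x. x)"
  unfolding smooth_on_def by (simp add: Ck_on_ident)

lemma smooth_on_compose_linear: "bounded_linear h \<Longrightarrow> smooth_on S f \<Longrightarrow> smooth_on S (\<lambda>x. h (f x))"
  unfolding smooth_on_def by (simp add: Ck_on_compose_linear)

lemma smooth_on_add: "smooth_on S f \<Longrightarrow> smooth_on S g \<Longrightarrow> smooth_on S (\<lambda>x. f x + g x)"
  unfolding smooth_on_def by (simp add: Ck_on_add)

lemma smooth_on_bilinear:
  "bounded_bilinear bl \<Longrightarrow> smooth_on S f \<Longrightarrow> smooth_on S g \<Longrightarrow> smooth_on S (\<lambda>x. bl (f x) (g x))"
  unfolding smooth_on_def by (simp add: Ck_on_bilinear)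

lemma smooth_on_cong: "(\<And>x. x \<in> S \<Longrightarrow> f x = g x) \<Longrightarrow> smooth_on S f \<longleftrightarrow> smooth_on S g"
  unfolding smooth_on_def by (simp cong: Ck_on_cong)

lemma smooth_on_sum: "(\<And>i. i \<in> A \<Longrightarrow> smooth_on S (f i)) \<Longrightarrow> smooth_on S (\<lambda>x. \<Sum>i\<in>A. f i x)"
  unfolding smooth_on_def by (simp add: Ck_on_sum)

lemma smooth_on_compose:
  fixes g :: "'b::euclidean_space \<Rightarrow> 'c::real_normed_vector"
  shows "smooth_on T g \<Longrightarrow> smooth_on S h \<Longrightarrow> h ` S \<subseteq> T \<Longrightarrow> smooth_on S (\<lambda>x. g (h x))"
  unfolding smooth_on_def using Ck_on_compose by blast

lemma smooth_on_Pair: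
  fixes f :: "'a::euclidean_space \<Rightarrow> 'b::euclidean_space" and g :: "'a \<Rightarrow> 'c::euclidean_space"
  shows "smooth_on S f \<Longrightarrow> smooth_on S g \<Longrightarrow> smooth_on S (\<lambda>x. (f x, g x))"
  unfolding smooth_on_def by (simp add: Ck_on_Pair)

lemma smooth_on_inverse:
  fixes f :: "'a::euclidean_space \<Rightarrow> real"
  shows "smooth_on S f \<Longrightarrow> (\<And>x. x \<in> S \<Longrightarrow> f x \<noteq> 0) \<Longrightarrow> smooth_on S (\<lambda>x. inverse (f x))"
  unfolding smooth_on_def by (simp add: Ck_on_inverse)

lemma smooth_on_vec:
  fixes f :: "_ \<Rightarrow> real ^ 'n"
  shows "(\<And>i. smooth_on S (\<lambda>x. f x $ i)) \<Longrightarrow> smooth_on S f"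
  unfolding smooth_on_def using Ck_on_vec by blast

lemma smooth_on_cos:
  fixes f :: "'a::euclidean_space \<Rightarrow> real"
  assumes "smooth_on S f"
  shows "smooth_on S (\<lambda>x. cos (f x))"
proof (rule smooth_on_compose[OF _ assms])
  show "smooth_on UNIV (cos :: real \<Rightarrow> real)"
    using Ck_on_cos_shift[of _ UNIV 0] by (simp add: smooth_on_def)
qed simp

lemmas smooth_on_scaleR = smooth_on_bilinear[OF bounded_bilinear_scaleR]
  and smooth_on_mult = smooth_on_bilinear[OF bounded_bilinear_mult]
  and smooth_on_inner = smooth_on_bilinear[OF bounded_bilinear_inner]
  and smooth_on_minus = smooth_on_compose_linear[OF bounded_linear_minus[OF bounded_linear_ident]]
  and smooth_on_fst = smooth_on_compose_linear[OF bounded_linear_fst]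
  and smooth_on_snd = smooth_on_compose_linear[OF bounded_linear_snd]
  and smooth_on_nth = smooth_on_compose_linear[OF bounded_linear_vec_nth]

lemma smooth_on_diff: "smooth_on S f \<Longrightarrow> smooth_on S g \<Longrightarrow> smooth_on S (\<lambda>x. f x - g x)"
  using smooth_on_add[OF _ smooth_on_minus, of S f g] by simp

lemmas smooth_intros = smooth_on_const smooth_on_ident smooth_on_add smooth_on_sum smooth_on_Pair
  smooth_on_scaleR smooth_on_mult smooth_on_inner smooth_on_minus smooth_on_fst smooth_on_snd
  smooth_on_nth smooth_on_diff smooth_on_cos

text \<open>\<open>fat S\<close> is the condition under which derivatives within \<open>S\<close> are unique. Since \<open>Ck_on\<close> asks for a
  possibly different derivative for every order, this uniqueness is what makes the derivative of a
  smooth function smooth.\<close>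

definition fat :: "'a::euclidean_space set \<Rightarrow> bool" where
  "fat S \<longleftrightarrow> (\<forall>x\<in>S. \<forall>i\<in>Basis. \<forall>e>0. \<exists>d. 0 < \<bar>d\<bar> \<and> \<bar>d\<bar> < e \<and> x + d *\<^sub>R i \<in> S)"

lemma fat_UNIV: "fat UNIV"
  unfolding fat_def
proof (intro ballI allI impI)
  fix x i :: 'a and e :: real assume "e > 0"
  then show "\<exists>d. 0 < \<bar>d\<bar> \<and> \<bar>d\<bar> < e \<and> x + d *\<^sub>R i \<in> UNIV"
    by (intro exI[of _ "e / 2"]) simp
qed

lemma fat_interval:
  assumes "is_interval I" "interior I \<noteq> {}"
  shows "fat (I :: real set)"
  unfolding fat_def
proof (intro ballI allI impI)
  fix x i e :: real assume x: "x \<in> I" and i: "i \<in> Basis" and e: "e > 0"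
  obtain y r where r: "r > 0" "ball y r \<subseteq> I"
    using assms(2) by (metis all_not_in_conv mem_interior)
  have "y \<in> I" "y + r / 2 \<in> I"
    using r by (auto simp: dist_real_def subset_iff)
  then obtain z where z: "z \<in> I" "z \<noteq> x"
    using r(1) by (metis add_cancel_right_right half_gt_zero_iff less_irrefl)
  \<comment> \<open>\<open>x\<close> may be an end point of \<open>I\<close>, so the increment
    points towards a second point \<open>z\<close> of \<open>I\<close> and is cut at
    \<open>e / 2\<close>.\<close>
  define d where "d = (if z > x then min (e / 2) (z - x) else - min (e / 2) (x - z))"
  have "x + d \<in> I"
  proof (cases "z > x")
    case True
    then have "x \<le> x + d" "x + d \<le> z" using e by (auto simp: d_def)
    then show ?thesis using assms(1) x z(1) by (meson mem_is_interval_1_I)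
  next
    case False
    then have "x + d \<le> x" "z \<le> x + d" using e z by (auto simp: d_def)
    then show ?thesis using assms(1) x z(1) by (meson mem_is_interval_1_I)
  qed
  then show "\<exists>d. 0 < \<bar>d\<bar> \<and> \<bar>d\<bar> < e \<and> x + d *\<^sub>R i \<in> I"
    using i e z by (intro exI[of _ d]) (auto simp: d_def)
qed

lemma fat_Times:
  assumes "fat S" "fat T"
  shows "fat (S \<times> T)"
  unfolding fat_def
proof (intro ballI allI impI)
  fix z i :: "'a \<times> 'b" and e :: real assume z: "z \<in> S \<times> T" and i: "i \<in> Basis" and e: "e > 0"
  obtain x y where xy: "z = (x, y)" "x \<in> S" "y \<in> T" using z by blast
  from i consider j where "j \<in> Basis" "i = (j, 0)" | j where "j \<in> Basis" "i = (0, j)"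
    by (auto simp: Basis_prod_def)
  then show "\<exists>d. 0 < \<bar>d\<bar> \<and> \<bar>d\<bar> < e \<and> z + d *\<^sub>R i \<in> S \<times> T"
  proof cases
    case 1
    then obtain d where "0 < \<bar>d\<bar>" "\<bar>d\<bar> < e" "x + d *\<^sub>R j \<in> S"
      using assms(1) xy(2) e unfolding fat_def by blast
    with 1 xy show ?thesis by (intro exI[of _ d]) simp
  next
    case 2
    then obtain d where "0 < \<bar>d\<bar>" "\<bar>d\<bar> < e" "y + d *\<^sub>R j \<in> T"
      using assms(2) xy(3) e unfolding fat_def by blast
    with 2 xy show ?thesis by (intro exI[of _ d]) simp
  qed
qed

lemma fat_derivative_unique:
  assumes "fat S" "x \<in> S" "(f has_derivative f') (at x within S)" "(f has_derivative f'') (at x within S)"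
  shows "f' = f''"
proof (rule frechet_derivative_unique_within[OF assms(3,4)])
  show "\<exists>d. 0 < \<bar>d\<bar> \<and> \<bar>d\<bar> < e \<and> x + d *\<^sub>R i \<in> S" if "i \<in> Basis" "e > 0" for i e
    using assms(1,2) that unfolding fat_def by blast
qed

lemma smooth_on_derivative:
  assumes "fat S" "smooth_on S f"
  obtains f' where "\<And>x. x \<in> S \<Longrightarrow> (f has_derivative f' x) (at x within S)"
    "\<And>v. smooth_on S (\<lambda>x. f' x v)"
proof -
  have "Ck_on (Suc 0) S f" using assms(2) by (auto simp: smooth_on_def simp del: Ck_on.simps)
  then obtain f' where f': "\<And>x. x \<in> S \<Longrightarrow> (f has_derivative f' x) (at x within S)" by auto
  have "Ck_on m S (\<lambda>x. f' x v)" for m v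
  proof -
    have "Ck_on (Suc m) S f" using assms(2) by (auto simp: smooth_on_def simp del: Ck_on.simps)
    then obtain g' where g': "\<And>x. x \<in> S \<Longrightarrow> (f has_derivative g' x) (at x within S)"
      "Ck_on m S (\<lambda>x. g' x v)" by auto
    have "g' x = f' x" if "x \<in> S" for x
      using fat_derivative_unique[OF assms(1) that g'(1) f'] that by simp
    with g'(2) show ?thesis by (simp cong: Ck_on_cong)
  qed
  with f' that show thesis by (auto simp: smooth_on_def)
qed

lemma smooth_UNIV_has_derivative:
  assumes "smooth_on UNIV f"
  shows "(f has_derivative frechet_derivative f (at x)) (at x)"
proof -
  obtain f' where "\<And>x. (f has_derivative f' x) (at x)"
    using smooth_on_derivative[OF fat_UNIV assms] by (metis UNIV_I)
  then show ?thesis by (metis frechet_derivative_at)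
qed

lemma smooth_UNIV_frechet_derivative:
  assumes "smooth_on UNIV f"
  shows "smooth_on UNIV (\<lambda>x. frechet_derivative f (at x) v)"
proof -
  obtain f' where f': "\<And>x. (f has_derivative f' x) (at x)" "\<And>v. smooth_on UNIV (\<lambda>x. f' x v)"
    using smooth_on_derivative[OF fat_UNIV assms] by (metis UNIV_I)
  then have "frechet_derivative f (at x) = f' x" for x by (metis frechet_derivative_at)
  with f'(2) show ?thesis by simp
qed

subsection \<open>Volume-preserving maps and torus integrals\<close>

text \<open>The change of variables theorem of the library needs a well-ordered index type, which \<open>'n\<close> is
  not; the following copy of a finite type is well-ordered by an arbitrary enumeration.\<close>

typedef 'a ordered_copy = "UNIV :: 'a set" morphisms of_copy to_copy by simp

lemma bij_of_copy: "bij of_copy" and bij_to_copy: "bij to_copy"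
  using of_copy_inverse to_copy_inverse by (metis UNIV_I o_bij comp_def id_apply ext)+

definition copy_index :: "'a::finite ordered_copy \<Rightarrow> nat" where
  "copy_index = (SOME f. inj f)"

instance ordered_copy :: (finite) finite
proof
  show "finite (UNIV :: 'a ordered_copy set)"
    using bij_to_copy finite_imageI[of UNIV to_copy] by (metis bij_def finite_code)
qed

lemma inj_copy_index: "inj copy_index"
  unfolding copy_index_def
  using finite_imp_inj_to_nat_seg[OF finite[of UNIV]] by (metis someI_ex)

instantiation ordered_copy :: (finite) wellorder
begin

definition "x \<le> y \<longleftrightarrow> copy_index x \<le> copy_index y"
definition "x < y \<longleftrightarrow> copy_index x < copy_index y"

instance
proof
  fix P :: "'a ordered_copy \<Rightarrow> bool" and a
  assume step: "\<And>x. (\<And>y. y < x \<Longrightarrow> P y) \<Longrightarrow> P x"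
  show "P a"
    by (rule measure_induct_rule[of copy_index])
      (rule step, simp add: less_ordered_copy_def)
qed (use inj_copy_index in \<open>auto simp: less_ordered_copy_def less_eq_ordered_copy_def inj_def\<close>)

end

text \<open>Conjugation by \<open>\<sigma>\<close> is a sign-preserving bijection between the
  permutations of the two index types, so the Leibniz sums agree term by term.\<close>

lemma det_reindex:
  fixes A :: "real ^ 'n ^ 'n" and \<sigma> :: "'m::finite \<Rightarrow> 'n::finite"
  assumes "bij \<sigma>"
  shows "det (\<chi> i j. A $ \<sigma> i $ \<sigma> j) = det A"
proof -
  let ?\<mu> = "map_permutation UNIV \<sigma>"
  have inv: "bij (inv \<sigma>)" using assms by (rule bij_imp_bij_inv)
  have "det (\<chi> i j. A $ \<sigma> i $ \<sigma> j) =
      (\<Sum>p | p permutes UNIV. of_int (sign p) * (\<Prod>i\<in>UNIV. A $ \<sigma> i $ \<sigma> (p i)))"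
    unfolding det_def by simp
  also have "\<dots> = (\<Sum>p | p permutes UNIV. of_int (sign (?\<mu> p)) * (\<Prod>i\<in>UNIV. A $ i $ ?\<mu> p i))"
  proof (rule sum.cong[OF refl])
    fix p :: "'m \<Rightarrow> 'm" assume "p \<in> {p. p permutes UNIV}"
    then have p: "p permutes UNIV" by simp
    have "(\<Prod>i\<in>UNIV. A $ i $ ?\<mu> p i) = (\<Prod>i\<in>UNIV. A $ \<sigma> i $ ?\<mu> p (\<sigma> i))"
      using prod.reindex_bij_betw[OF assms, of "\<lambda>i. A $ i $ ?\<mu> p i"] by simp
    also have "\<dots> = (\<Prod>i\<in>UNIV. A $ \<sigma> i $ \<sigma> (p i))"
      using map_permutation_apply[OF bij_is_inj[OF assms]] by simp
    finally show "of_int (sign p) * (\<Prod>i\<in>UNIV. A $ \<sigma> i $ \<sigma> (p i)) =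
        of_int (sign (?\<mu> p)) * (\<Prod>i\<in>UNIV. A $ i $ ?\<mu> p i)"
      using sign_map_permutation[OF bij_is_inj[OF assms] p] by simp
  qed
  also have "\<dots> = (\<Sum>p | p permutes UNIV. of_int (sign p) * (\<Prod>i\<in>UNIV. A $ i $ p i))"
  proof (rule sum.reindex_bij_betw)
    show "bij_betw ?\<mu> {p. p permutes UNIV} {p. p permutes UNIV}"
    proof (rule bij_betw_byWitness[where f' = "map_permutation UNIV (inv \<sigma>)"])
      show "\<forall>p\<in>{p. p permutes UNIV}. map_permutation UNIV (inv \<sigma>) (?\<mu> p) = p"
        using map_permutation_compose_inv[OF assms, of _ "inv \<sigma>"] assms by (simp add: bij_is_inj)
      show "\<forall>p\<in>{p. p permutes UNIV}. ?\<mu> (map_permutation UNIV (inv \<sigma>) p) = p"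
        using map_permutation_compose_inv[OF inv, of _ \<sigma>] assms by (simp add: bij_is_surj surj_f_inv_f)
      show "?\<mu> ` {p. p permutes UNIV} \<subseteq> {p. p permutes UNIV}"
        using map_permutation_permutes[OF assms] by auto
      show "map_permutation UNIV (inv \<sigma>) ` {p. p permutes UNIV} \<subseteq> {p. p permutes UNIV}"
        using map_permutation_permutes[OF inv] by auto
    qed
  qed
  also have "\<dots> = det A" unfolding det_def ..
  finally show ?thesis .
qed

definition reindex :: "('m::finite \<Rightarrow> 'n::finite) \<Rightarrow> real ^ 'n \<Rightarrow> real ^ 'm" where
  "reindex \<sigma> x = (\<chi> i. x $ \<sigma> i)"

lemma bounded_linear_reindex: "bounded_linear (reindex \<sigma> :: real ^ 'n \<Rightarrow> real ^ 'm)"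
  unfolding linear_conv_bounded_linear[symmetric]
  by (rule linearI) (auto simp: reindex_def vec_eq_iff)

lemma prod_Basis_vec: "(\<Prod>b\<in>Basis. (x :: real ^ 'n) \<bullet> b) = (\<Prod>i\<in>UNIV. x $ i)"
proof -
  have "Basis = range (\<lambda>i. axis i (1::real) :: real ^ 'n)"
    by (auto simp: Basis_vec_def)
  moreover have "inj (\<lambda>i. axis i (1::real) :: real ^ 'n)"
    by (auto simp: inj_def axis_eq_axis)
  ultimately have "(\<Prod>b\<in>Basis. x \<bullet> b) = (\<Prod>i\<in>UNIV. x \<bullet> axis i 1)"
    using prod.reindex[of "\<lambda>i. axis i (1::real) :: real ^ 'n" UNIV "\<lambda>b. x \<bullet> b"]
    by (metis (mono_tags, lifting) comp_apply prod.cong)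
  then show ?thesis by (simp add: inner_axis)
qed

text \<open>Lebesgue measure is determined by its values on boxes, and relabelling coordinates turns
  a box into a box with permuted side lengths.\<close>

lemma distr_lborel_reindex:
  fixes \<sigma> :: "'m::finite \<Rightarrow> 'n::finite"
  assumes "bij \<sigma>"
  shows "distr lborel borel (reindex \<sigma>) = (lborel :: (real ^ 'm) measure)"
proof (rule lborel_eqI[symmetric])
  fix l u :: "real ^ 'm"
  assume le: "\<And>b. b \<in> Basis \<Longrightarrow> l \<bullet> b \<le> u \<bullet> b"
  have le': "l $ i \<le> u $ i" for i
    using le[of "axis i 1"] by (simp add: inner_axis)
  let ?R = "reindex (inv \<sigma>) :: real ^ 'm \<Rightarrow> real ^ 'n"
  have [measurable]: "reindex \<sigma> \<in> borel_measurable (borel :: (real ^ 'n) measure)"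
    using bounded_linear_reindex linear_continuous_on borel_measurable_continuous_onI by blast
  have eq: "reindex \<sigma> -` box l u = box (?R l) (?R u)"
  proof -
    have "(\<forall>i. l $ i < x $ \<sigma> i \<and> x $ \<sigma> i < u $ i) \<longleftrightarrow>
        (\<forall>i. l $ inv \<sigma> i < x $ i \<and> x $ i < u $ inv \<sigma> i)" for x :: "real ^ 'n"
      using assms by (metis bij_inv_eq_iff)
    then show ?thesis
      by (auto simp: mem_box_cart reindex_def)
  qed
  have "emeasure (distr lborel borel (reindex \<sigma>)) (box l u) = emeasure lborel (box (?R l) (?R u))"
    by (subst emeasure_distr) (auto simp: eq)
  also have "\<dots> = (\<Prod>b\<in>Basis. (?R u - ?R l) \<bullet> b)"
    by (rule emeasure_lborel_box) (auto simp: Basis_vec_def inner_axis reindex_def le')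
  also have "\<dots> = (\<Prod>i\<in>UNIV. (u - l) $ inv \<sigma> i)"
    by (simp only: prod_Basis_vec) (simp add: reindex_def)
  also have "\<dots> = (\<Prod>i\<in>UNIV. (u - l) $ i)"
    using prod.reindex_bij_betw[OF bij_imp_bij_inv[OF assms], of "\<lambda>i. (u - l) $ i"] by simp
  also have "\<dots> = (\<Prod>b\<in>Basis. (u - l) \<bullet> b)"
    by (simp only: prod_Basis_vec)
  finally show "emeasure (distr lborel borel (reindex \<sigma>)) (box l u) = (\<Prod>b\<in>Basis. (u - l) \<bullet> b)" .
qed simp

text \<open>The preimage of a box under \<open>F\<close> is its image under \<open>G\<close>, whose
  volume the change of variables formula computes with a Jacobian of modulus one. The derivative is
  that of \<open>G\<close>, so the invariance obtained is the one under the inverse of the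
  differentiated map.\<close>

lemma distr_lborel_unit_jacobian_wellorder:
  fixes F G :: "real ^ 'm::{finite,wellorder} \<Rightarrow> real ^ 'm::_"
  assumes FG: "\<And>x. F (G x) = x" "\<And>x. G (F x) = x" and F: "continuous_on UNIV F"
    and G: "\<And>x. (G has_derivative G' x) (at x)" and det: "\<And>x. \<bar>det (matrix (G' x))\<bar> = 1"
  shows "distr lborel borel F = lborel"
proof (rule lborel_eqI[symmetric])
  fix l u :: "real ^ 'm::_"
  assume le: "\<And>b. b \<in> Basis \<Longrightarrow> l \<bullet> b \<le> u \<bullet> b"
  have [measurable]: "F \<in> borel_measurable borel"
    using F borel_measurable_continuous_onI by blast
  have eq: "F -` box l u = G ` box l u"
    using FG by (auto simp: image_iff) metis
  have "((\<lambda>x. 1 :: real) has_integral measure lebesgue (box l u)) (box l u)"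
    by (metis has_integral_integral lmeasurable_box lmeasurable_iff_integrable_on lmeasure_integral)
  then have "((\<lambda>x. \<bar>det (matrix (G' x))\<bar>) has_integral measure lebesgue (box l u)) (box l u)"
    by (simp add: det)
  moreover have "box l u \<in> sets lebesgue" by simp
  moreover have "(G has_derivative G' x) (at x within box l u)" for x
    using G by (rule has_derivative_at_withinI)
  moreover have "inj_on G (box l u)"
    using FG by (metis inj_on_inverseI)
  ultimately have *: "G ` box l u \<in> lmeasurable" "measure lebesgue (G ` box l u) = measure lebesgue (box l u)"
    using has_measure_differentiable_image[of "box l u" G G' "measure lebesgue (box l u)"] by blast+
  have "open (F -` box l u)"
    using F open_box by (metis continuous_on_open_vimage open_UNIV Int_UNIV_right)
  then have b: "G ` box l u \<in> sets borel" by (simp add: eq)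
  have "emeasure (distr lborel borel F) (box l u) = emeasure lborel (G ` box l u)"
    by (subst emeasure_distr) (auto simp: eq)
  also have "\<dots> = emeasure lebesgue (G ` box l u)"
    using b by (simp add: emeasure_completion)
  also have "\<dots> = emeasure lebesgue (box l u)"
    using * by (metis emeasure_eq_measure2 fmeasurableD2 fmeasurable_def lmeasurable_box)
  also have "\<dots> = (\<Prod>b\<in>Basis. (u - l) \<bullet> b)"
    using le by (simp add: emeasure_completion)
  finally show "emeasure (distr lborel borel F) (box l u) = (\<Prod>b\<in>Basis. (u - l) \<bullet> b)" .
qed simp

text \<open>Conjugation by the relabelling of coordinates moves the problem to the well-ordered
  index type: the relabelling preserves Lebesgue measure and, by \<open>det_reindex\<close>, the
  Jacobian.\<close>

lemma distr_lborel_unit_jacobian: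
  fixes F G :: "real ^ 'n \<Rightarrow> real ^ 'n"
  assumes FG: "\<And>x. F (G x) = x" "\<And>x. G (F x) = x" and F: "continuous_on UNIV F"
    and G: "\<And>x. (G has_derivative G' x) (at x)" and det: "\<And>x. det (matrix (G' x)) = 1"
  shows "distr lborel borel F = lborel"
proof -
  let ?R = "reindex of_copy :: real ^ 'n \<Rightarrow> real ^ 'n ordered_copy"
  let ?R' = "reindex to_copy :: real ^ 'n ordered_copy \<Rightarrow> real ^ 'n"
  have RR: "?R (?R' y) = y" "?R' (?R x) = x" for x y
    by (simp_all add: reindex_def vec_eq_iff of_copy_inverse to_copy_inverse)
  have cont: "continuous_on UNIV ?R" "continuous_on UNIV ?R'"
    using bounded_linear_reindex linear_continuous_on by blast+
  let ?F = "\<lambda>y. ?R (F (?R' y))" and ?G = "\<lambda>y. ?R (G (?R' y))"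
  have "distr lborel borel ?F = lborel"
  proof (rule distr_lborel_unit_jacobian_wellorder[of ?F ?G "\<lambda>y v. ?R (G' (?R' y) (?R' v))"])
    show "?F (?G x) = x" "?G (?F x) = x" for x by (simp_all add: RR FG)
    show "continuous_on UNIV ?F"
      by (intro continuous_on_compose2[OF cont(1)] continuous_on_compose2[OF F] cont(2)) auto
    fix y
    show "(?G has_derivative (\<lambda>v. ?R (G' (?R' y) (?R' v)))) (at y)"
      by (rule bounded_linear.has_derivative[OF bounded_linear_reindex]
          has_derivative_compose[OF bounded_linear_imp_has_derivative[OF bounded_linear_reindex] G])+
    have "matrix (\<lambda>v. ?R (G' (?R' y) (?R' v))) = (\<chi> i j. matrix (G' (?R' y)) $ of_copy i $ of_copy j)"
    proof -
      have "?R' (axis j 1) = axis (of_copy j) 1" for j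
        by (auto simp: reindex_def axis_def vec_eq_iff to_copy_inverse of_copy_inverse)
      then show ?thesis
        by (simp add: matrix_def reindex_def)
    qed
    then show "\<bar>det (matrix (\<lambda>v. ?R (G' (?R' y) (?R' v))))\<bar> = 1"
      by (simp add: det_reindex[OF bij_of_copy] det)
  qed
  note 1 = this
  have [measurable]: "F \<in> borel_measurable borel" "?R \<in> borel_measurable borel" "?R' \<in> borel_measurable borel"
    using F cont borel_measurable_continuous_onI by blast+
  have "distr lborel borel F = distr (distr lborel borel ?R') borel F"
    by (simp add: distr_lborel_reindex[OF bij_to_copy])
  also have "\<dots> = distr lborel borel (F \<circ> ?R')"
    by (subst distr_distr) auto
  also have "F \<circ> ?R' = ?R' \<circ> ?F"
    by (simp add: fun_eq_iff RR)
  also have "distr lborel borel (?R' \<circ> ?F) = distr (distr lborel borel ?F) borel ?R'"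
    by (subst distr_distr) auto
  also have "\<dots> = lborel"
    by (simp add: 1 distr_lborel_reindex[OF bij_to_copy])
  finally show ?thesis .
qed

section \<open>Lattice translates and fundamental domains\<close>

lemma int_lattice_0: "0 \<in> int_lattice"
  and int_lattice_add: "k \<in> int_lattice \<Longrightarrow> l \<in> int_lattice \<Longrightarrow> k + l \<in> int_lattice"
  and int_lattice_minus: "k \<in> int_lattice \<Longrightarrow> - k \<in> int_lattice"
  and int_lattice_diff: "k \<in> int_lattice \<Longrightarrow> l \<in> int_lattice \<Longrightarrow> k - l \<in> int_lattice"
  and int_lattice_axis: "axis i 1 \<in> int_lattice"
  by (auto simp: int_lattice_def axis_def)

lemma countable_int_lattice: "countable (int_lattice :: (real ^ 'n) set)"
proof (rule countable_subset)
  show "int_lattice \<subseteq> range (\<lambda>f :: 'n \<Rightarrow> int. (\<chi> i. of_int (f i)) :: real ^ 'n)"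
  proof
    fix k :: "real ^ 'n" assume "k \<in> int_lattice"
    then have "k = (\<chi> i. of_int \<lfloor>k $ i\<rfloor>)"
      by (auto simp: int_lattice_def vec_eq_iff elim!: Ints_cases)
    then show "k \<in> range (\<lambda>f :: 'n \<Rightarrow> int. (\<chi> i. of_int (f i)) :: real ^ 'n)"
      using rangeI[of "\<lambda>f :: 'n \<Rightarrow> int. (\<chi> i. of_int (f i)) :: real ^ 'n" "\<lambda>i. \<lfloor>k $ i\<rfloor>"] by simp
  qed
qed simp

text \<open>Half-open, unlike the cube in \<open>torus_integral\<close>, so that every point has
  exactly one representative modulo the lattice.\<close>

definition unit_cell :: "(real ^ 'n) set" where
  "unit_cell = {x. \<forall>i. 0 \<le> x $ i \<and> x $ i < 1}"

definition fundamental_domain :: "(real ^ 'n) set \<Rightarrow> bool" where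
  "fundamental_domain A \<longleftrightarrow> A \<in> sets borel \<and> (\<forall>x. \<exists>!k. k \<in> int_lattice \<and> x - k \<in> A)"

lemma unit_cell_borel: "unit_cell \<in> sets borel"
proof -
  have eq: "unit_cell = (\<Inter>i. {x :: real ^ 'n. 0 \<le> x $ i} \<inter> {x. x $ i < 1})"
    by (auto simp: unit_cell_def)
  have "{x :: real ^ 'n. 0 \<le> x $ i} \<inter> {x. x $ i < 1} \<in> sets borel" for i
    by (intro sets.Int borel_closed borel_open)
      (auto intro!: closed_Collect_le open_Collect_less continuous_intros)
  then show ?thesis
    unfolding eq by (intro sets.finite_INT) auto
qed

lemma fundamental_domain_unit_cell: "fundamental_domain unit_cell"
  unfolding fundamental_domain_def
proof (intro conjI unit_cell_borel allI)
  fix x :: "real ^ 'n"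
  show "\<exists>!k. k \<in> int_lattice \<and> x - k \<in> unit_cell"
  proof (rule ex1I[of _ "\<chi> i. of_int \<lfloor>x $ i\<rfloor>"])
    show "(\<chi> i. of_int \<lfloor>x $ i\<rfloor>) \<in> int_lattice \<and> x - (\<chi> i. of_int \<lfloor>x $ i\<rfloor>) \<in> unit_cell"
      by (auto simp: int_lattice_def unit_cell_def) linarith
  next
    fix k assume k: "k \<in> int_lattice \<and> x - k \<in> unit_cell"
    show "k = (\<chi> i. of_int \<lfloor>x $ i\<rfloor>)"
      unfolding vec_eq_iff
    proof
      fix i
      obtain z where z: "k $ i = of_int z"
        using k by (auto simp: int_lattice_def elim!: Ints_cases)
      have "0 \<le> x $ i - k $ i" "x $ i - k $ i < 1"
        using k by (auto simp: unit_cell_def)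
      then have "\<lfloor>x $ i\<rfloor> = z" using z by (simp add: floor_eq_iff)
      with z show "k $ i = (\<chi> i. of_int \<lfloor>x $ i\<rfloor>) $ i" by simp
    qed
  qed
qed

lemma nn_integral_lborel_shift:
  fixes f :: "real ^ 'n \<Rightarrow> ennreal"
  assumes "f \<in> borel_measurable borel"
  shows "(\<integral>\<^sup>+x. f (c + x) \<partial>lborel) = (\<integral>\<^sup>+x. f x \<partial>lborel)"
proof -
  have "(\<integral>\<^sup>+x. f x \<partial>lborel) = (\<integral>\<^sup>+x. f x \<partial>(distr lborel borel ((+) c)))"
    by (simp add: lborel_distr_plus)
  also have "\<dots> = (\<integral>\<^sup>+x. f (c + x) \<partial>lborel)"
    using assms by (subst nn_integral_distr) auto
  finally show ?thesis ..
qed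

text \<open>The lattice translates of \<open>A\<close> partition space. This partition of unity is
  what \<open>nn_integral_fundamental_domain\<close> inserts into integrals.\<close>

lemma fundamental_domain_indicator:
  fixes A :: "(real ^ 'n) set"
  assumes "fundamental_domain A"
  shows "(\<integral>\<^sup>+k. indicator A (x - k) \<partial>count_space int_lattice) = (1 :: ennreal)"
proof -
  have "\<exists>!k. k \<in> int_lattice \<and> x - k \<in> A"
    using assms unfolding fundamental_domain_def by (elim conjE allE)
  then obtain k0 where k0: "k0 \<in> int_lattice" "x - k0 \<in> A"
      and uniq: "\<forall>k. k \<in> int_lattice \<and> x - k \<in> A \<longrightarrow> k = k0"
    unfolding Ex1_def by (elim exE conjE) rule
  have "(\<integral>\<^sup>+k. indicator A (x - k) \<partial>count_space int_lattice) =
      (\<integral>\<^sup>+k. indicator {k0} k \<partial>count_space int_lattice)"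
  proof (rule nn_integral_cong)
    fix k :: "real ^ 'n" assume "k \<in> space (count_space int_lattice)"
    then show "indicator A (x - k) = (indicator {k0} k :: ennreal)"
      using k0(2) uniq by (auto simp: indicator_def)
  qed
  also have "\<dots> = emeasure (count_space int_lattice) {k0}"
    by (rule nn_integral_indicator) (use k0(1) in simp)
  also have "\<dots> = 1"
    using k0 by simp
  finally show ?thesis .
qed

text \<open>The integral over \<open>A\<close> is cut into pieces by the translates of
  \<open>B\<close>, each piece is moved by its lattice vector, under which \<open>f\<close> is
  invariant, and the pieces reassemble to the integral over \<open>B\<close>. With values in
  \<open>ennreal\<close> the exchange of sum and integral raises no question of
  integrability.\<close>

lemma nn_integral_fundamental_domain:
  fixes f :: "real ^ 'n \<Rightarrow> ennreal"
  assumes f: "f \<in> borel_measurable borel" and per: "periodic f"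
    and A: "fundamental_domain A" and B: "fundamental_domain B"
  shows "(\<integral>\<^sup>+x. f x * indicator A x \<partial>lborel) = (\<integral>\<^sup>+x. f x * indicator B x \<partial>lborel)"
proof -
  note [measurable] = f
  have [measurable]: "A \<in> sets borel" "B \<in> sets borel"
    using A B by (auto simp: fundamental_domain_def)
  have "(\<integral>\<^sup>+x. f x * indicator A x \<partial>lborel) =
      (\<integral>\<^sup>+x. \<integral>\<^sup>+k. f x * indicator A x * indicator B (x - k) \<partial>count_space int_lattice \<partial>lborel)"
    by (simp add: nn_integral_cmult fundamental_domain_indicator[OF B])
  also have "\<dots> = (\<integral>\<^sup>+k. \<integral>\<^sup>+x. f x * indicator A x * indicator B (x - k) \<partial>lborel \<partial>count_space int_lattice)"
    by (intro nn_integral_count_space_nn_integral countable_int_lattice) measurable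
  also have "\<dots> = (\<integral>\<^sup>+k. \<integral>\<^sup>+x. f x * indicator B x * indicator A (x + k) \<partial>lborel \<partial>count_space int_lattice)"
  proof (rule nn_integral_cong)
    fix k :: "real ^ 'n" assume "k \<in> space (count_space int_lattice)"
    then have k: "f (k + x) = f x" for x
      using per by (simp add: periodic_def add.commute[of k])
    show "(\<integral>\<^sup>+x. f x * indicator A x * indicator B (x - k) \<partial>lborel) =
        (\<integral>\<^sup>+x. f x * indicator B x * indicator A (x + k) \<partial>lborel)"
      by (subst nn_integral_lborel_shift[symmetric, of _ k]) (auto simp: k add.commute[of _ k] mult_ac)
  qed
  also have "\<dots> = (\<integral>\<^sup>+x. \<integral>\<^sup>+k. f x * indicator B x * indicator A (x + k) \<partial>count_space int_lattice \<partial>lborel)"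
    by (intro nn_integral_count_space_nn_integral[symmetric] countable_int_lattice) measurable
  also have "\<dots> = (\<integral>\<^sup>+x. \<integral>\<^sup>+k. f x * indicator B x * indicator A (x - k) \<partial>count_space int_lattice \<partial>lborel)"
  proof (rule nn_integral_cong)
    fix x :: "real ^ 'n"
    have "bij_betw uminus (int_lattice :: (real ^ 'n) set) int_lattice"
      by (rule bij_betwI[of _ _ _ uminus]) (auto intro: int_lattice_minus)
    from nn_integral_bij_count_space[OF this, of "\<lambda>k. f x * indicator B x * indicator A (x + k)"]
    show "(\<integral>\<^sup>+k. f x * indicator B x * indicator A (x + k) \<partial>count_space int_lattice) =
        (\<integral>\<^sup>+k. f x * indicator B x * indicator A (x - k) \<partial>count_space int_lattice)"
      by simp
  qed
  also have "\<dots> = (\<integral>\<^sup>+x. f x * indicator B x \<partial>lborel)"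
    by (simp add: nn_integral_cmult fundamental_domain_indicator[OF A])
  finally show ?thesis .
qed

text \<open>The closed cube and the half-open cell differ only by faces, a null set.\<close>

lemma torus_integral_nn_integral:
  fixes f :: "real ^ 'n \<Rightarrow> real"
  assumes f: "continuous_on UNIV f" and nonneg: "\<And>x. f x \<ge> 0"
  shows "ennreal (torus_integral f) = (\<integral>\<^sup>+x. ennreal (f x) * indicator unit_cell x \<partial>lborel)"
proof -
  have [measurable]: "f \<in> borel_measurable borel"
    using f borel_measurable_continuous_onI by blast
  have "(f has_integral torus_integral f) (cbox 0 1)"
    unfolding torus_integral_def
    by (intro integrable_integral integrable_continuous continuous_on_subset[OF f]) auto
  then have "((\<lambda>x. if x \<in> cbox 0 1 then f x else 0) has_integral torus_integral f) UNIV"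
    by (simp add: has_integral_restrict_UNIV)
  then have "ennreal (torus_integral f) = (\<integral>\<^sup>+x. ennreal (if x \<in> cbox 0 1 then f x else 0) \<partial>lborel)"
    using nonneg by (subst nn_integral_has_integral_lborel) (auto simp: measurable_If_set)
  also have "\<dots> = (\<integral>\<^sup>+x. ennreal (f x) * indicator unit_cell x \<partial>lborel)"
  proof (rule nn_integral_cong_AE)
    have "emeasure lborel (cbox 0 1 - box 0 (1 :: real ^ 'n)) = 0"
    proof (subst emeasure_Diff)
      show "emeasure lborel (box 0 (1 :: real ^ 'n)) \<noteq> \<infinity>"
        using emeasure_lborel_box_finite[of 0 "1 :: real ^ 'n"] by simp
      have "emeasure lborel (cbox 0 (1 :: real ^ 'n)) = emeasure lborel (box 0 (1 :: real ^ 'n))"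
        unfolding emeasure_lborel_cbox_eq emeasure_lborel_box_eq ..
      then show "emeasure lborel (cbox 0 (1 :: real ^ 'n)) - emeasure lborel (box 0 (1 :: real ^ 'n)) = 0"
        using \<open>emeasure lborel (box 0 (1 :: real ^ 'n)) \<noteq> \<infinity>\<close>  by simp
    qed (auto simp: box_subset_cbox)
    then have "cbox 0 1 - box 0 (1 :: real ^ 'n) \<in> null_sets lborel"
      by (intro null_setsI) auto
    then have "AE x in lborel. x \<notin> cbox 0 1 - box 0 (1 :: real ^ 'n)"
      by (rule AE_not_in)
    then show "AE x in lborel. ennreal (if x \<in> cbox 0 1 then f x else 0) =
        ennreal (f x) * indicator unit_cell x"
    proof (rule AE_mp, intro AE_I2 impI)
      fix x :: "real ^ 'n" assume "x \<notin> cbox 0 1 - box 0 1"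
      then show "ennreal (if x \<in> cbox 0 1 then f x else 0) = ennreal (f x) * indicator unit_cell x"
        by (auto simp: mem_box_cart unit_cell_def indicator_def less_imp_le)
    qed
  qed
  finally show ?thesis .
qed

section \<open>Elementary properties of torus integrals\<close>

lemma continuous_integrable_cbox:
  "continuous_on UNIV f \<Longrightarrow> f integrable_on cbox a b" for f :: "'a::euclidean_space \<Rightarrow> real"
  by (rule integrable_continuous) (rule continuous_on_subset, auto)

lemma torus_integral_add:
  "continuous_on UNIV f \<Longrightarrow> continuous_on UNIV g \<Longrightarrow>
    torus_integral (\<lambda>x. f x + g x) = torus_integral f + torus_integral g"
  unfolding torus_integral_def by (rule integral_add) (auto intro: continuous_integrable_cbox)

lemma torus_integral_diff:
  "continuous_on UNIV f \<Longrightarrow> continuous_on UNIV g \<Longrightarrow>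
    torus_integral (\<lambda>x. f x - g x) = torus_integral f - torus_integral g"
  unfolding torus_integral_def by (rule integral_diff) (auto intro: continuous_integrable_cbox)

lemma torus_integral_cmult: "torus_integral (\<lambda>x. c * f x) = c * torus_integral f"
  unfolding torus_integral_def by simp

lemma torus_integral_minus: "torus_integral (\<lambda>x. - f x) = - torus_integral f"
  unfolding torus_integral_def by simp

lemma torus_integral_sum:
  "finite A \<Longrightarrow> (\<And>i. i \<in> A \<Longrightarrow> continuous_on UNIV (f i)) \<Longrightarrow>
    torus_integral (\<lambda>x. \<Sum>i\<in>A. f i x) = (\<Sum>i\<in>A. torus_integral (f i))"
  unfolding torus_integral_def by (rule integral_sum) (auto intro: continuous_integrable_cbox)

lemma torus_integral_const: "torus_integral (\<lambda>x :: real ^ 'n. c) = c"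
proof -
  have "measure lborel (cbox 0 (1 :: real ^ 'n)) = 1"
    by (subst content_cbox_cart) (auto simp: interval_ne_empty_cart)
  then show ?thesis unfolding torus_integral_def by simp
qed

lemma torus_translate_to_cell:
  obtains k where "k \<in> int_lattice" "x - k \<in> cbox 0 (1 :: real ^ 'n)"
proof -
  have "\<exists>!k. k \<in> int_lattice \<and> x - k \<in> unit_cell"
    using fundamental_domain_unit_cell unfolding fundamental_domain_def by (elim conjE allE)
  then obtain k where "k \<in> int_lattice" "x - k \<in> unit_cell"
    by blast
  with that show thesis by (auto simp: unit_cell_def mem_box_cart less_imp_le)
qed

lemma periodic_minus: "periodic f \<Longrightarrow> k \<in> int_lattice \<Longrightarrow> f (x - k) = f x"
  unfolding periodic_def using int_lattice_minus by (metis diff_conv_add_uminus)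

lemma periodic_bounded:
  fixes f :: "real ^ 'n \<Rightarrow> real"
  assumes "continuous_on UNIV f" "periodic f"
  obtains M where "\<And>x. \<bar>f x\<bar> \<le> M"
proof -
  have "compact (f ` cbox 0 1)"
    by (intro compact_continuous_image continuous_on_subset[OF assms(1)]) auto
  then obtain M where M: "\<And>x. x \<in> cbox 0 1 \<Longrightarrow> \<bar>f x\<bar> \<le> M"
    using compact_imp_bounded[of "f ` cbox 0 1"] by (auto simp: bounded_iff)
  have "\<bar>f x\<bar> \<le> M" for x
  proof -
    obtain k where "k \<in> int_lattice" "x - k \<in> cbox 0 1" by (rule torus_translate_to_cell)
    then show ?thesis using M[of "x - k"] periodic_minus[OF assms(2)] by simp
  qed
  with that show thesis .
qed

lemma torus_integral_nonneg_eq_0: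
  fixes f :: "real ^ 'n \<Rightarrow> real"
  assumes "continuous_on UNIV f" "periodic f" "\<And>x. f x \<ge> 0" "torus_integral f = 0"
  shows "f x = 0"
proof -
  have *: "f y = 0" if "y \<in> cbox 0 1" for y
  proof -
    have "(f has_integral 0) (cbox 0 1)"
      using assms(4) continuous_integrable_cbox[OF assms(1)] unfolding torus_integral_def
      by (metis integrable_integral)
    moreover have "box 0 (1 :: real ^ 'n) \<noteq> {}" by (auto simp: interval_ne_empty_cart)
    ultimately show ?thesis
      using that assms(1,3) by (intro has_integral_0_cbox_imp_0[of 0 1 f]) (auto intro: continuous_on_subset)
  qed
  obtain k where "k \<in> int_lattice" "x - k \<in> cbox 0 1" by (rule torus_translate_to_cell)
  then show ?thesis using *[of "x - k"] periodic_minus[OF assms(2)] by simp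
qed

text \<open>Since \<open>F\<close> commutes with lattice translations, it maps the unit cell to
  another fundamental domain; invariance of Lebesgue measure moves the integral there, and a
  periodic function has the same integral over every fundamental domain.\<close>

lemma torus_integral_compose:
  fixes f :: "real ^ 'n \<Rightarrow> real"
  assumes f: "continuous_on UNIV f" "periodic f"
    and F: "continuous_on UNIV F" "bij F" "distr lborel borel F = lborel"
    and trans: "\<And>x k. k \<in> int_lattice \<Longrightarrow> F (x + k) = F x + k"
  shows "torus_integral (\<lambda>x. f (F x)) = torus_integral f"
proof -
  obtain M where M: "\<And>x. \<bar>f x\<bar> \<le> M" using periodic_bounded[OF f] by blast
  \<comment> \<open>Adding a bound makes the integrand nonnegative, as the \<open>ennreal\<close>
    integrals require; the constant cancels at the end.\<close>
  define g where "g x = f x + M" for x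
  have g: "continuous_on UNIV g" "periodic g"
    using f unfolding g_def[abs_def] periodic_def by (auto intro!: continuous_intros)
  have g0: "g x \<ge> 0" for x
    using M[of x] unfolding g_def by linarith
  have gF: "continuous_on UNIV (\<lambda>x. g (F x))"
    using continuous_on_compose2[OF g(1) F(1)] by simp
  have [measurable]: "F \<in> borel_measurable borel" "g \<in> borel_measurable borel"
    using F(1) g(1) borel_measurable_continuous_onI by blast+
  have inv: "inv F (F x) = x" "F (inv F x) = x" for x
    using F(2) by (simp_all add: bij_is_inj bij_is_surj surj_f_inv_f)
  \<comment> \<open>By invariance of domain. Measurability of \<open>inv F\<close> makes the image
    of the cell, written as a preimage under \<open>inv F\<close>, a Borel set.\<close>
  have "continuous_on UNIV (inv F)"
  proof -
    obtain G where "homeomorphism UNIV UNIV F G"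
      using invariance_of_domain_homeomorphism[of UNIV F] F by (auto simp: bij_def)
    then have "continuous_on UNIV G" "\<And>x. G (F x) = x" by (auto simp: homeomorphism_def)
    moreover from this(2) have "G = inv F"
      using F(2) inv(2) by (metis ext)
    ultimately show ?thesis by simp
  qed
  then have [measurable]: "inv F \<in> borel_measurable borel"
    using borel_measurable_continuous_onI by blast
  let ?A = "inv F -` unit_cell"
  have A: "fundamental_domain ?A"
    unfolding fundamental_domain_def
  proof (intro conjI allI)
    show "?A \<in> sets borel"
      using measurable_sets[of "inv F" borel borel unit_cell] unit_cell_borel by simp
    fix x
    have "inv F (x - k) = inv F x - k" if "k \<in> int_lattice" for k
    proof -
      have "F (inv F x - k) = x - k"
        using trans[OF that, of "inv F x - k"] by (simp add: inv algebra_simps)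
      then show ?thesis by (metis inv(1))
    qed
    then have "(k \<in> int_lattice \<and> x - k \<in> ?A) = (k \<in> int_lattice \<and> inv F x - k \<in> unit_cell)" for k
      by auto
    moreover have "\<exists>!k. k \<in> int_lattice \<and> inv F x - k \<in> unit_cell"
      using fundamental_domain_unit_cell unfolding fundamental_domain_def by blast
    ultimately show "\<exists>!k. k \<in> int_lattice \<and> x - k \<in> ?A"
      by presburger
  qed
  have [measurable]: "?A \<in> sets borel" "unit_cell \<in> sets (borel :: (real ^ 'n) measure)"
    using A fundamental_domain_unit_cell by (auto simp: fundamental_domain_def)
  have "ennreal (torus_integral (\<lambda>x. g (F x))) =
      (\<integral>\<^sup>+x. ennreal (g (F x)) * indicator unit_cell x \<partial>lborel)"
    using gF g0 by (rule torus_integral_nn_integral)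
  also have "\<dots> = (\<integral>\<^sup>+x. ennreal (g (F x)) * indicator ?A (F x) \<partial>lborel)"
    by (simp add: indicator_def inv)
  also have "\<dots> = (\<integral>\<^sup>+x. ennreal (g x) * indicator ?A x \<partial>(distr lborel borel F))"
    by (subst nn_integral_distr) auto
  also have "\<dots> = (\<integral>\<^sup>+x. ennreal (g x) * indicator ?A x \<partial>lborel)"
    by (simp add: F(3))
  also have "\<dots> = (\<integral>\<^sup>+x. ennreal (g x) * indicator unit_cell x \<partial>lborel)"
    using g(2) A by (intro nn_integral_fundamental_domain fundamental_domain_unit_cell)
      (auto simp: periodic_def)
  also have "\<dots> = ennreal (torus_integral g)"
    using torus_integral_nn_integral[OF g(1) g0] by simp
  finally have "torus_integral (\<lambda>x. g (F x)) = torus_integral g"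
    unfolding torus_integral_def using g0
    by (subst (asm) ennreal_inj) (auto intro!: Henstock_Kurzweil_Integration.integral_nonneg
        continuous_integrable_cbox gF g(1))
  moreover have "continuous_on UNIV (\<lambda>x. f (F x))"
    using continuous_on_compose2[OF f(1) F(1)] by simp
  ultimately show ?thesis
    unfolding g_def using f(1) by (simp add: torus_integral_add)
qed

lemma torus_integral_translate:
  fixes f :: "real ^ 'n \<Rightarrow> real"
  assumes "continuous_on UNIV f" "periodic f"
  shows "torus_integral (\<lambda>x. f (x + h)) = torus_integral f"
proof -
  have "bij (\<lambda>x :: real ^ 'n. x + h)"
    by (rule bij_betw_byWitness[where f' = "\<lambda>x. x - h"]) auto
  note bij = this
  have "(\<lambda>x :: real ^ 'n. x + h) = (+) h" by (auto simp: add.commute)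
  then have "distr lborel borel (\<lambda>x :: real ^ 'n. x + h) = lborel"
    by (simp only: lborel_distr_plus)
  note distr = this
  have "continuous_on UNIV (\<lambda>x :: real ^ 'n. x + h)"
    by (intro continuous_intros)
  from torus_integral_compose[OF assms this bij distr] show ?thesis
    by (simp add: ac_simps)
qed

subsection \<open>Fourier modes on the torus\<close>

text \<open>The phase unites cosines and sines in one real family. Products of two waves are sums of
  waves by \<open>wave_mult\<close>, and a derivative in direction \<open>h\<close> shifts the phase
  by \<open>pi / 2\<close> and multiplies by \<open>2 * pi * (k \<bullet> h)\<close>.\<close>

definition wave :: "real ^ 'n \<Rightarrow> real \<Rightarrow> real ^ 'n \<Rightarrow> real" where
  "wave k \<theta> x = cos (2 * pi * (k \<bullet> x) + \<theta>)"

lemma int_lattice_inner: "k \<in> int_lattice \<Longrightarrow> l \<in> int_lattice \<Longrightarrow> k \<bullet> l \<in> \<int>"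
  unfolding inner_vec_def int_lattice_def by (auto intro!: Ints_sum Ints_mult)

lemma periodic_wave:
  fixes k :: "real ^ 'n"
  assumes "k \<in> int_lattice"
  shows "periodic (wave k \<theta>)"
  unfolding periodic_def
proof (intro allI ballI)
  fix x l :: "real ^ 'n" assume "l \<in> int_lattice"
  then obtain n where n: "k \<bullet> l = of_int n"
    using int_lattice_inner[OF assms] by (metis Ints_cases)
  have "2 * pi * (k \<bullet> (x + l)) + \<theta> = 2 * pi * (k \<bullet> x) + \<theta> + 2 * pi * of_int n"
    by (simp add: inner_add_right n algebra_simps)
  then show "wave k \<theta> (x + l) = wave k \<theta> x"
    unfolding wave_def by (simp only: cos_add[of "_ + \<theta>"] cos_int_2pin sin_int_2pin)
qed

lemma continuous_wave: "continuous_on S (wave k \<theta>)"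
  unfolding wave_def by (intro continuous_intros)

lemma wave_has_derivative:
  "(wave k \<theta> has_derivative (\<lambda>h. 2 * pi * (k \<bullet> h) * wave k (\<theta> + pi / 2) x)) (at x within S)"
proof -
  have "wave k (\<theta> + pi / 2) x = - sin (2 * pi * (k \<bullet> x) + \<theta>)"
    unfolding wave_def by (simp add: add.assoc[symmetric] cos_add)
  then show ?thesis
    unfolding wave_def[of k \<theta>, abs_def] by (auto intro!: derivative_eq_intros)
qed

lemma wave_mult:
  "wave k \<theta> x * wave l \<eta> x = (wave (k + l) (\<theta> + \<eta>) x + wave (k - l) (\<theta> - \<eta>) x) / 2"
  unfolding wave_def cos_times_cos by (simp add: inner_add_left inner_diff_left algebra_simps)

text \<open>Multiplying mode \<open>k\<close> by one summand of \<open>K\<close> gives half the sum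
  of the modes \<open>k + axis i 1\<close> and \<open>k - axis i 1\<close>, which are again lattice
  modes. Each further factor \<open>K\<close> therefore reduces to the previous power, for other
  \<open>k\<close> and \<open>\<theta>\<close>.\<close>

lemma wave_power_orthogonal:
  fixes F :: "real ^ 'n \<Rightarrow> real" and \<theta>' :: "'n \<Rightarrow> real"
  assumes F: "continuous_on UNIV F"
    and orth: "\<And>k \<theta>. k \<in> int_lattice \<Longrightarrow> torus_integral (\<lambda>x. F x * wave k \<theta> x) = 0"
  defines "K \<equiv> (\<lambda>x. \<Sum>i\<in>UNIV. wave (axis i 1) (\<theta>' i) x)"
  shows "k \<in> int_lattice \<Longrightarrow> torus_integral (\<lambda>x. F x * K x ^ N * wave k \<theta> x) = 0"
proof (induction N arbitrary: k \<theta>)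
  case 0
  then show ?case using orth by simp
next
  case (Suc N)
  have cK: "continuous_on UNIV K"
    unfolding K_def by (intro continuous_intros continuous_wave)
  let ?e = "\<lambda>i. axis i 1 :: real ^ 'n"
  have "F x * K x ^ Suc N * wave k \<theta> x = (\<Sum>i\<in>UNIV. (1 / 2) *
      (F x * K x ^ N * wave (k + ?e i) (\<theta> + \<theta>' i) x + F x * K x ^ N * wave (k - ?e i) (\<theta> - \<theta>' i) x))" for x
  proof -
    have "F x * K x ^ Suc N * wave k \<theta> x = F x * K x ^ N * (\<Sum>i\<in>UNIV. wave k \<theta> x * wave (?e i) (\<theta>' i) x)"
      by (simp add: K_def sum_distrib_left[symmetric])
    also have "\<dots> = (\<Sum>i\<in>UNIV. F x * K x ^ N * (wave k \<theta> x * wave (?e i) (\<theta>' i) x))"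
      by (rule sum_distrib_left)
    finally show ?thesis
      unfolding wave_mult by (simp add: algebra_simps add_divide_distrib)
  qed
  moreover have "torus_integral (\<lambda>x. \<Sum>i\<in>UNIV. (1 / 2) *
      (F x * K x ^ N * wave (k + ?e i) (\<theta> + \<theta>' i) x + F x * K x ^ N * wave (k - ?e i) (\<theta> - \<theta>' i) x)) = 0"
  proof -
    have c: "continuous_on UNIV (\<lambda>x. F x * K x ^ N * wave l \<eta> x)" for l \<eta>
      by (intro continuous_intros F cK continuous_wave)
    have "torus_integral (\<lambda>x. (1 / 2) * (F x * K x ^ N * wave (k + ?e i) (\<theta> + \<theta>' i) x
        + F x * K x ^ N * wave (k - ?e i) (\<theta> - \<theta>' i) x)) = 0" for i
      using Suc.IH[OF int_lattice_add[OF Suc.prems int_lattice_axis, of i], of "\<theta> + \<theta>' i"]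
        Suc.IH[OF int_lattice_diff[OF Suc.prems int_lattice_axis, of i], of "\<theta> - \<theta>' i"]
      by (simp only: torus_integral_cmult torus_integral_add[OF c c]) simp
    then show ?thesis
      by (subst torus_integral_sum) (auto intro!: continuous_intros c F cK continuous_wave)
  qed
  ultimately show ?case by simp
qed

text \<open>If \<open>F c > 0\<close>, the trigonometric polynomial \<open>K\<close> below is maximal exactly on \<open>c\<close> plus the lattice and
  at most \<open>q < max K\<close> where \<open>F \<le> 0\<close>. Approximating \<open>s \<mapsto> max 0 (s - q)\<close> by polynomials in \<open>K\<close> shows that
  the nonnegative function \<open>F max(0, K - q)\<close> has zero integral.\<close>

theorem wave_complete_pos:
  fixes F :: "real ^ 'n \<Rightarrow> real"
  assumes F: "continuous_on UNIV F" "periodic F"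
    and orth: "\<And>k \<theta>. k \<in> int_lattice \<Longrightarrow> torus_integral (\<lambda>x. F x * wave k \<theta> x) = 0"
  shows "F c \<le> 0"
proof (rule ccontr)
  assume "\<not> F c \<le> 0"
  then have Fc: "F c > 0" by simp
  define K where "K x = (\<Sum>i\<in>UNIV. wave (axis i 1) (- 2 * pi * c $ i) x)" for x :: "real ^ 'n"
  let ?d = "real CARD('n)"
  have K_alt: "K x = (\<Sum>i\<in>UNIV. cos (2 * pi * (x $ i - c $ i)))" for x
    unfolding K_def wave_def by (simp add: inner_axis' algebra_simps)
  have K: "continuous_on UNIV K" "periodic K"
    unfolding K_def
  proof -
    show "continuous_on UNIV (\<lambda>x. \<Sum>i\<in>UNIV. wave (axis i 1) (- 2 * pi * c $ i) x)"
      by (intro continuous_intros continuous_wave)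
    have "wave (axis i 1) \<theta> (x + k) = wave (axis i 1) \<theta> x" if "k \<in> int_lattice" for i \<theta> k and x :: "real ^ 'n"
      using periodic_wave[OF int_lattice_axis] that unfolding periodic_def by blast
    then show "periodic (\<lambda>x. \<Sum>i\<in>UNIV. wave (axis i 1) (- 2 * pi * c $ i) x)"
      unfolding periodic_def by simp
  qed
  have K_bound: "\<bar>K x\<bar> \<le> ?d" for x
  proof -
    have "\<bar>K x\<bar> \<le> (\<Sum>i\<in>(UNIV :: 'n set). 1)"
      unfolding K_alt by (rule order_trans[OF sum_abs]) (rule sum_mono, simp)
    then show ?thesis by simp
  qed
  have K_max: "F x > 0" if "K x = ?d" for x
  proof -
    have "(\<Sum>i\<in>UNIV. 1 - cos (2 * pi * (x $ i - c $ i))) = 0"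
      using that unfolding K_alt by (simp add: sum_subtractf)
    then have "cos (2 * pi * (x $ i - c $ i)) = 1" for i
      by (subst (asm) sum_nonneg_eq_0_iff) auto
    then have "\<exists>n :: int. x $ i - c $ i = of_int n" for i
    proof -
      have "\<exists>n :: int. 2 * pi * (x $ i - c $ i) = of_int n * 2 * pi"
        using \<open>\<And>i. cos (2 * pi * (x $ i - c $ i)) = 1\<close> cos_one_2pi_int by blast
      then obtain n :: int where "2 * pi * (x $ i - c $ i) = 2 * pi * of_int n"
        by (auto simp: mult_ac)
      then have "x $ i - c $ i = of_int n" by (simp only: mult_cancel_left) simp
      then show ?thesis ..
    qed
    then have "x - c \<in> int_lattice"
      unfolding int_lattice_def by (auto simp: Ints_def)
    then have "F x = F c"
      using F(2) unfolding periodic_def by (metis add.commute diff_add_cancel)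
    then show ?thesis using Fc by simp
  qed
  define C where "C = cbox 0 1 \<inter> {x. F x \<le> 0}"
  have C: "compact C"
    unfolding C_def by (intro compact_Int_closed compact_cbox closed_Collect_le F(1) continuous_intros)
  \<comment> \<open>\<open>K\<close> attains its maximum over the compact set \<open>C\<close>, and
    this is not \<open>?d\<close>, because \<open>F\<close> is positive wherever \<open>K\<close>
    equals \<open>?d\<close>. If \<open>C\<close> is empty, any number below \<open>?d\<close>
    serves.\<close>
  obtain q where q: "q < ?d" "\<And>x. x \<in> C \<Longrightarrow> K x \<le> q"
  proof (cases "C = {}")
    case True
    then show ?thesis using that[of "?d - 1"] by simp
  next
    case False
    then obtain y where y: "y \<in> C" "\<And>x. x \<in> C \<Longrightarrow> K x \<le> K y"
      using continuous_attains_sup[OF C False continuous_on_subset[OF K(1)]] by auto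
    have "K y \<noteq> ?d" using K_max[of y] y(1) unfolding C_def by auto
    then have "K y < ?d" using K_bound[of y] by linarith
    then show ?thesis using that y(2) by blast
  qed
  define \<phi> where "\<phi> s = max 0 (s - q)" for s :: real
  have \<phi>: "continuous_on S \<phi>" for S unfolding \<phi>_def by (intro continuous_intros)
  have c\<phi>: "continuous_on UNIV (\<lambda>x. \<phi> (K x))"
    using continuous_on_compose2[OF \<phi> K(1)] by blast
  obtain M where M: "\<And>x. \<bar>F x\<bar> \<le> M" using periodic_bounded[OF F] by blast
  have M0: "M \<ge> 0" using M[of 0] by linarith
  have small: "\<bar>torus_integral (\<lambda>x. F x * \<phi> (K x))\<bar> \<le> M * e" if e: "e > 0" for e
  proof -
    obtain p where p: "real_polynomial_function p" "\<And>s. s \<in> {- ?d..?d} \<Longrightarrow> \<bar>\<phi> s - p s\<bar> < e"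
      using Stone_Weierstrass_real_polynomial_function[OF _ \<phi> e, of "{- ?d..?d}"] by auto
    obtain a m where am: "p = (\<lambda>s. \<Sum>i\<le>m. a i * s ^ i)"
      using p(1) real_polynomial_function_iff_sum by blast
    have cp: "continuous_on UNIV (\<lambda>x. p (K x))"
      unfolding am by (intro continuous_intros K(1))
    \<comment> \<open>The constant 1 is the mode \<open>k = 0\<close> with phase 0; orthogonality to
      it says that each \<open>F x * K x ^ i\<close> has zero integral.\<close>
    have w: "wave 0 0 = (\<lambda>x :: real ^ 'n. 1)" by (simp add: wave_def fun_eq_iff)
    have "torus_integral (\<lambda>x. F x * p (K x)) = torus_integral (\<lambda>x. \<Sum>i\<le>m. a i * (F x * K x ^ i))"
      unfolding am by (simp add: sum_distrib_left algebra_simps)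
    also have "\<dots> = (\<Sum>i\<le>m. a i * torus_integral (\<lambda>x. F x * K x ^ i))"
      unfolding torus_integral_cmult[symmetric]
      by (rule torus_integral_sum) (auto intro!: continuous_intros F K)
    also have "\<dots> = 0"
      using wave_power_orthogonal[OF F(1) orth int_lattice_0, where \<theta>' = "\<lambda>i. - 2 * pi * c $ i" and \<theta> = 0]
      unfolding w K_def by (simp add: sum.neutral)
    finally have "torus_integral (\<lambda>x. F x * \<phi> (K x)) = torus_integral (\<lambda>x. F x * \<phi> (K x) - F x * p (K x))"
      by (subst torus_integral_diff) (auto intro!: continuous_intros F c\<phi> cp)
    also have "\<bar>\<dots>\<bar> \<le> torus_integral (\<lambda>x :: real ^ 'n. M * e)"
    proof -
      have "norm (integral (cbox 0 1) (\<lambda>x. F x * \<phi> (K x) - F x * p (K x))) \<le> integral (cbox 0 (1 :: real ^ 'n)) (\<lambda>x. M * e)"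
      proof (rule integral_norm_bound_integral)
        show "(\<lambda>x. F x * \<phi> (K x) - F x * p (K x)) integrable_on cbox 0 1"
          by (intro continuous_integrable_cbox continuous_intros F c\<phi> cp)
        show "(\<lambda>x. M * e) integrable_on cbox 0 (1 :: real ^ 'n)" by (rule integrable_const)
        fix x
        have "\<bar>\<phi> (K x) - p (K x)\<bar> \<le> e"
          using p(2)[of "K x"] K_bound[of x] by (auto simp: abs_le_iff)
        then have "\<bar>F x\<bar> * \<bar>\<phi> (K x) - p (K x)\<bar> \<le> M * e"
          using M[of x] M0 by (intro mult_mono) auto
        then show "norm (F x * \<phi> (K x) - F x * p (K x)) \<le> M * e"
          by (simp add: right_diff_distrib[symmetric] abs_mult)
      qed
      then show ?thesis by (simp add: torus_integral_def)
    qed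
    finally show ?thesis by (simp add: torus_integral_const)
  qed
  have zero: "torus_integral (\<lambda>x. F x * \<phi> (K x)) = 0"
  proof (rule ccontr)
    assume "\<not> ?thesis"
    then have pos: "\<bar>torus_integral (\<lambda>x. F x * \<phi> (K x))\<bar> > 0" (is "?t > 0") by simp
    \<comment> \<open>The choice of \<open>e\<close> brings \<open>M * e\<close> below half of
      \<open>?t\<close>; dividing by \<open>M + 1\<close> instead of \<open>M\<close> covers
      \<open>M = 0\<close>.\<close>
    have "?t \<le> M * (?t / (M + 1) / 2)" using pos M0 by (intro small) auto
    also have "\<dots> = ?t * (M / (2 * (M + 1)))" by (simp add: mult_ac)
    also have "\<dots> < ?t * 1"
      using pos M0 by (intro mult_strict_left_mono) (auto simp: field_simps)
    finally show False by simp
  qed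
  have "F c * \<phi> (K c) = 0"
  proof (rule torus_integral_nonneg_eq_0[OF _ _ _ zero])
    show "continuous_on UNIV (\<lambda>x. F x * \<phi> (K x))" by (intro continuous_intros F c\<phi>)
    show per: "periodic (\<lambda>x. F x * \<phi> (K x))" using F(2) K(2) by (simp add: periodic_def)
    fix x :: "real ^ 'n"
    obtain k where k: "k \<in> int_lattice" "x - k \<in> cbox 0 1" by (rule torus_translate_to_cell)
    have "F (x - k) * \<phi> (K (x - k)) \<ge> 0"
    proof (cases "x - k \<in> C")
      case True
      then show ?thesis using q(2) by (simp add: \<phi>_def)
    next
      case False
      then have "F (x - k) \<ge> 0" using k(2) by (auto simp: C_def)
      then show ?thesis by (simp add: \<phi>_def)
    qed
    then show "F x * \<phi> (K x) \<ge> 0" using periodic_minus[OF per k(1), of x] by simp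
  qed
  moreover have "K c = ?d" unfolding K_alt by simp
  ultimately show False using Fc q(1) by (simp add: \<phi>_def)
qed

theorem wave_complete:
  fixes F :: "real ^ 'n \<Rightarrow> real"
  assumes "continuous_on UNIV F" "periodic F"
    and "\<And>k \<theta>. k \<in> int_lattice \<Longrightarrow> torus_integral (\<lambda>x. F x * wave k \<theta> x) = 0"
  shows "F c = 0"
proof -
  have "F c \<le> 0" using wave_complete_pos[OF assms] .
  moreover have "- F c \<le> 0"
    using assms by (intro wave_complete_pos[of "\<lambda>x. - F x"])
      (auto intro!: continuous_intros simp: periodic_def torus_integral_minus)
  ultimately show ?thesis by simp
qed

section \<open>Integration by parts on the torus\<close>

lemma torus_integral_swap:
  fixes f :: "real ^ 'n \<Rightarrow> real \<Rightarrow> real"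
  assumes "continuous_on (UNIV \<times> {a..b}) (\<lambda>(x, t). f x t)"
  shows "torus_integral (\<lambda>x. integral {a..b} (f x)) = integral {a..b} (\<lambda>t. torus_integral (\<lambda>x. f x t))"
  unfolding torus_integral_def
proof -
  have "continuous_on (cbox (0, a) (1, b)) (\<lambda>(x, t). f x t)"
    by (rule continuous_on_subset[OF assms]) (auto simp: cbox_Pair_eq)
  from integral_swap_continuous[OF this]
  show "integral (cbox 0 1) (\<lambda>x. integral {a..b} (f x)) = integral {a..b} (\<lambda>t. integral (cbox 0 1) (\<lambda>x. f x t))"
    by simp
qed

lemma periodic_derivative:
  fixes f :: "real ^ 'n \<Rightarrow> 'b::real_normed_vector"
  assumes "periodic f" "\<And>x. (f has_derivative f' x) (at x)"
  shows "periodic f'"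
  unfolding periodic_def
proof (intro allI ballI)
  fix x k :: "real ^ 'n" assume k: "k \<in> int_lattice"
  have "((\<lambda>y. f (y + k)) has_derivative f' (x + k)) (at x)"
  proof -
    have "((\<lambda>y. y + k) has_derivative (\<lambda>h. h)) (at x)"
      by (auto intro!: derivative_eq_intros)
    from has_derivative_compose[OF this assms(2)] show ?thesis .
  qed
  moreover have "(\<lambda>y. f (y + k)) = f" using assms(1) k by (auto simp: periodic_def)
  ultimately show "f' (x + k) = f' x"
    using assms(2) has_derivative_unique by metis
qed

text \<open>The integral of \<open>f (x + h) - f x\<close> vanishes by translation invariance, and equals the average over
  \<open>\<tau>\<close> of the integrals of the translated derivative, which all coincide.\<close>

lemma torus_integral_derivative:
  fixes f :: "real ^ 'n \<Rightarrow> real"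
  assumes f: "periodic f" "\<And>x. (f has_derivative f' x) (at x)" and cont: "continuous_on UNIV (\<lambda>x. f' x h)"
  shows "torus_integral (\<lambda>x. f' x h) = 0"
proof -
  have cf: "continuous_on UNIV f"
    using f(2) by (metis has_derivative_continuous continuous_at_imp_continuous_on)
  have "integral {0..1} (\<lambda>\<tau>. f' (x + \<tau> *\<^sub>R h) h) = f (x + h) - f x" for x
  proof (rule integral_unique)
    have "((\<lambda>\<tau>. f' (x + \<tau> *\<^sub>R h) h) has_integral f (x + 1 *\<^sub>R h) - f (x + 0 *\<^sub>R h)) {0..1}"
    proof (rule fundamental_theorem_of_calculus)
      fix \<tau> :: real
      have "((\<lambda>\<tau>. f (x + \<tau> *\<^sub>R h)) has_derivative (\<lambda>s. f' (x + \<tau> *\<^sub>R h) (s *\<^sub>R h))) (at \<tau> within {0..1})"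
        by (rule has_derivative_compose[OF _ f(2)]) (auto intro!: derivative_eq_intros)
      moreover have "f' (x + \<tau> *\<^sub>R h) (s *\<^sub>R h) = s *\<^sub>R f' (x + \<tau> *\<^sub>R h) h" for s
        using f(2) has_derivative_linear linear_cmul by blast
      ultimately show "((\<lambda>\<tau>. f (x + \<tau> *\<^sub>R h)) has_vector_derivative f' (x + \<tau> *\<^sub>R h) h) (at \<tau> within {0..1})"
        unfolding has_vector_derivative_def by simp
    qed simp
    then show "((\<lambda>\<tau>. f' (x + \<tau> *\<^sub>R h) h) has_integral f (x + h) - f x) {0..1}" by simp
  qed
  then have "torus_integral (\<lambda>x. f (x + h) - f x) = torus_integral (\<lambda>x. integral {0..1} (\<lambda>\<tau>. f' (x + \<tau> *\<^sub>R h) h))"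
    by simp
  also have "\<dots> = integral {0..1} (\<lambda>\<tau>. torus_integral (\<lambda>x. f' (x + \<tau> *\<^sub>R h) h))"
  proof (rule torus_integral_swap)
    show "continuous_on (UNIV \<times> {0..1}) (\<lambda>(x, \<tau>). f' (x + \<tau> *\<^sub>R h) h)"
      unfolding case_prod_beta by (rule continuous_on_compose2[OF cont]) (auto intro!: continuous_intros)
  qed
  also have "\<dots> = torus_integral (\<lambda>x. f' x h)"
  proof -
    have "periodic (\<lambda>x. f' x h)"
      using periodic_derivative[OF f] by (simp add: periodic_def)
    then show ?thesis using torus_integral_translate[OF cont] by simp
  qed
  finally have "torus_integral (\<lambda>x. f' x h) = torus_integral (\<lambda>x. f (x + h) - f x)" ..
  also have "\<dots> = torus_integral (\<lambda>x. f (x + h)) - torus_integral f"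
    by (rule torus_integral_diff) (auto intro!: cf continuous_on_compose2[OF cf] continuous_intros)
  also have "\<dots> = 0" using torus_integral_translate[OF cf f(1)] by simp
  finally show ?thesis .
qed

text \<open>The product of \<open>f\<close> and the wave is periodic, so its directional derivative
  integrates to zero; the term in which the wave is differentiated is again a wave.\<close>

lemma torus_integral_wave_by_parts:
  fixes f :: "real ^ 'n \<Rightarrow> real"
  assumes f: "periodic f" "\<And>x. (f has_derivative f' x) (at x)" and cont: "continuous_on UNIV (\<lambda>x. f' x h)"
    and k: "k \<in> int_lattice"
  shows "torus_integral (\<lambda>x. f' x h * wave k \<theta> x) =
    - (2 * pi * (k \<bullet> h) * torus_integral (\<lambda>x. f x * wave k (\<theta> + pi / 2) x))"
proof -
  have cf: "continuous_on UNIV f"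
    using f(2) by (metis has_derivative_continuous continuous_at_imp_continuous_on)
  let ?g = "\<lambda>x v. f x * (2 * pi * (k \<bullet> v) * wave k (\<theta> + pi / 2) x) + f' x v * wave k \<theta> x"
  have "torus_integral (\<lambda>x. ?g x h) = 0"
  proof (rule torus_integral_derivative[of "\<lambda>x. f x * wave k \<theta> x" ?g h])
    show "periodic (\<lambda>x. f x * wave k \<theta> x)"
      using f(1) periodic_wave[OF k] by (simp add: periodic_def)
    show "((\<lambda>x. f x * wave k \<theta> x) has_derivative ?g x) (at x)" for x
      by (rule has_derivative_mult[OF f(2) wave_has_derivative])
    show "continuous_on UNIV (\<lambda>x. ?g x h)"
      by (intro continuous_intros cf cont continuous_wave)
  qed
  moreover have "torus_integral (\<lambda>x. ?g x h) =
      2 * pi * (k \<bullet> h) * torus_integral (\<lambda>x. f x * wave k (\<theta> + pi / 2) x) + torus_integral (\<lambda>x. f' x h * wave k \<theta> x)"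
    unfolding torus_integral_cmult[symmetric]
    by (subst torus_integral_add[symmetric])
      (auto intro!: continuous_intros cf cont continuous_wave simp: algebra_simps)
  ultimately show ?thesis by simp
qed

subsection \<open>Parametric integrals and time derivatives\<close>

text \<open>Leibniz's rule once per order: the derivative of the integral in a fixed direction
  \<open>v\<close> is the integral of \<open>f'\<close> in direction \<open>(v, 0)\<close>, a
  parametric integral of the same kind with one order less.\<close>

lemma Ck_on_integral:
  fixes f :: "'a::euclidean_space \<Rightarrow> 'b::euclidean_space \<Rightarrow> real"
  assumes S: "convex S"
  shows "Ck_on m (S \<times> cbox a b) (\<lambda>(x, t). f x t) \<Longrightarrow> Ck_on m S (\<lambda>x. integral (cbox a b) (f x))"
proof (induction m arbitrary: f)
  case 0
  then show ?case by (simp add: integral_continuous_on_param)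
next
  case (Suc m)
  have cont: "continuous_on (S \<times> cbox a b) (\<lambda>(x, t). f x t)"
    using Ck_on_continuous[OF Suc.prems] .
  from Suc.prems obtain f' where f': "\<forall>z\<in>S \<times> cbox a b. ((\<lambda>(x, t). f x t) has_derivative f' z) (at z within S \<times> cbox a b)"
    and f'_Ck: "\<forall>v. Ck_on m (S \<times> cbox a b) (\<lambda>z. f' z v)"
    by auto
  \<comment> \<open>Leibniz's rule asks for a continuous operator-valued derivative. In finite
    dimension its continuity follows from that in each basis direction, which is what
    \<open>Ck_on\<close> provides.\<close>
  define fx where "fx x t = Blinfun (\<lambda>v. f' (x, t) (v, 0))" for x t
  have der: "((\<lambda>x. f x t) has_derivative (\<lambda>v. f' (x, t) (v, 0))) (at x within S)" if "x \<in> S" "t \<in> cbox a b" for x t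
  proof -
    have "((\<lambda>x. (x, t)) has_derivative (\<lambda>v. (v, 0))) (at x within S)"
      by (auto intro!: derivative_eq_intros)
    moreover have "((\<lambda>(x, t). f x t) has_derivative f' (x, t)) (at (x, t) within (\<lambda>x. (x, t)) ` S)"
      by (rule has_derivative_subset[of _ _ _ "S \<times> cbox a b"]) (use f' that in auto)
    ultimately show ?thesis
      using diff_chain_within[of "\<lambda>x. (x, t)" "\<lambda>v. (v, 0)" x S "\<lambda>(x, t). f x t" "f' (x, t)"]
      by (simp add: o_def)
  qed
  have app: "blinfun_apply (fx x t) v = f' (x, t) (v, 0)" if "x \<in> S" "t \<in> cbox a b" for x t v
    unfolding fx_def using has_derivative_bounded_linear[OF der[OF that]]
    by (simp add: bounded_linear_Blinfun_apply)
  have cont_fx: "continuous_on (S \<times> cbox a b) (\<lambda>(x, t). fx x t)"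
  proof (rule continuous_on_blinfun_componentwise)
    fix i :: 'a
    have "continuous_on (S \<times> cbox a b) (\<lambda>z. f' z (i, 0))"
      using f'_Ck Ck_on_continuous by blast
    then show "continuous_on (S \<times> cbox a b) (\<lambda>z. blinfun_apply (case z of (x, t) \<Rightarrow> fx x t) i)"
      by (rule continuous_on_eq) (auto simp: app)
  qed
  have "((\<lambda>x. integral (cbox a b) (f x)) has_derivative (\<lambda>v. integral (cbox a b) (\<lambda>t. f' (x, t) (v, 0)))) (at x within S)"
    if x: "x \<in> S" for x
  proof -
    have "((\<lambda>x. integral (cbox a b) (f x)) has_derivative blinfun_apply (integral (cbox a b) (fx x))) (at x within S)"
    proof (rule leibniz_rule[OF _ _ cont_fx x S])
      show "((\<lambda>x. f x t) has_derivative blinfun_apply (fx x t)) (at x within S)" if "x \<in> S" "t \<in> cbox a b" for x t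
      proof -
        have "blinfun_apply (fx x t) = (\<lambda>v. f' (x, t) (v, 0))" using app[OF that] by (rule ext)
        then show ?thesis using der[OF that] by simp
      qed
      show "f x integrable_on cbox a b" if "x \<in> S" for x
        by (intro integrable_continuous continuous_on_compose2[OF cont, of "cbox a b" "\<lambda>t. (x, t)", simplified])
          (use that in \<open>auto intro!: continuous_intros\<close>)
    qed
    moreover have "blinfun_apply (integral (cbox a b) (fx x)) = (\<lambda>v. integral (cbox a b) (\<lambda>t. f' (x, t) (v, 0)))"
    proof
      fix v
      have "continuous_on (cbox a b) (fx x)"
      proof -
        have "continuous_on (cbox a b) (Pair x)" by (intro continuous_intros)
        moreover have "Pair x ` cbox a b \<subseteq> S \<times> cbox a b" using x by auto
        ultimately show ?thesis
          using continuous_on_compose2[OF cont_fx, of "cbox a b" "Pair x"] by simp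
      qed
      then have "fx x integrable_on cbox a b" by (rule integrable_continuous)
      then have "blinfun_apply (integral (cbox a b) (fx x)) v = integral (cbox a b) (\<lambda>t. blinfun_apply (fx x t) v)"
        by (rule blinfun_apply_integral)
      also have "\<dots> = integral (cbox a b) (\<lambda>t. f' (x, t) (v, 0))"
        by (rule integral_cong) (simp add: app x)
      finally show "blinfun_apply (integral (cbox a b) (fx x)) v = integral (cbox a b) (\<lambda>t. f' (x, t) (v, 0))" .
    qed
    ultimately show ?thesis by simp
  qed
  moreover have "Ck_on m S (\<lambda>x. integral (cbox a b) (\<lambda>t. f' (x, t) (v, 0)))" for v
  proof (rule Suc.IH)
    have "Ck_on m (S \<times> cbox a b) (\<lambda>z. f' z (v, 0))" using f'_Ck by blast
    moreover have "(\<lambda>(x, t). f' (x, t) (v, 0)) = (\<lambda>z. f' z (v, 0))"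
      by (auto simp: fun_eq_iff)
    ultimately show "Ck_on m (S \<times> cbox a b) (\<lambda>(x, t). f' (x, t) (v, 0))" by metis
  qed
  ultimately show ?case
    unfolding Ck_on.simps by (intro exI[of _ "\<lambda>x v. integral (cbox a b) (\<lambda>t. f' (x, t) (v, 0))"]) simp
qed

lemma smooth_on_integral:
  fixes f :: "'a::euclidean_space \<Rightarrow> 'b::euclidean_space \<Rightarrow> real"
  assumes "convex S" "smooth_on (S \<times> cbox a b) (\<lambda>(x, t). f x t)"
  shows "smooth_on S (\<lambda>x. integral (cbox a b) (f x))"
  using assms(2) Ck_on_integral[OF assms(1)] unfolding smooth_on_def by blast

locale time_interval =
  fixes I :: "real set"
  assumes interval: "is_interval I" and nondegenerate: "interior I \<noteq> {}"
begin

lemma fat_I: "fat I"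
  using fat_interval interval nondegenerate by blast

lemma fat_prod: "fat (I \<times> (UNIV :: 'a::euclidean_space set))"
  by (intro fat_Times fat_I fat_UNIV)

lemma at_within_I: "t \<in> I \<Longrightarrow> at t within I \<noteq> bot"
  using fat_I unfolding fat_def trivial_limit_within islimpt_approachable
  by (force simp: dist_real_def)

text \<open>A joint derivative \<open>f'\<close> splits into \<open>f' (t, x) (1, 0)\<close> and
  \<open>f' (t, x) (0, v)\<close>. Identifying these with \<open>time_deriv\<close> and
  \<open>frechet_derivative\<close> hands the joint smoothness on to both partial derivatives, also
  at end points of \<open>I\<close>, where the time derivative is one-sided.\<close>

lemma space_time_derivative:
  fixes h :: "real \<Rightarrow> real ^ 'n \<Rightarrow> 'b::real_normed_vector"
  assumes "smooth_on (I \<times> UNIV) (\<lambda>(t, x). h t x)"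
  shows "t \<in> I \<Longrightarrow> ((\<lambda>(t, x). h t x) has_derivative
      (\<lambda>(\<tau>, v). \<tau> *\<^sub>R time_deriv I h t x + frechet_derivative (h t) (at x) v)) (at (t, x) within I \<times> UNIV)"
    and "t \<in> I \<Longrightarrow> ((\<lambda>\<tau>. h \<tau> x) has_vector_derivative time_deriv I h t x) (at t within I)"
    and "t \<in> I \<Longrightarrow> (h t has_derivative frechet_derivative (h t) (at x)) (at x)"
    and "smooth_on (I \<times> UNIV) (\<lambda>(t, x). time_deriv I h t x)"
    and "smooth_on (I \<times> UNIV) (\<lambda>(t, x). frechet_derivative (h t) (at x) v)"
proof -
  obtain f' where f': "\<And>z. z \<in> I \<times> UNIV \<Longrightarrow> ((\<lambda>(t, x). h t x) has_derivative f' z) (at z within I \<times> UNIV)"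
    and sm: "\<And>v. smooth_on (I \<times> UNIV) (\<lambda>z. f' z v)"
    using smooth_on_derivative[OF fat_prod assms] by metis
  have time: "((\<lambda>\<tau>. h \<tau> x) has_vector_derivative f' (t, x) (1, 0)) (at t within I)" if t: "t \<in> I" for t x
  proof -
    have "((\<lambda>\<tau>. (\<tau>, x)) has_derivative (\<lambda>s. (s, 0))) (at t within I)"
      by (auto intro!: derivative_eq_intros)
    moreover have "((\<lambda>(t, x). h t x) has_derivative f' (t, x)) (at (t, x) within (\<lambda>\<tau>. (\<tau>, x)) ` I)"
      by (rule has_derivative_subset[of _ _ _ "I \<times> UNIV"]) (use f' t in auto)
    ultimately have "((\<lambda>\<tau>. h \<tau> x) has_derivative (\<lambda>s. f' (t, x) (s, 0))) (at t within I)"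
      using diff_chain_within[of "\<lambda>\<tau>. (\<tau>, x)" "\<lambda>s. (s, 0)" t I "\<lambda>(t, x). h t x" "f' (t, x)"]
      by (simp add: o_def)
    moreover have "(\<lambda>s. f' (t, x) (s, 0)) = (\<lambda>s. s *\<^sub>R f' (t, x) (1, 0))"
    proof
      fix s
      have "f' (t, x) (s *\<^sub>R (1, 0)) = s *\<^sub>R f' (t, x) (1, 0)"
        using f'[of "(t, x)"] t has_derivative_linear linear_cmul by blast
      then show "f' (t, x) (s, 0) = s *\<^sub>R f' (t, x) (1, 0)" by simp
    qed
    ultimately show ?thesis unfolding has_vector_derivative_def by metis
  qed
  have td: "time_deriv I h t x = f' (t, x) (1, 0)" if "t \<in> I" for t x
    unfolding time_deriv_def using time[OF that] at_within_I[OF that] by (simp add: vector_derivative_within)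
  have space: "(h t has_derivative (\<lambda>v. f' (t, x) (0, v))) (at x)" if t: "t \<in> I" for t x
  proof -
    have "((\<lambda>y. (t, y)) has_derivative (\<lambda>v. (0, v))) (at x)"
      by (auto intro!: derivative_eq_intros)
    moreover have "((\<lambda>(t, x). h t x) has_derivative f' (t, x)) (at (t, x) within range (\<lambda>y. (t, y)))"
      by (rule has_derivative_subset[of _ _ _ "I \<times> UNIV"]) (use f' t in auto)
    ultimately show ?thesis
      using diff_chain_within[of "\<lambda>y. (t, y)" "\<lambda>v. (0, v)" x UNIV "\<lambda>(t, x). h t x" "f' (t, x)"]
      by (simp add: o_def)
  qed
  have fd: "frechet_derivative (h t) (at x) = (\<lambda>v. f' (t, x) (0, v))" if "t \<in> I" for t x
    using frechet_derivative_at[OF space[OF that]] by simp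
  show "((\<lambda>(t, x). h t x) has_derivative
      (\<lambda>(\<tau>, v). \<tau> *\<^sub>R time_deriv I h t x + frechet_derivative (h t) (at x) v)) (at (t, x) within I \<times> UNIV)"
    if t: "t \<in> I"
  proof -
    have lin: "linear (f' (t, x))" using f'[of "(t, x)"] t has_derivative_linear by blast
    have "f' (t, x) = (\<lambda>(\<tau>, v). \<tau> *\<^sub>R time_deriv I h t x + frechet_derivative (h t) (at x) v)"
    proof (rule ext, clarify)
      fix \<tau> v
      have "f' (t, x) (\<tau> *\<^sub>R (1, 0) + (0, v)) = \<tau> *\<^sub>R f' (t, x) (1, 0) + f' (t, x) (0, v)"
        using lin by (simp only: linear_add linear_cmul)
      then show "f' (t, x) (\<tau>, v) = \<tau> *\<^sub>R time_deriv I h t x + frechet_derivative (h t) (at x) v"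
        unfolding td[OF t] fd[OF t] by simp
    qed
    then show ?thesis using f'[of "(t, x)"] t by simp
  qed
  show "t \<in> I \<Longrightarrow> ((\<lambda>\<tau>. h \<tau> x) has_vector_derivative time_deriv I h t x) (at t within I)"
    using time td by simp
  show "t \<in> I \<Longrightarrow> (h t has_derivative frechet_derivative (h t) (at x)) (at x)"
    using space fd by simp
  have "smooth_on (I \<times> UNIV) (\<lambda>(t, x). time_deriv I h t x) \<longleftrightarrow> smooth_on (I \<times> UNIV) (\<lambda>z. f' z (1, 0))"
    by (rule smooth_on_cong) (auto simp: td)
  then show "smooth_on (I \<times> UNIV) (\<lambda>(t, x). time_deriv I h t x)"
    using sm by simp
  have "smooth_on (I \<times> UNIV) (\<lambda>(t, x). frechet_derivative (h t) (at x) v) \<longleftrightarrow> smooth_on (I \<times> UNIV) (\<lambda>z. f' z (0, v))"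
    by (rule smooth_on_cong) (auto simp: fd)
  then show "smooth_on (I \<times> UNIV) (\<lambda>(t, x). frechet_derivative (h t) (at x) v)"
    using sm by simp
qed

lemma smooth_on_slice:
  fixes h :: "real \<Rightarrow> real ^ 'n \<Rightarrow> 'b::real_normed_vector"
  assumes "smooth_on (I \<times> UNIV) (\<lambda>(t, x). h t x)" "t \<in> I"
  shows "smooth_on UNIV (h t)"
proof -
  have "smooth_on UNIV (\<lambda>x. (\<lambda>(t, x). h t x) (t, x))"
    by (rule smooth_on_compose[OF assms(1)]) (use assms(2) in \<open>auto intro!: smooth_intros\<close>)
  then show ?thesis by simp
qed

lemma time_deriv_eqI:
  assumes "((\<lambda>\<tau>. h \<tau> x) has_vector_derivative d) (at t within I)" "t \<in> I"
  shows "time_deriv I h t x = d"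
  unfolding time_deriv_def using assms at_within_I by (simp add: vector_derivative_within)

end

subsection \<open>The inverse flow map\<close>

lemma Ck_on_det:
  fixes E :: "'a::euclidean_space \<Rightarrow> real ^ 'n ^ 'n"
  assumes "\<And>i j. Ck_on m S (\<lambda>z. E z $ i $ j)"
  shows "Ck_on m S (\<lambda>z. det (E z))"
  unfolding det_def
  by (intro Ck_on_sum Ck_on_bilinear[OF bounded_bilinear_mult] Ck_on_const Ck_on_prod assms)

text \<open>Cramer's rule with the division by \<open>det A\<close> left out: for determinant one it
  solves the linear system by polynomials in the entries, so its regularity in a parameter is
  immediate.\<close>

definition cramer_solution :: "real ^ 'n ^ 'n \<Rightarrow> real ^ 'n \<Rightarrow> real ^ 'n" where
  "cramer_solution A b = (\<chi> k. det (\<chi> i j. if j = k then b $ i else A $ i $ j))"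

lemma cramer_solution:
  fixes A :: "real ^ 'n ^ 'n"
  assumes "det A = 1"
  shows "A *v cramer_solution A b = b" and "cramer_solution A (A *v x) = x"
  using cramer[of A "cramer_solution A b" b] cramer[of A x "A *v x"] assms
  by (auto simp: cramer_solution_def)

lemma Ck_on_cramer_solution:
  fixes E :: "'a::euclidean_space \<Rightarrow> real ^ 'n ^ 'n"
  assumes "\<And>i j. Ck_on m S (\<lambda>z. E z $ i $ j)" "\<And>i. Ck_on m S (\<lambda>z. b z $ i)"
  shows "Ck_on m S (\<lambda>z. cramer_solution (E z) (b z))"
proof (rule Ck_on_vec)
  fix k
  have "Ck_on m S (\<lambda>z. if j = k then b z $ i else E z $ i $ j)" for i j
    using assms by (cases "j = k") auto
  then show "Ck_on m S (\<lambda>z. cramer_solution (E z) (b z) $ k)"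
    unfolding cramer_solution_def by (simp, intro Ck_on_det) simp
qed

text \<open>Distinct integers are at least 1 apart, so no coordinate can jump. This upgrades
  statements modulo the lattice to equalities of lifts.\<close>

lemma int_lattice_valued_constant:
  fixes f :: "'a::real_normed_vector \<Rightarrow> real ^ 'n"
  assumes S: "connected S" "continuous_on S f" and lattice: "\<And>x. x \<in> S \<Longrightarrow> f x \<in> int_lattice"
    and "x \<in> S" "y \<in> S"
  shows "f x = f y"
  unfolding vec_eq_iff
proof
  fix i
  have "(\<lambda>x. f x $ i) constant_on S"
  proof (rule continuous_discrete_range_constant[OF S(1)])
    show "continuous_on S (\<lambda>x. f x $ i)" by (intro continuous_intros S(2))
    fix x assume x: "x \<in> S"
    have "1 \<le> norm (f y $ i - f x $ i)" if "y \<in> S" "f y $ i \<noteq> f x $ i" for y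
    proof -
      have "f y $ i - f x $ i \<in> \<int>" using lattice x that(1) unfolding int_lattice_def by (auto intro: Ints_diff)
      then show ?thesis using that(2) Ints_nonzero_abs_ge1[of "f y $ i - f x $ i"] by simp
    qed
    then show "\<exists>e>0. \<forall>y. y \<in> S \<and> f y $ i \<noteq> f x $ i \<longrightarrow> e \<le> norm (f y $ i - f x $ i)"
      by (intro exI[of _ 1]) auto
  qed
  then show "f x $ i = f y $ i" using assms(4,5) unfolding constant_on_def by auto
qed

text \<open>\<open>SDiff\<close> only says that \<open>X t (x + k) - X t x\<close> is some lattice
  vector. That this vector is \<open>k\<close> reflects that \<open>X t\<close> is deformed from the
  identity; it is supplied by \<open>lattice_translation_curve\<close>.\<close>

locale flow = time_interval I for I +
  fixes X :: "real \<Rightarrow> real ^ 'n \<Rightarrow> real ^ 'n"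
  assumes smooth_X: "smooth_on (I \<times> UNIV) (\<lambda>(t, x). X t x)"
    and SDiff_X: "t \<in> I \<Longrightarrow> X t \<in> SDiff"
    and X_translate: "t \<in> I \<Longrightarrow> k \<in> int_lattice \<Longrightarrow> X t (x + k) = X t x + k"
begin

lemma bij_X: "t \<in> I \<Longrightarrow> bij (X t)"
  and det_X: "t \<in> I \<Longrightarrow> det (matrix (frechet_derivative (X t) (at x))) = 1"
  and smooth_inv_X: "t \<in> I \<Longrightarrow> smooth_on UNIV (inv (X t))"
  using SDiff_X[of t] by (auto simp: SDiff_def)

lemma inv_X: "t \<in> I \<Longrightarrow> inv (X t) (X t x) = x" "t \<in> I \<Longrightarrow> X t (inv (X t) y) = y"
  using bij_X[of t] by (simp_all add: bij_is_inj bij_is_surj surj_f_inv_f)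

lemma inv_X_translate:
  assumes "t \<in> I" "k \<in> int_lattice"
  shows "inv (X t) (y + k) = inv (X t) y + k"
proof -
  have "X t (inv (X t) y + k) = y + k"
    using X_translate[OF assms] inv_X(2)[OF assms(1)] by simp
  then show ?thesis using inv_X(1)[OF assms(1)] by metis
qed

text \<open>Smoothness of each \<open>inv (X t)\<close> in space says nothing about its dependence
  on \<open>t\<close>. The inverse \<open>g\<close> of the space-time map \<open>\<Phi>\<close> is
  shown to be continuous, hence differentiable, hence smooth order by order, since its derivative is
  a formula in \<open>g\<close> and the derivatives of \<open>X\<close>.\<close>

lemma smooth_inverse: "smooth_on (I \<times> UNIV) (\<lambda>(t, y). inv (X t) y)"
proof -
  let ?S = "I \<times> (UNIV :: (real ^ 'n) set)"
  define \<Phi> where "\<Phi> = (\<lambda>(t, x). (t, X t x))"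
  define g where "g = (\<lambda>(t, y). (t, inv (X t) y))"
  have g\<Phi>: "g (\<Phi> z) = z" and \<Phi>g: "\<Phi> (g z) = z" and gS: "g z \<in> ?S" "\<Phi> z \<in> ?S" if "z \<in> ?S" for z
    using that inv_X by (auto simp: g_def \<Phi>_def)
  have \<Phi>S: "\<Phi> ` ?S = ?S"
  proof
    show "\<Phi> ` ?S \<subseteq> ?S" using gS by blast
    show "?S \<subseteq> \<Phi> ` ?S" using \<Phi>g gS by (metis image_eqI subsetI)
  qed
  have cont_X: "continuous_on ?S (\<lambda>(t, x). X t x)"
    using smooth_X by (rule smooth_on_continuous)
  have cont_\<Phi>: "continuous_on ?S \<Phi>"
    unfolding \<Phi>_def case_prod_beta
    using cont_X by (intro continuous_intros) (simp add: case_prod_beta)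
  have cont_g: "continuous_on ?S g"
    unfolding continuous_on_sequentially
  proof (intro allI ballI impI, elim conjE)
    fix z s assume z: "z \<in> ?S" and s: "\<forall>n. s n \<in> ?S" and lim: "s \<longlonglongrightarrow> z"
    \<comment> \<open>Along a convergent sequence the times stay in a compact set \<open>K\<close>.
      There the displacement \<open>X t x - x\<close>, being periodic in \<open>x\<close>, is
      bounded by some \<open>B\<close>, so the preimages stay in the compact set \<open>?C\<close>,
      on which a continuous injection has a continuous inverse.\<close>
    define K where "K = fst ` insert z (range s)"
    have compact_zs: "compact (insert z (range s))" using lim by (rule compact_sequence_with_limit)
    have K: "compact K" unfolding K_def
      by (rule compact_continuous_image[OF _ compact_zs]) (intro continuous_intros)
    have KI: "K \<subseteq> I" using z s unfolding K_def by (auto simp: mem_Times_iff)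
    let ?G = "\<lambda>(t, x). X t x - x"
    have "compact (?G ` (K \<times> cbox 0 1))"
    proof (rule compact_continuous_image)
      show "continuous_on (K \<times> cbox 0 1) ?G"
        using continuous_on_subset[OF cont_X, of "K \<times> cbox 0 1"] KI
        unfolding case_prod_beta by (intro continuous_intros) auto
      show "compact (K \<times> cbox 0 (1 :: real ^ 'n))" by (intro compact_Times K compact_cbox)
    qed
    from compact_imp_bounded[OF this] obtain B where B: "\<forall>w\<in>?G ` (K \<times> cbox 0 1). norm w \<le> B"
      unfolding bounded_iff by (elim exE) rule
    have B': "norm (X t x - x) \<le> B" if t: "t \<in> K" for t x
    proof -
      obtain k where k: "k \<in> int_lattice" "x - k \<in> cbox 0 1" by (rule torus_translate_to_cell)
      have "X t x = X t (x - k) + k" using X_translate[of t k "x - k"] t KI k(1) by auto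
      moreover have "norm (?G (t, x - k)) \<le> B"
        using B t k(2) by (intro B[rule_format] imageI) simp
      ultimately show ?thesis by (simp add: algebra_simps)
    qed
    have "compact (snd ` insert z (range s))"
      by (rule compact_continuous_image[OF _ compact_zs]) (intro continuous_intros)
    from compact_imp_bounded[OF this] obtain R where R: "\<forall>y\<in>snd ` insert z (range s). norm y \<le> R"
      unfolding bounded_iff by (elim exE) rule
    let ?C = "K \<times> cball (0 :: real ^ 'n) (R + B)"
    have sub: "\<Phi> ` ?C \<subseteq> ?S" using \<Phi>S KI by blast
    have in_C: "w \<in> \<Phi> ` ?C" if w: "w \<in> insert z (range s)" for w
    proof -
      have wS: "w \<in> ?S" using w z s by auto
      obtain t y where ty: "w = (t, y)" by (cases w)
      have t: "t \<in> K" unfolding K_def using imageI[OF w, of fst] ty by simp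
      have y: "norm y \<le> R" using R[rule_format, OF imageI[OF w]] ty by simp
      have "norm (y - inv (X t) y) \<le> B"
        using B'[OF t, of "inv (X t) y"] inv_X(2)[of t y] t KI by auto
      then have "norm (inv (X t) y) \<le> R + B"
        using y norm_triangle_sub[of "inv (X t) y" y] by (simp add: norm_minus_commute)
      then have "g w \<in> ?C" using t ty by (simp add: g_def)
      then show ?thesis using \<Phi>g[OF wS] by (metis imageI)
    qed
    have "continuous_on (\<Phi> ` ?C) g"
    proof (rule continuous_on_inv)
      show "continuous_on ?C \<Phi>" by (rule continuous_on_subset[OF cont_\<Phi>]) (use KI in auto)
      show "compact ?C" by (intro compact_Times K compact_cball)
      show "\<forall>x\<in>?C. g (\<Phi> x) = x"
      proof
        fix x assume "x \<in> ?C"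
        then have "x \<in> ?S" using KI by auto
        then show "g (\<Phi> x) = x" by (rule g\<Phi>)
      qed
    qed
    note cg = this
    have zC: "z \<in> \<Phi> ` ?C" and sC: "\<forall>n. s n \<in> \<Phi> ` ?C"
      by (blast intro: in_C)+
    from bspec[OF spec[OF iffD1[OF continuous_on_sequentially cg]] zC] sC lim
    show "(g \<circ> s) \<longlonglongrightarrow> g z" by simp
  qed
  let ?M = "\<lambda>z. matrix (frechet_derivative (X (fst z)) (at (snd z)))"
  \<comment> \<open>The second component solves \<open>\<tau> *\<^sub>R V + A *v v = snd w\<close>
    for \<open>v\<close>, with \<open>\<tau> = fst w\<close> and with \<open>V\<close> and
    \<open>A\<close> the time and space derivatives of \<open>X\<close> at
    \<open>g z\<close>.\<close>
  define g' where "g' z w = (fst w, cramer_solution (?M (g z)) (snd w - fst w *\<^sub>R time_deriv I X (fst z) (snd (g z))))" for z w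
  have der: "(g has_derivative g' z) (at z within ?S)" if z: "z \<in> ?S" for z
  proof -
    obtain t y where ty: "z = (t, y)" by (cases z)
    then have t: "t \<in> I" using z by simp
    define x where "x = inv (X t) y"
    have gz: "g z = (t, x)" by (simp add: g_def ty x_def)
    have zx: "z = \<Phi> (t, x)" using \<Phi>g[OF z] gz by simp
    define A where "A = matrix (frechet_derivative (X t) (at x))"
    define V where "V = time_deriv I X t x"
    have detA: "det A = 1" using det_X[OF t] by (simp add: A_def)
    have lin: "linear (frechet_derivative (X t) (at x))"
      using space_time_derivative(3)[OF smooth_X t] has_derivative_linear by blast
    have Av: "A *v v = frechet_derivative (X t) (at x) v" for v
      unfolding A_def using matrix_vector_mul(2)[OF lin] by (rule fun_cong)
    obtain B where B: "B ** A = mat 1"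
      using detA invertible_det_nz[of A] unfolding invertible_def by auto
    have cs: "cramer_solution A b = B *v b" for b
    proof -
      have "B *v (A *v cramer_solution A b) = cramer_solution A b"
        by (simp add: matrix_vector_mul_assoc B)
      then show ?thesis using cramer_solution(1)[OF detA] by simp
    qed
    have der_\<Phi>: "(\<Phi> has_derivative (\<lambda>(\<tau>, v). (\<tau>, \<tau> *\<^sub>R V + A *v v))) (at (t, x) within ?S)"
    proof -
      have "((\<lambda>z. (fst z, case z of (t, x) \<Rightarrow> X t x)) has_derivative
          (\<lambda>h. (fst h, case h of (\<tau>, v) \<Rightarrow> \<tau> *\<^sub>R V + frechet_derivative (X t) (at x) v))) (at (t, x) within ?S)"
        using space_time_derivative(1)[OF smooth_X t] unfolding V_def
        by (intro has_derivative_Pair has_derivative_fst has_derivative_ident)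
      then show ?thesis
        unfolding \<Phi>_def Av by (simp add: case_prod_unfold)
    qed
    have "(g has_derivative (\<lambda>w. (fst w, cramer_solution A (snd w - fst w *\<^sub>R V)))) (at (\<Phi> (t, x)) within \<Phi> ` ?S)"
    proof (rule has_derivative_inverse_within[OF der_\<Phi>])
      show "continuous (at (\<Phi> (t, x)) within \<Phi> ` ?S) g"
        using cont_g z unfolding \<Phi>S zx[symmetric] continuous_on_eq_continuous_within by (rule bspec)
      show "linear (\<lambda>w. (fst w, cramer_solution A (snd w - fst w *\<^sub>R V)))"
        unfolding cs
        by (rule linearI) (simp_all add: matrix_vector_mult_diff_distrib matrix_vector_right_distrib
            algebra_simps matrix_vector_mult_scaleR)
      show "(\<lambda>w. (fst w, cramer_solution A (snd w - fst w *\<^sub>R V))) \<circ> (\<lambda>(\<tau>, v). (\<tau>, \<tau> *\<^sub>R V + A *v v)) = id"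
        using cramer_solution(2)[OF detA] by (auto simp: fun_eq_iff)
    qed (use t g\<Phi> in auto)
    moreover have "g' z = (\<lambda>w. (fst w, cramer_solution A (snd w - fst w *\<^sub>R V)))"
      by (simp add: g'_def fun_eq_iff gz[unfolded ty] A_def V_def ty)
    ultimately show ?thesis unfolding \<Phi>S zx[symmetric] by simp
  qed
  have "Ck_on m ?S g" for m
  proof (induction m)
    case 0
    then show ?case using cont_g by simp
  next
    case (Suc m)
    \<comment> \<open>Bootstrap: \<open>g'\<close> contains \<open>g\<close> only undifferentiated,
      as an argument of smooth functions, so order \<open>m\<close> of \<open>g\<close> gives order
      \<open>m\<close> of \<open>g'\<close>.\<close>
    have comp: "Ck_on m ?S (\<lambda>z. h (g z))" if "smooth_on ?S h" for h :: "real \<times> (real ^ 'n) \<Rightarrow> real ^ 'n"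
    proof (rule Ck_on_compose[OF _ Suc.IH])
      show "Ck_on m ?S h" using that by (simp add: smooth_on_def)
      show "g ` ?S \<subseteq> ?S" using gS(1) by (rule image_subsetI)
    qed
    have "Ck_on m ?S (\<lambda>z. g' z w)" for w
    proof -
      have M: "Ck_on m ?S (\<lambda>z. ?M (g z) $ i $ j)" for i j
      proof -
        have "Ck_on m ?S (\<lambda>z. (case g z of (t, x) \<Rightarrow> frechet_derivative (X t) (at x) (axis j 1)) $ i)"
          by (intro Ck_on_compose_linear[OF bounded_linear_vec_nth] comp space_time_derivative(5)[OF smooth_X])
        then show ?thesis by (simp add: matrix_def case_prod_beta)
      qed
      have V: "Ck_on m ?S (\<lambda>z. snd w - fst w *\<^sub>R time_deriv I X (fst (g z)) (snd (g z)))"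
      proof -
        have "Ck_on m ?S (\<lambda>z. snd w + (- fst w) *\<^sub>R (case g z of (t, x) \<Rightarrow> time_deriv I X t x))"
          by (intro Ck_on_add Ck_on_const Ck_on_compose_linear[OF bounded_linear_scaleR_right] comp
              space_time_derivative(4)[OF smooth_X])
        then show ?thesis by (simp add: case_prod_beta)
      qed
      have "fst (g z) = fst z" for z by (simp add: g_def case_prod_beta)
      then have V': "Ck_on m ?S (\<lambda>z. (snd w - fst w *\<^sub>R time_deriv I X (fst z) (snd (g z))) $ i)" for i
        using Ck_on_compose_linear[OF bounded_linear_vec_nth V] by simp
      show ?thesis
        unfolding g'_def by (rule Ck_on_Pair[OF Ck_on_const Ck_on_cramer_solution[OF M V']])
    qed
    with der show ?case
      unfolding Ck_on.simps by (intro exI[of _ g']) simp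
  qed
  then have "smooth_on ?S g" by (simp add: smooth_on_def)
  from smooth_on_snd[OF this] show ?thesis
    by (simp add: g_def case_prod_unfold)
qed

text \<open>The determinant condition concerns \<open>X t\<close>, so the unit Jacobian lemma yields
  invariance of Lebesgue measure under \<open>inv (X t)\<close>; pushing forward once more by
  \<open>X t\<close> gives the claim without computing the Jacobian of the inverse.\<close>

lemma distr_X:
  assumes "t \<in> I"
  shows "distr lborel borel (X t) = lborel"
proof -
  have c: "continuous_on UNIV (X t)" "continuous_on UNIV (inv (X t))"
    using smooth_on_slice[OF smooth_X assms] smooth_inv_X[OF assms] smooth_on_continuous by blast+
  then have [measurable]: "X t \<in> borel_measurable borel" "inv (X t) \<in> borel_measurable borel"
    using borel_measurable_continuous_onI by blast+
  have inv: "distr lborel borel (inv (X t)) = lborel"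
    using inv_X[OF assms] det_X[OF assms] space_time_derivative(3)[OF smooth_X assms] c(2)
    by (intro distr_lborel_unit_jacobian[of "inv (X t)" "X t" "\<lambda>x. frechet_derivative (X t) (at x)"]) auto
  have "distr lborel borel (X t) = distr (distr lborel borel (inv (X t))) borel (X t)"
    by (simp add: inv)
  also have "\<dots> = distr lborel borel (X t \<circ> inv (X t))"
    by (rule distr_distr) auto
  also have "X t \<circ> inv (X t) = (\<lambda>x. x)" using inv_X(2)[OF assms] by (simp add: fun_eq_iff)
  also have "distr lborel borel (\<lambda>x :: real ^ 'n. x) = lborel"
    by (rule distr_id2) simp
  finally show ?thesis .
qed

lemma torus_integral_X:
  assumes "t \<in> I" "continuous_on UNIV f" "periodic f"
  shows "torus_integral (\<lambda>x. f (X t x)) = torus_integral f"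
proof -
  have "continuous_on UNIV (X t)"
    using smooth_on_slice[OF smooth_X assms(1)] smooth_on_continuous by blast
  from torus_integral_compose[OF assms(2,3) this bij_X[OF assms(1)] distr_X[OF assms(1)] X_translate[OF assms(1)]]
  show ?thesis .
qed

end

text \<open>Two connectedness arguments: for fixed \<open>x\<close> the lattice vector
  \<open>X t (x + k) - X t x\<close> cannot change with \<open>t\<close>, and at time 0 the lattice
  vector \<open>X 0 x - x\<close> cannot change with \<open>x\<close>, which identifies the former
  as \<open>k\<close>.\<close>

lemma lattice_translation_curve:
  fixes X :: "real \<Rightarrow> real ^ 'n \<Rightarrow> real ^ 'n"
  assumes I: "is_interval I" "0 \<in> I" and X: "smooth_curve I X" and X0: "torus_eq (X 0) id"
    and t: "t \<in> I" and k: "k \<in> int_lattice"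
  shows "X t (x + k) = X t x + k"
proof -
  have cont_X: "continuous_on (I \<times> UNIV) (\<lambda>(t, x). X t x)"
    using X smooth_on_continuous unfolding smooth_curve_def by blast
  have cont_time: "continuous_on I (\<lambda>t. X t x)" for x
    using continuous_on_compose2[OF cont_X, of I "\<lambda>t. (t, x)"] by (force intro: continuous_intros)
  have cont_space: "continuous_on UNIV (X 0)"
    using continuous_on_compose2[OF cont_X, of UNIV "\<lambda>x. (0, x)"] I(2) by (force intro: continuous_intros)
  have "X t (x + k) - X t x = X 0 (x + k) - X 0 x"
  proof (rule int_lattice_valued_constant[of I "\<lambda>t. X t (x + k) - X t x"])
    show "connected I" using I(1) is_interval_connected by blast
    show "continuous_on I (\<lambda>t. X t (x + k) - X t x)" by (intro continuous_intros cont_time)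
    show "X t (x + k) - X t x \<in> int_lattice" if "t \<in> I" for t
      using X k that unfolding smooth_curve_def SDiff_def torus_map_def by blast
  qed (use I t in auto)
  moreover have "X 0 (x + k) - (x + k) = X 0 x - x"
  proof (rule int_lattice_valued_constant[of UNIV "\<lambda>x. X 0 x - x"])
    show "continuous_on UNIV (\<lambda>x. X 0 x - x)" by (intro continuous_intros cont_space)
    show "X 0 x - x \<in> int_lattice" for x
      using X0 unfolding torus_eq_def by simp
  qed auto
  ultimately show ?thesis by (simp add: algebra_simps)
qed

subsection \<open>A smooth cutoff function\<close>

text \<open>\<open>flat_exp 0\<close> is the classical flat function; the powers of
  \<open>inverse t\<close> make the family closed, up to linear combinations, under
  differentiation.\<close>

definition flat_exp :: "nat \<Rightarrow> real \<Rightarrow> real" where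
  "flat_exp n t = (if t > 0 then inverse t ^ n * exp (- inverse t) else 0)"

lemma flat_exp_tendsto_0: "(flat_exp n \<longlongrightarrow> 0) (at 0)"
proof (rule filterlim_split_at)
  show "(flat_exp n \<longlongrightarrow> 0) (at_left 0)"
    by (rule tendsto_eventually) (auto simp: eventually_at_filter flat_exp_def)
  have "((\<lambda>t. inverse t ^ n / exp (inverse t)) \<longlongrightarrow> 0) (at_right (0 :: real))"
    by (rule filterlim_compose[OF tendsto_power_div_exp_0 filterlim_inverse_at_top_right])
  moreover have "\<forall>\<^sub>F t in at_right 0. inverse t ^ n / exp (inverse t) = flat_exp n t"
    by (auto simp: eventually_at_filter flat_exp_def exp_minus divide_inverse)
  ultimately show "(flat_exp n \<longlongrightarrow> 0) (at_right 0)"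
    by (rule Lim_transform_eventually)
qed

lemma flat_exp_deriv:
  "(flat_exp n has_real_derivative flat_exp (n + 2) t - real n * flat_exp (n + 1) t) (at t)"
proof -
  consider "t > 0" | "t < 0" | "t = 0" by linarith
  then show ?thesis
  proof cases
    case 1
    have "((\<lambda>t. inverse t ^ n * exp (- inverse t)) has_real_derivative
        flat_exp (n + 2) t - real n * flat_exp (n + 1) t) (at t)"
    proof -
      have "((\<lambda>t. inverse t ^ n) has_real_derivative - real n * inverse t ^ (n + 1)) (at t)"
        using DERIV_power[OF DERIV_inverse, of t n UNIV] 1 by (cases n) (simp_all add: algebra_simps)
      moreover have "((\<lambda>t. exp (- inverse t)) has_real_derivative exp (- inverse t) * inverse t ^ 2) (at t)"
        using 1 by (auto intro!: derivative_eq_intros simp: power2_eq_square)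
      ultimately have "((\<lambda>t. inverse t ^ n * exp (- inverse t)) has_real_derivative
          - real n * inverse t ^ (n + 1) * exp (- inverse t) + exp (- inverse t) * inverse t ^ 2 * inverse t ^ n) (at t)"
        by (rule DERIV_mult)
      then show ?thesis
        using 1 by (simp add: flat_exp_def power_add power2_eq_square mult_ac)
    qed
    then show ?thesis
      by (rule has_field_derivative_transform_within_open[of _ _ _ "{0<..}"]) (use 1 in \<open>auto simp: flat_exp_def\<close>)
  next
    case 2
    have "((\<lambda>t. 0) has_real_derivative 0) (at t)" by simp
    then have "(flat_exp n has_real_derivative 0) (at t)"
      by (rule has_field_derivative_transform_within_open[of _ _ _ "{..<0}"]) (use 2 in \<open>auto simp: flat_exp_def\<close>)
    then show ?thesis using 2 by (simp add: flat_exp_def)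
  next
    case 3
    \<comment> \<open>The difference quotient at 0 is the next member of the family, whose limit at
      0 is already known.\<close>
    have "(\<lambda>h. (flat_exp n (0 + h) - flat_exp n 0) / h) = flat_exp (Suc n)"
      by (auto simp: fun_eq_iff flat_exp_def divide_inverse)
    then have "(flat_exp n has_real_derivative 0) (at 0)"
      using flat_exp_tendsto_0[of "Suc n"] by (simp only: DERIV_def)
    then show ?thesis using 3 by (simp add: flat_exp_def)
  qed
qed

lemma smooth_flat_exp: "smooth_on UNIV (flat_exp n)"
proof -
  have "Ck_on m UNIV (flat_exp n)" for m
  proof (induction m arbitrary: n)
    case 0
    show ?case using DERIV_isCont[OF flat_exp_deriv] by (simp add: continuous_at_imp_continuous_on)
  next
    case (Suc m)
    show ?case
    proof (rule Ck_on_SucI_real)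
      show "(flat_exp n has_real_derivative flat_exp (n + 2) t + (- real n) * flat_exp (n + 1) t) (at t)" for t
        using flat_exp_deriv[of n t] by simp
      show "Ck_on m UNIV (\<lambda>t. flat_exp (n + 2) t + (- real n) * flat_exp (n + 1) t)"
        by (intro Ck_on_add Ck_on_bilinear[OF bounded_bilinear_mult] Ck_on_const Suc)
    qed
  qed
  then show ?thesis by (simp add: smooth_on_def)
qed

text \<open>Vanishing outside the open interval keeps the end points of a variation fixed;
  positivity inside lets the cutoff act as a weight when an integral identity is localised in
  time.\<close>

definition cutoff :: "real \<Rightarrow> real \<Rightarrow> real \<Rightarrow> real" where
  "cutoff a b t = flat_exp 0 (t - a) * flat_exp 0 (b - t)"

lemma smooth_cutoff: "smooth_on S (cutoff a b)"
  unfolding cutoff_def[abs_def]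
  by (intro smooth_on_mult smooth_on_compose[OF smooth_flat_exp] smooth_on_diff smooth_on_ident smooth_on_const) simp_all

lemma cutoff_pos: "t \<in> {a<..<b} \<Longrightarrow> cutoff a b t > 0"
  and cutoff_0: "t \<notin> {a<..<b} \<Longrightarrow> cutoff a b t = 0"
  by (auto simp: cutoff_def flat_exp_def)

lemma cutoff_nonneg: "cutoff a b t \<ge> 0"
  by (simp add: cutoff_def flat_exp_def)

subsection \<open>Shear flows\<close>

text \<open>Stretching along \<open>e\<close> conjugates the transvection \<open>T 1\<close> to \<open>T 2 = T 1 \<circ> T 1\<close>, so its determinant
  equals its own square.\<close>

lemma det_transvection:
  fixes a e :: "real ^ 'n"
  assumes "a \<bullet> e = 0"
  shows "det (matrix (\<lambda>h. h + (a \<bullet> h) *\<^sub>R e)) = 1"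
proof (cases "e = 0")
  case True
  have "matrix (\<lambda>h :: real ^ 'n. h) = mat 1" by (simp add: matrix_id_mat_1[unfolded id_def])
  with True show ?thesis by simp
next
  case False
  define T where "T c = (\<lambda>h. h + (c * (a \<bullet> h)) *\<^sub>R e)" for c
  \<comment> \<open>\<open>L\<close> doubles \<open>e\<close> and fixes its orthogonal complement;
    \<open>L'\<close> undoes this. As \<open>a\<close> is orthogonal to \<open>e\<close>, both leave
    \<open>a \<bullet> h\<close> unchanged, so the conjugation only doubles the
    displacement.\<close>
  define L where "L = (\<lambda>h. h + ((e \<bullet> h) / (e \<bullet> e)) *\<^sub>R e)"
  define L' where "L' = (\<lambda>h. h - ((e \<bullet> h) / (2 * (e \<bullet> e))) *\<^sub>R e)"
  have lin: "linear (T c)" "linear L" "linear L'" for c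
    by (auto intro!: linearI simp: T_def L_def L'_def algebra_simps add_divide_distrib)
  have ee: "e \<bullet> e \<noteq> 0" using False by simp
  have TT: "T c \<circ> T d = T (c + d)" for c d
    by (simp add: fun_eq_iff T_def inner_add_right assms algebra_simps)
  have LL: "L \<circ> L' = id"
    using ee by (simp add: fun_eq_iff L_def L'_def inner_diff_right diff_divide_distrib
        scaleR_left_distrib[symmetric] scaleR_left_diff_distrib[symmetric] algebra_simps flip: scaleR_add_left)
  have LTL: "L \<circ> (T 1 \<circ> L') = T 2"
    using ee assms by (simp add: fun_eq_iff L_def L'_def T_def inner_diff_right inner_add_right algebra_simps add_divide_distrib
        diff_divide_distrib flip: scaleR_add_left)
  have "det (matrix (T 1)) * det (matrix (T (-1))) = det (matrix (T 0))"
    using matrix_compose[OF lin(1)[of "-1"] lin(1)[of 1]] TT[of 1 "-1"] by (simp add: det_mul)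
  also have "T 0 = id" by (simp add: T_def fun_eq_iff)
  finally have "det (matrix (T 1)) * det (matrix (T (-1))) = 1"
    by (simp only: matrix_id_mat_1 det_I)
  then have nz: "det (matrix (T 1)) \<noteq> 0" by auto
  have "det (matrix L) * det (matrix L') = 1"
    using matrix_compose[OF lin(3) lin(2)] unfolding LL matrix_id_mat_1 by (metis det_I det_mul)
  moreover have "det (matrix (T 2)) = det (matrix L) * (det (matrix (T 1)) * det (matrix L'))"
    using matrix_compose[OF linear_compose[OF lin(3) lin(1)] lin(2), of 1] matrix_compose[OF lin(3) lin(1), of 1] LTL
    by (simp add: det_mul)
  moreover have "det (matrix (T 2)) = det (matrix (T 1)) * det (matrix (T 1))"
    using matrix_compose[OF lin(1)[of 1] lin(1)[of 1]] TT[of 1 1] by (simp add: det_mul)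
  ultimately have "det (matrix (T 1)) * det (matrix (T 1)) = det (matrix (T 1))"
    by (metis mult.left_commute mult.right_neutral)
  with nz show ?thesis by (simp add: T_def)
qed

definition shear :: "real ^ 'n \<Rightarrow> real \<Rightarrow> real ^ 'n \<Rightarrow> real \<Rightarrow> real ^ 'n \<Rightarrow> real ^ 'n" where
  "shear k \<theta> e r y = y + (r * wave k \<theta> y) *\<^sub>R e"

lemma smooth_wave: "smooth_on S (wave k \<theta>)"
  unfolding wave_def by (intro smooth_intros)

text \<open>The wave is constant in the direction \<open>e\<close>, so it has the same value before
  and after the displacement, and the two displacements cancel.\<close>

lemma shear_inverse:
  assumes "k \<bullet> e = 0"
  shows "shear k \<theta> e r (shear k \<theta> e (- r) y) = y"
proof -
  have "wave k \<theta> (y - c *\<^sub>R e) = wave k \<theta> y" for c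
    unfolding wave_def by (simp add: inner_diff_right assms)
  then show ?thesis unfolding shear_def by (simp add: scaleR_left_distrib[symmetric])
qed

text \<open>A lattice vector \<open>k\<close> makes the shear a torus map, and
  \<open>k \<bullet> e = 0\<close> makes its derivative a transvection, of determinant one.\<close>

lemma shear_SDiff:
  assumes k: "k \<in> int_lattice" and ke: "k \<bullet> e = 0"
  shows "shear k \<theta> e r \<in> SDiff"
proof -
  have bij: "bij (shear k \<theta> e r)" and inv: "inv (shear k \<theta> e r) = shear k \<theta> e (- r)" for r
  proof -
    have 1: "shear k \<theta> e r \<circ> shear k \<theta> e (- r) = id" for r
      using shear_inverse[OF ke] by (simp add: fun_eq_iff)
    from 1[of r] 1[of "- r"] show "bij (shear k \<theta> e r)"
      by (auto intro: o_bij)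
    from 1[of r] 1[of "- r"] show "inv (shear k \<theta> e r) = shear k \<theta> e (- r)"
      by (auto intro: inv_unique_comp)
  qed
  have smooth: "smooth_on UNIV (shear k \<theta> e r)" for r
    unfolding shear_def[abs_def] by (intro smooth_intros smooth_wave)
  have torus: "torus_map (shear k \<theta> e r)" for r
    using periodic_wave[OF k] unfolding torus_map_def shear_def periodic_def by auto
  have "det (matrix (frechet_derivative (shear k \<theta> e r) (at x))) = 1" for x
  proof -
    let ?c = "2 * pi * wave k (\<theta> + pi / 2) x * r"
    have "(shear k \<theta> e r has_derivative (\<lambda>h. h + (r * (2 * pi * (k \<bullet> h) * wave k (\<theta> + pi / 2) x)) *\<^sub>R e)) (at x)"
      unfolding shear_def[abs_def]
      by (rule has_derivative_add[OF has_derivative_ident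
          has_derivative_scaleR_left[OF has_derivative_mult_right[OF wave_has_derivative]]])
    note d = this
    have "(\<lambda>h. h + (r * (2 * pi * (k \<bullet> h) * wave k (\<theta> + pi / 2) x)) *\<^sub>R e) = (\<lambda>h. h + ((?c *\<^sub>R k) \<bullet> h) *\<^sub>R e)"
      by (rule ext) (simp add: mult_ac)
    then have "frechet_derivative (shear k \<theta> e r) (at x) = (\<lambda>h. h + ((?c *\<^sub>R k) \<bullet> h) *\<^sub>R e)"
      using frechet_derivative_at[OF d] by simp
    then show ?thesis
      using det_transvection[of "?c *\<^sub>R k" e] ke by simp
  qed
  with bij inv smooth torus show ?thesis
    unfolding SDiff_def by simp
qed

lemma torus_map_compose:
  assumes "torus_map F" "torus_map G"
  shows "torus_map (F \<circ> G)"
  unfolding torus_map_def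
proof (intro allI ballI)
  fix x k :: "real ^ 'a" assume "k \<in> int_lattice"
  then have "G (x + k) - G x \<in> int_lattice" using assms(2) unfolding torus_map_def by blast
  then have "F (G x + (G (x + k) - G x)) - F (G x) \<in> int_lattice"
    using assms(1) unfolding torus_map_def by blast
  then show "(F \<circ> G) (x + k) - (F \<circ> G) x \<in> int_lattice" by simp
qed

lemma SDiff_compose:
  assumes F: "F \<in> SDiff" and G: "G \<in> SDiff"
  shows "F \<circ> G \<in> SDiff"
proof -
  have F': "bij F" "smooth_on UNIV F" "smooth_on UNIV (inv F)" "torus_map F" "torus_map (inv F)"
      "det (matrix (frechet_derivative F (at x))) = 1" for x
    using F unfolding SDiff_def by auto
  have G': "bij G" "smooth_on UNIV G" "smooth_on UNIV (inv G)" "torus_map G" "torus_map (inv G)"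
      "det (matrix (frechet_derivative G (at x))) = 1" for x
    using G unfolding SDiff_def by auto
  have inv: "inv (F \<circ> G) = inv G \<circ> inv F"
    using o_inv_distrib[OF F'(1) G'(1)] .
  have smooth: "smooth_on UNIV (F \<circ> G)" "smooth_on UNIV (inv G \<circ> inv F)"
    unfolding o_def using smooth_on_compose[OF F'(2) G'(2)] smooth_on_compose[OF G'(3) F'(3)] by simp_all
  have "det (matrix (frechet_derivative (F \<circ> G) (at x))) = 1" for x
  proof -
    note dF = smooth_UNIV_has_derivative[OF F'(2), of "G x"]
    note dG = smooth_UNIV_has_derivative[OF G'(2), of x]
    have "frechet_derivative (F \<circ> G) (at x) = frechet_derivative F (at (G x)) \<circ> frechet_derivative G (at x)"
      using frechet_derivative_at[OF diff_chain_at[OF dG dF]] by simp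
    then show ?thesis
      using matrix_compose[OF has_derivative_linear[OF dG] has_derivative_linear[OF dF]] F'(6) G'(6)
      by (simp add: det_mul)
  qed
  then show ?thesis
    using bij_comp[OF G'(1) F'(1)] smooth torus_map_compose[OF F'(4) G'(4)] torus_map_compose[OF G'(5) F'(5)]
    unfolding SDiff_def by (simp add: inv)
qed

subsection \<open>The first variation of the energy\<close>

lemma continuous_on_torus_integral:
  fixes h :: "'a::topological_space \<Rightarrow> real ^ 'n \<Rightarrow> real"
  assumes "continuous_on (S \<times> UNIV) (\<lambda>(t, x). h t x)"
  shows "continuous_on S (\<lambda>t. torus_integral (h t))"
  unfolding torus_integral_def
  by (rule integral_continuous_on_param) (rule continuous_on_subset[OF assms], auto)

lemma continuous_on_swap_args:
  assumes "continuous_on (S \<times> T) (\<lambda>(t, x). h t x)"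
  shows "continuous_on (T \<times> S) (\<lambda>(x, t). h t x)"
proof -
  have "continuous_on (T \<times> S) (\<lambda>z. (\<lambda>(t, x). h t x) (prod.swap z))"
    by (rule continuous_on_compose2[OF assms]) (auto intro!: continuous_on_swap)
  then show ?thesis by (simp add: case_prod_unfold)
qed

context flow
begin

abbreviation "vel \<equiv> time_deriv I X"
abbreviation "acc \<equiv> time_deriv I (time_deriv I X)"

lemma smooth_vel: "smooth_on (I \<times> UNIV) (\<lambda>(t, x). vel t x)"
  by (rule space_time_derivative(4)[OF smooth_X])

lemma smooth_acc: "smooth_on (I \<times> UNIV) (\<lambda>(t, x). acc t x)"
  by (rule space_time_derivative(4)[OF smooth_vel])

lemma smooth_along_flow:
  fixes h :: "real \<Rightarrow> real ^ 'n \<Rightarrow> 'b::real_normed_vector"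
  assumes "smooth_on (I \<times> UNIV) (\<lambda>(t, x). h t x)"
  shows "smooth_on (I \<times> UNIV) (\<lambda>(t, x). h t (X t x))"
proof -
  have "smooth_on (I \<times> UNIV) (\<lambda>z. (\<lambda>(t, x). h t x) (fst z, (\<lambda>(t, x). X t x) z))"
    by (rule smooth_on_compose[OF assms smooth_on_Pair[OF smooth_on_fst[OF smooth_on_ident] smooth_X]]) auto
  then show ?thesis by (simp add: case_prod_unfold)
qed

lemma smooth_along_inverse:
  fixes h :: "real \<Rightarrow> real ^ 'n \<Rightarrow> 'b::real_normed_vector"
  assumes "smooth_on (I \<times> UNIV) (\<lambda>(t, x). h t x)"
  shows "smooth_on (I \<times> UNIV) (\<lambda>(t, y). h t (inv (X t) y))"
proof -
  have "smooth_on (I \<times> UNIV) (\<lambda>z. (\<lambda>(t, x). h t x) (fst z, (\<lambda>(t, y). inv (X t) y) z))"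
    by (rule smooth_on_compose[OF assms smooth_on_Pair[OF smooth_on_fst[OF smooth_on_ident] smooth_inverse]]) auto
  then show ?thesis by (simp add: case_prod_unfold)
qed

lemma smooth_on_space:
  fixes f :: "real ^ 'n \<Rightarrow> 'b::real_normed_vector"
  assumes "smooth_on UNIV f"
  shows "smooth_on (I \<times> UNIV) (\<lambda>(t, x). f x)"
proof -
  have "smooth_on (I \<times> (UNIV :: (real ^ 'n) set)) (\<lambda>z. f (snd z))"
    by (rule smooth_on_compose[OF assms smooth_on_snd[OF smooth_on_ident]]) auto
  then show ?thesis by (simp add: case_prod_unfold)
qed

lemma smooth_on_time:
  fixes f :: "real \<Rightarrow> 'b::real_normed_vector"
  assumes "smooth_on UNIV f"
  shows "smooth_on (I \<times> UNIV) (\<lambda>(t, x :: real ^ 'n). f t)"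
proof -
  have "smooth_on (I \<times> (UNIV :: (real ^ 'n) set)) (\<lambda>z. f (fst z))"
    by (rule smooth_on_compose[OF assms smooth_on_fst[OF smooth_on_ident]]) auto
  then show ?thesis by (simp add: case_prod_unfold)
qed

text \<open>The amplitude of a shear enters linearly, so the perturbed curve is affine in
  \<open>s\<close> and no limit has to be taken under an integral. The linear coefficient of the
  energy vanishes by criticality; integrating it by parts in time moves the derivative from the
  cutoff wave \<open>G\<close> to the velocity.\<close>

lemma first_variation:
  assumes geodesic: "geodesic I \<rho>0 X" and \<rho>0: "continuous_on UNIV \<rho>0"
    and k: "k \<in> int_lattice" "k \<bullet> e = 0" and ab: "a < b" "{a..b} \<subseteq> I"
  shows "integral {a..b} (\<lambda>t. cutoff a b t *
    torus_integral (\<lambda>x. (acc t x \<bullet> e) * wave k \<theta> (X t x) * \<rho>0 x)) = 0"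
proof -
  interpret J: time_interval "{a..b}"
    by unfold_locales (use ab in \<open>auto simp: is_interval_cc\<close>)
  define G where "G t x = cutoff a b t * wave k \<theta> (X t x)" for t x
  define B where "B = time_deriv I G"
  define Y where "Y s t = shear k \<theta> e (s * cutoff a b t) \<circ> X t" for s t
  have Y: "Y s t x = X t x + (s * G t x) *\<^sub>R e" for s t x
    by (simp add: Y_def shear_def G_def)
  have smooth_G: "smooth_on (I \<times> UNIV) (\<lambda>(t, x). G t x)"
  proof -
    have "smooth_on (I \<times> UNIV) (\<lambda>z. (\<lambda>(t, x :: real ^ 'n). cutoff a b t) z * (\<lambda>(t, x). wave k \<theta> (X t x)) z)"
      by (intro smooth_on_mult smooth_on_time smooth_cutoff
          smooth_along_flow[of "\<lambda>t. wave k \<theta>"] smooth_on_space smooth_wave)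
    then show ?thesis by (simp add: G_def case_prod_unfold)
  qed
  have smooth_B: "smooth_on (I \<times> UNIV) (\<lambda>(t, x). B t x)"
    unfolding B_def by (rule space_time_derivative(4)[OF smooth_G])
  \<comment> \<open>The radius 1 is arbitrary: shears exist for all amplitudes.\<close>
  have "variation I a b X 1 Y"
    unfolding variation_def
  proof (intro conjI ballI)
    let ?D = "{- 1<..<1} \<times> I \<times> (UNIV :: (real ^ 'n) set)"
    have "smooth_on ?D (\<lambda>z. (\<lambda>(t, x). X t x) (snd z))"
      by (rule smooth_on_compose[OF smooth_X smooth_on_snd[OF smooth_on_ident]]) auto
    moreover have "smooth_on ?D (\<lambda>z. (\<lambda>(t, x). G t x) (snd z))"
      by (rule smooth_on_compose[OF smooth_G smooth_on_snd[OF smooth_on_ident]]) auto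
    ultimately have "smooth_on ?D (\<lambda>z. (\<lambda>(t, x). X t x) (snd z) + (fst z * (\<lambda>(t, x). G t x) (snd z)) *\<^sub>R e)"
      by (intro smooth_on_add smooth_on_scaleR smooth_on_mult smooth_on_const smooth_on_fst smooth_on_ident)
    then show "smooth_on ?D (\<lambda>(s, t, x). Y s t x)"
      by (simp add: Y case_prod_unfold)
    show "Y s t \<in> SDiff" if "t \<in> I" for s t
      unfolding Y_def by (intro SDiff_compose shear_SDiff k SDiff_X that)
    show "torus_eq (Y 0 t) (X t)" for t
      by (simp add: torus_eq_def Y int_lattice_0)
    show "torus_eq (Y s t) (X t)" if "t \<in> I - {a<..<b}" for s t
      using that by (simp add: torus_eq_def Y G_def cutoff_0 int_lattice_0)
  qed
  then have der: "((\<lambda>s. energy \<rho>0 a b (Y s)) has_real_derivative 0) (at 0)"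
    using geodesic ab unfolding geodesic_def by (meson zero_less_one)
  have der_t: "((\<lambda>\<tau>. h \<tau> x) has_vector_derivative time_deriv I h t x) (at t within {a..b})"
    if "smooth_on (I \<times> UNIV) (\<lambda>(t, x). h t x)" "t \<in> {a..b}"
    for h :: "real \<Rightarrow> real ^ 'n \<Rightarrow> 'b::real_normed_vector" and t x
    using space_time_derivative(2)[OF that(1)] that(2) ab(2) has_vector_derivative_within_subset by blast
  \<comment> \<open>\<open>energy\<close> differentiates within \<open>{a..b}\<close>, whereas
    \<open>vel\<close> and \<open>B\<close> are derivatives within \<open>I\<close>; these restrict
    to the smaller interval, which is nondegenerate, so that they are unique there.\<close>
  have td: "time_deriv {a..b} (Y s) t x = vel t x + (s * B t x) *\<^sub>R e" if t: "t \<in> {a..b}" for s t x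
  proof (rule J.time_deriv_eqI[OF _ t])
    have "((\<lambda>\<tau>. X \<tau> x + s *\<^sub>R (G \<tau> x *\<^sub>R e)) has_vector_derivative vel t x + s *\<^sub>R (B t x *\<^sub>R e)) (at t within {a..b})"
      unfolding B_def
      by (intro has_vector_derivative_add der_t[OF smooth_X t]
          bounded_linear.has_vector_derivative[OF bounded_linear_scaleR_right]
          bounded_linear.has_vector_derivative[OF bounded_linear_scaleR_left] der_t[OF smooth_G t])
    then show "((\<lambda>\<tau>. Y s \<tau> x) has_vector_derivative vel t x + (s * B t x) *\<^sub>R e) (at t within {a..b})"
      by (simp add: Y)
  qed
  have c: "continuous_on ({a..b} \<times> UNIV) (\<lambda>(t, x). h t x)"
    if "smooth_on (I \<times> UNIV) (\<lambda>(t, x). h t x)" for h :: "real \<Rightarrow> real ^ 'n \<Rightarrow> 'b::real_normed_vector"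
    using continuous_on_subset[OF smooth_on_continuous[OF that], of "{a..b} \<times> UNIV"] ab(2) by auto
  have c\<rho>: "continuous_on ({a..b} \<times> UNIV) (\<lambda>(t, x). \<rho>0 x)"
    unfolding case_prod_beta by (rule continuous_on_compose2[OF \<rho>0]) (auto intro!: continuous_intros)
  note cs = c[OF smooth_vel] c[OF smooth_acc] c[OF smooth_G] c[OF smooth_B] c\<rho>
  define f0 where "f0 t x = (vel t x \<bullet> vel t x) * \<rho>0 x" for t x
  define f1 where "f1 t x = (vel t x \<bullet> e) * B t x * \<rho>0 x" for t x
  define f2 where "f2 t x = B t x * B t x * (e \<bullet> e) * \<rho>0 x" for t x
  have cf0: "continuous_on ({a..b} \<times> UNIV) (\<lambda>(t, x). f0 t x)"
    using cs unfolding f0_def case_prod_beta by (intro continuous_intros)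
  have cf1: "continuous_on ({a..b} \<times> UNIV) (\<lambda>(t, x). f1 t x)"
    using cs unfolding f1_def case_prod_beta by (intro continuous_intros)
  have cf2: "continuous_on ({a..b} \<times> UNIV) (\<lambda>(t, x). f2 t x)"
    using cs unfolding f2_def case_prod_beta by (intro continuous_intros)
  have slice: "continuous_on UNIV (h t)" if "continuous_on ({a..b} \<times> UNIV) (\<lambda>(t, x). h t x)" "t \<in> {a..b}"
    for h :: "real \<Rightarrow> real ^ 'n \<Rightarrow> real" and t
    using continuous_on_compose2[OF that(1), of UNIV "\<lambda>x. (t, x)"] that(2)
    by (simp add: continuous_on_Pair image_subset_iff)
  have int: "(\<lambda>t. torus_integral (h t)) integrable_on {a..b}"
    if "continuous_on ({a..b} \<times> UNIV) (\<lambda>(t, x). h t x)" for h :: "real \<Rightarrow> real ^ 'n \<Rightarrow> real"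
    by (rule integrable_continuous_real[OF continuous_on_torus_integral[OF that]])
  let ?E = "\<lambda>f. integral {a..b} (\<lambda>t. torus_integral (f t))"
  have energy: "energy \<rho>0 a b (Y s) = 1 / 2 * ?E f0 + s * ?E f1 + s * s * (1 / 2 * ?E f2)" for s
  proof -
    have "weighted_metric \<rho>0 (time_deriv {a..b} (Y s) t) (time_deriv {a..b} (Y s) t) =
        torus_integral (f0 t) + ((2 * s) * torus_integral (f1 t) + (s * s) * torus_integral (f2 t))"
      if t: "t \<in> {a..b}" for t
    proof -
      have "weighted_metric \<rho>0 (time_deriv {a..b} (Y s) t) (time_deriv {a..b} (Y s) t) =
          torus_integral (\<lambda>x. f0 t x + ((2 * s) * f1 t x + (s * s) * f2 t x))"
        unfolding weighted_metric_def td[OF t] f0_def f1_def f2_def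
        by (simp add: inner_add_left inner_add_right inner_commute algebra_simps)
      also have "\<dots> = torus_integral (f0 t) + ((2 * s) * torus_integral (f1 t) + (s * s) * torus_integral (f2 t))"
        using slice[OF cf0 t] slice[OF cf1 t] slice[OF cf2 t]
        by (simp add: torus_integral_add torus_integral_cmult continuous_intros)
      finally show ?thesis .
    qed
    then have "energy \<rho>0 a b (Y s) = 1 / 2 * integral {a..b} (\<lambda>t. torus_integral (f0 t)
        + ((2 * s) * torus_integral (f1 t) + (s * s) * torus_integral (f2 t)))"
      unfolding energy_def by (intro arg_cong[of _ _ "(*) (1 / 2)"] Henstock_Kurzweil_Integration.integral_cong)
    also have "\<dots> = 1 / 2 * (?E f0 + ((2 * s) * ?E f1 + (s * s) * ?E f2))"
      using int[OF cf0] int[OF cf1] int[OF cf2]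
      by (simp add: integral_add integrable_add integrable_on_cmult_left integrable_on_mult_right)
    finally show ?thesis by (simp add: algebra_simps)
  qed
  have "((\<lambda>s. energy \<rho>0 a b (Y s)) has_real_derivative ?E f1) (at 0)"
    unfolding energy by (auto intro!: derivative_eq_intros)
  then have "?E f1 = 0" using der DERIV_unique by blast
  define g where "g t x = (acc t x \<bullet> e) * G t x * \<rho>0 x" for t x
  have cg: "continuous_on ({a..b} \<times> UNIV) (\<lambda>(t, x). g t x)"
    using cs unfolding g_def case_prod_beta by (intro continuous_intros)
  \<comment> \<open>Integration by parts takes place in time at fixed \<open>x\<close>, which is why
    the two integrals are exchanged before and after it. The boundary terms vanish because the
    cutoff is zero at \<open>a\<close> and \<open>b\<close>.\<close>
  have parts: "integral {a..b} (\<lambda>t. f1 t x) = - integral {a..b} (\<lambda>t. g t x)" for x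
  proof -
    have slice_t: "(\<lambda>t. h t x) integrable_on {a..b}" if "continuous_on ({a..b} \<times> UNIV) (\<lambda>(t, x). h t x)"
      for h :: "real \<Rightarrow> real ^ 'n \<Rightarrow> real"
      using continuous_on_compose2[OF that, of "{a..b}" "\<lambda>t. (t, x)"]
      by (intro integrable_continuous_real) (simp add: continuous_on_Pair image_subset_iff)
    have "((\<lambda>t. f1 t x + g t x) has_integral (vel b x \<bullet> e) * G b x * \<rho>0 x - (vel a x \<bullet> e) * G a x * \<rho>0 x) {a..b}"
    proof (rule fundamental_theorem_of_calculus)
      show "a \<le> b" using ab by simp
      fix t assume t: "t \<in> {a..b}"
      have "((\<lambda>t. vel t x \<bullet> e) has_vector_derivative acc t x \<bullet> e) (at t within {a..b})"
        by (rule bounded_linear.has_vector_derivative[OF bounded_linear_inner_left der_t[OF smooth_vel t]])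
      from has_vector_derivative_mult[OF this der_t[OF smooth_G t]]
      have "((\<lambda>t. (vel t x \<bullet> e) * G t x) has_vector_derivative (vel t x \<bullet> e) * B t x + (acc t x \<bullet> e) * G t x) (at t within {a..b})"
        by (simp add: B_def)
      from bounded_linear.has_vector_derivative[OF bounded_linear_mult_left this]
      show "((\<lambda>t. (vel t x \<bullet> e) * G t x * \<rho>0 x) has_vector_derivative f1 t x + g t x) (at t within {a..b})"
        by (simp add: f1_def g_def algebra_simps)
    qed
    then have "integral {a..b} (\<lambda>t. f1 t x + g t x) = 0"
      by (simp add: G_def cutoff_0 integral_unique)
    then show ?thesis
      using slice_t[OF cf1] slice_t[OF cg] by (simp add: integral_add)
  qed
  have "?E f1 = torus_integral (\<lambda>x. integral {a..b} (\<lambda>t. f1 t x))"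
    by (rule torus_integral_swap[OF continuous_on_swap_args[OF cf1], symmetric])
  also have "\<dots> = - torus_integral (\<lambda>x. integral {a..b} (\<lambda>t. g t x))"
    by (simp add: parts torus_integral_minus)
  also have "torus_integral (\<lambda>x. integral {a..b} (\<lambda>t. g t x)) = ?E g"
    by (rule torus_integral_swap[OF continuous_on_swap_args[OF cg]])
  finally have "?E g = 0" using \<open>?E f1 = 0\<close> by simp
  moreover have "torus_integral (g t) = cutoff a b t * torus_integral (\<lambda>x. (acc t x \<bullet> e) * wave k \<theta> (X t x) * \<rho>0 x)" for t
    unfolding torus_integral_cmult[symmetric] g_def[abs_def] G_def by (simp add: mult_ac)
  ultimately show ?thesis by simp
qed

text \<open>Fundamental lemma of the calculus of variations: were the continuous function
  \<open>m\<close> nonzero at \<open>t0\<close>, it would keep its sign on a short interval, and its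
  integral against the cutoff of that interval could not vanish.\<close>

lemma acceleration_orthogonal:
  assumes geodesic: "geodesic I \<rho>0 X" and \<rho>0: "continuous_on UNIV \<rho>0"
    and k: "k \<in> int_lattice" "k \<bullet> e = 0" and t0: "t0 \<in> I"
  shows "torus_integral (\<lambda>x. (acc t0 x \<bullet> e) * wave k \<theta> (X t0 x) * \<rho>0 x) = 0"
proof (rule ccontr)
  define m where "m t = torus_integral (\<lambda>x. (acc t x \<bullet> e) * wave k \<theta> (X t x) * \<rho>0 x)" for t
  assume "\<not> ?thesis"
  then have m0: "m t0 \<noteq> 0" by (simp add: m_def)
  have m: "continuous_on I m"
    unfolding m_def[abs_def]
  proof (rule continuous_on_torus_integral)
    have "continuous_on (I \<times> UNIV) (\<lambda>z. \<rho>0 (snd z))"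
      by (rule continuous_on_compose2[OF \<rho>0]) (auto intro!: continuous_intros)
    moreover have "continuous_on (I \<times> UNIV) (\<lambda>z. wave k \<theta> (X (fst z) (snd z)))"
      using smooth_on_continuous[OF smooth_X] unfolding case_prod_beta
      by (intro continuous_on_compose2[OF continuous_wave[of UNIV]]) auto
    ultimately show "continuous_on (I \<times> UNIV) (\<lambda>(t, x). (acc t x \<bullet> e) * wave k \<theta> (X t x) * \<rho>0 x)"
      using smooth_on_continuous[OF smooth_acc] unfolding case_prod_beta by (intro continuous_intros)
  qed
  obtain d where d: "d > 0" "\<And>t. t \<in> I \<Longrightarrow> \<bar>t - t0\<bar> < d \<Longrightarrow> \<bar>m t - m t0\<bar> < \<bar>m t0\<bar>"
    using m t0 m0 unfolding continuous_on_iff dist_real_def by (metis zero_less_abs_iff)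
  \<comment> \<open>\<open>t0\<close> may be an end point of \<open>I\<close>, so the interval
    extends from \<open>t0\<close> to a side that stays in \<open>I\<close>.\<close>
  obtain \<delta> where \<delta>: "0 < \<bar>\<delta>\<bar>" "\<bar>\<delta>\<bar> < d" "t0 + \<delta> \<in> I"
    using fat_I t0 d(1) unfolding fat_def by (metis Basis_real_def real_scaleR_def mult.right_neutral singletonI)
  define a b where "a = min t0 (t0 + \<delta>)" and "b = max t0 (t0 + \<delta>)"
  have ab: "a < b" "a \<in> I" "b \<in> I" using \<delta> t0 by (auto simp: a_def b_def min_def max_def)
  have sub: "{a..b} \<subseteq> I" using mem_is_interval_1_I[OF interval ab(2,3)] by (auto simp: subset_iff)
  \<comment> \<open>The factor \<open>m t0\<close> treats both signs at once.\<close>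
  have pos: "m t * m t0 > 0" if "t \<in> {a..b}" for t
  proof -
    have "\<bar>t - t0\<bar> < d" using that \<delta> by (auto simp: a_def b_def)
    then have "\<bar>m t - m t0\<bar> < \<bar>m t0\<bar>" using d(2) sub that by blast
    then show ?thesis by (cases "m t0 > 0") (auto simp: zero_less_mult_iff abs_if split: if_splits)
  qed
  have cont: "continuous_on {a..b} (\<lambda>t. cutoff a b t * (m t * m t0))"
    using continuous_on_subset[OF m sub] smooth_on_continuous[OF smooth_cutoff]
    by (intro continuous_intros)
  have "integral {a..b} (\<lambda>t. cutoff a b t * m t) = 0"
    unfolding m_def by (rule first_variation[OF geodesic \<rho>0 k ab(1) sub])
  then have "integral {a..b} (\<lambda>t. cutoff a b t * m t * m t0) = 0" by simp
  then have "integral {a..b} (\<lambda>t. cutoff a b t * (m t * m t0)) = 0" by (simp only: mult.assoc)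
  then have "((\<lambda>t. cutoff a b t * (m t * m t0)) has_integral 0) (cbox a b)"
    using integrable_continuous_real[OF cont] by (metis has_integral_integral box_real(2))
  then have "cutoff a b ((a + b) / 2) * (m ((a + b) / 2) * m t0) = 0"
  proof (rule has_integral_0_cbox_imp_0[rotated 2])
    show "continuous_on (cbox a b) (\<lambda>t. cutoff a b t * (m t * m t0))" using cont by simp
    show "0 \<le> cutoff a b t * (m t * m t0)" if "t \<in> box a b" for t
    proof -
      have "t \<in> {a..b}" using that by simp
      then show ?thesis
        by (rule mult_nonneg_nonneg[OF cutoff_nonneg less_imp_le[OF pos]])
    qed
  qed (use ab(1) in auto)
  then show False
    using cutoff_pos[of "(a + b) / 2" a b] pos[of "(a + b) / 2"] ab(1) by (auto simp: field_simps)
qed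

lemma vel_periodic: "t \<in> I \<Longrightarrow> periodic (vel t)"
  unfolding periodic_def
proof (intro allI ballI)
  fix x k :: "real ^ 'n" assume t: "t \<in> I" and k: "k \<in> int_lattice"
  have "((\<lambda>\<tau>. X \<tau> x + k) has_vector_derivative vel t x) (at t within I)"
    using has_vector_derivative_add[OF space_time_derivative(2)[OF smooth_X t] has_vector_derivative_const] by simp
  from has_vector_derivative_transform[OF t _ this, of "\<lambda>\<tau>. X \<tau> (x + k)"]
  have "((\<lambda>\<tau>. X \<tau> (x + k)) has_vector_derivative vel t x) (at t within I)"
    using X_translate[OF _ k] by simp
  then show "vel t (x + k) = vel t x" by (rule time_deriv_eqI[OF _ t])
qed

lemma acc_periodic: "t \<in> I \<Longrightarrow> periodic (acc t)"
  unfolding periodic_def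
proof (intro allI ballI)
  fix x k :: "real ^ 'n" assume t: "t \<in> I" and k: "k \<in> int_lattice"
  have "((\<lambda>\<tau>. vel \<tau> (x + k)) has_vector_derivative acc t x) (at t within I)"
    by (rule has_vector_derivative_transform[OF t _ space_time_derivative(2)[OF smooth_vel t]])
      (use vel_periodic k in \<open>auto simp: periodic_def\<close>)
  then show "acc t (x + k) = acc t x" by (rule time_deriv_eqI[OF _ t])
qed

end

subsection \<open>Vector calculus on the torus\<close>

lemma linear_vec_expansion:
  fixes D :: "real ^ 'n \<Rightarrow> 'b::real_vector"
  assumes "linear D"
  shows "D v = (\<Sum>i\<in>UNIV. v $ i *\<^sub>R D (axis i 1))"
proof -
  have "D (\<Sum>i\<in>UNIV. v $ i *\<^sub>R axis i 1) = (\<Sum>i\<in>UNIV. v $ i *\<^sub>R D (axis i 1))"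
    using assms by (simp add: linear_sum linear_cmul)
  then show ?thesis by (simp add: basis_expansion scalar_mult_eq_scaleR[symmetric])
qed

lemma grad_eq: "(f has_derivative f') (at x) \<Longrightarrow> grad f x = (\<chi> i. f' (axis i 1))"
  unfolding grad_def using frechet_derivative_at by metis

lemma grad_inner:
  assumes "(f has_derivative f') (at x)"
  shows "f' v = v \<bullet> grad f x"
  unfolding grad_eq[OF assms] linear_vec_expansion[OF has_derivative_linear[OF assms], of v]
  by (simp add: inner_vec_def)

lemma grad_unique:
  assumes "(f has_derivative (\<lambda>h. w \<bullet> h)) (at x)"
  shows "grad f x = w"
  unfolding grad_eq[OF assms] by (simp add: vec_eq_iff inner_axis)

lemma divg_eq: "(v has_derivative v') (at x) \<Longrightarrow> divg v x = (\<Sum>i\<in>UNIV. v' (axis i 1) $ i)"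
  unfolding divg_def using frechet_derivative_at by metis

lemma divg_add:
  assumes "smooth_on UNIV v" "smooth_on UNIV w"
  shows "divg (\<lambda>x. v x + w x) x = divg v x + divg w x"
  by (simp add: divg_def[of v] divg_def[of w] sum.distrib
      divg_eq[OF has_derivative_add[OF smooth_UNIV_has_derivative[OF assms(1)] smooth_UNIV_has_derivative[OF assms(2)]]])

lemma divg_scaleR:
  assumes "smooth_on UNIV f" "smooth_on UNIV v"
  shows "divg (\<lambda>x. f x *\<^sub>R v x) x = f x * divg v x + v x \<bullet> grad f x"
  by (simp add: divg_def[of v] grad_def sum.distrib sum_distrib_left inner_vec_def mult_ac
      divg_eq[OF has_derivative_scaleR[OF smooth_UNIV_has_derivative[OF assms(1)] smooth_UNIV_has_derivative[OF assms(2)]]])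

lemma smooth_grad:
  assumes "smooth_on UNIV f"
  shows "smooth_on UNIV (grad f)"
  by (rule smooth_on_vec) (simp add: grad_def smooth_UNIV_frechet_derivative[OF assms])

lemma smooth_divg:
  assumes "smooth_on UNIV v"
  shows "smooth_on UNIV (divg v)"
  unfolding divg_def[abs_def]
  by (intro smooth_on_sum smooth_on_nth smooth_UNIV_frechet_derivative[OF assms])

lemma periodic_frechet_derivative:
  "smooth_on UNIV f \<Longrightarrow> periodic f \<Longrightarrow> periodic (\<lambda>x. frechet_derivative f (at x))"
  by (rule periodic_derivative[OF _ smooth_UNIV_has_derivative])

lemma component_has_derivative:
  assumes "smooth_on UNIV v"
  shows "((\<lambda>x. v x $ i) has_derivative (\<lambda>h. frechet_derivative v (at x) h $ i)) (at x)"
  by (rule bounded_linear.has_derivative[OF bounded_linear_vec_nth smooth_UNIV_has_derivative[OF assms]])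

lemma torus_integral_partial_wave:
  assumes v: "smooth_on UNIV v" "periodic v" and k: "k \<in> int_lattice"
  shows "torus_integral (\<lambda>x. frechet_derivative v (at x) (axis j 1) $ i * wave k \<theta> x) =
    - (2 * pi * k $ j * torus_integral (\<lambda>x. v x $ i * wave k (\<theta> + pi / 2) x))"
proof -
  have "continuous_on UNIV (\<lambda>x. frechet_derivative v (at x) (axis j 1) $ i)"
    by (rule smooth_on_continuous[OF smooth_on_nth[OF smooth_UNIV_frechet_derivative[OF v(1)]]])
  moreover have "periodic (\<lambda>x. v x $ i)" using v(2) by (simp add: periodic_def)
  ultimately show ?thesis
    using torus_integral_wave_by_parts[OF _ component_has_derivative[OF v(1)] _ k, of i "axis j 1" \<theta>]
    by (simp add: inner_axis)
qed

lemma torus_integral_divg_wave: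
  assumes v: "smooth_on UNIV v" "periodic v" and k: "k \<in> int_lattice"
  shows "torus_integral (\<lambda>x. divg v x * wave k \<theta> x) =
    - (2 * pi * torus_integral (\<lambda>x. (k \<bullet> v x) * wave k (\<theta> + pi / 2) x))"
proof -
  note c = smooth_on_continuous[OF smooth_on_nth[OF v(1)]]
    smooth_on_continuous[OF smooth_on_nth[OF smooth_UNIV_frechet_derivative[OF v(1)]]]
  have "torus_integral (\<lambda>x. divg v x * wave k \<theta> x) =
      (\<Sum>i\<in>UNIV. torus_integral (\<lambda>x. frechet_derivative v (at x) (axis i 1) $ i * wave k \<theta> x))"
    unfolding divg_def sum_distrib_right
    by (rule torus_integral_sum) (simp, intro continuous_intros c continuous_wave)
  also have "\<dots> = (\<Sum>i\<in>UNIV. - (2 * pi) * torus_integral (\<lambda>x. k $ i * (v x $ i * wave k (\<theta> + pi / 2) x)))"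
    by (rule sum.cong[OF refl])
      (simp only: torus_integral_partial_wave[OF assms] torus_integral_cmult mult_minus_left mult.assoc)
  also have "\<dots> = - (2 * pi) * torus_integral (\<lambda>x. \<Sum>i\<in>UNIV. k $ i * (v x $ i * wave k (\<theta> + pi / 2) x))"
    unfolding sum_distrib_left[symmetric]
    by (subst torus_integral_sum) (auto intro!: continuous_intros c continuous_wave)
  finally show ?thesis
    by (simp add: inner_vec_def sum_distrib_left sum_distrib_right mult_ac)
qed

lemma torus_integral_divg:
  assumes "smooth_on UNIV v" "periodic v"
  shows "torus_integral (divg v) = 0"
  using torus_integral_divg_wave[OF assms int_lattice_0, of 0] by (simp add: wave_def torus_integral_def)

lemma periodic_divg: "smooth_on UNIV v \<Longrightarrow> periodic v \<Longrightarrow> periodic (divg v)"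
  using periodic_frechet_derivative[of v] unfolding periodic_def divg_def by simp

text \<open>By parts, mode \<open>k\<close> sees the divergence only through
  \<open>k \<bullet> v\<close>. The test involves no derivative of \<open>v\<close>, so it can be
  verified from integrals that do not depend on time.\<close>

lemma divg_eq_0I:
  assumes v: "smooth_on UNIV v" "periodic v"
    and orth: "\<And>k \<theta>. k \<in> int_lattice \<Longrightarrow> torus_integral (\<lambda>x. (k \<bullet> v x) * wave k \<theta> x) = 0"
  shows "divg v x = 0"
proof (rule wave_complete)
  show "continuous_on UNIV (divg v)" by (rule smooth_on_continuous[OF smooth_divg[OF v(1)]])
  show "periodic (divg v)" by (rule periodic_divg[OF v])
  show "torus_integral (\<lambda>x. divg v x * wave k \<theta> x) = 0" if "k \<in> int_lattice" for k \<theta>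
    using torus_integral_divg_wave[OF v that] orth[OF that] by simp
qed

text \<open>For the difference \<open>\<eta>\<close> of two solutions, the divergence of
  \<open>\<eta> x *\<^sub>R v x\<close> reduces to the weighted square of \<open>grad \<eta>\<close>
  and integrates to zero. So \<open>\<eta>\<close> is constant, and the zero means remove the
  constant.\<close>

lemma weighted_poisson_unique:
  fixes \<rho> :: "real ^ 'n \<Rightarrow> real"
  assumes \<rho>: "smooth_on UNIV \<rho>" "periodic \<rho>" "\<And>x. \<rho> x > 0"
    and sol: "weighted_poisson_solution \<rho> f \<phi>" "weighted_poisson_solution \<rho> f \<psi>"
  shows "\<phi> = \<psi>"
proof -
  have \<phi>: "smooth_on UNIV \<phi>" "periodic \<phi>" "torus_integral \<phi> = 0" "\<And>x. weighted_laplacian \<rho> \<phi> x = f x"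
    and \<psi>: "smooth_on UNIV \<psi>" "periodic \<psi>" "torus_integral \<psi> = 0" "\<And>x. weighted_laplacian \<rho> \<psi> x = f x"
    using sol unfolding weighted_poisson_solution_def by blast+
  define \<eta> where "\<eta> x = \<phi> x - \<psi> x" for x
  have \<eta>: "smooth_on UNIV \<eta>" "periodic \<eta>"
    unfolding \<eta>_def[abs_def] using smooth_on_diff[OF \<phi>(1) \<psi>(1)] \<phi>(2) \<psi>(2) by (auto simp: periodic_def)
  have sm_inv: "smooth_on UNIV (\<lambda>x. inverse (\<rho> x))"
    using \<rho>(1,3) by (intro smooth_on_inverse) (auto simp: less_imp_neq[symmetric])
  define v where "v x = inverse (\<rho> x) *\<^sub>R grad \<eta> x" for x
  have sv: "smooth_on UNIV v"
    unfolding v_def[abs_def] by (intro smooth_on_scaleR sm_inv smooth_grad \<eta>)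
  have grad_\<eta>: "grad \<eta> x = grad \<phi> x - grad \<psi> x" for x
  proof -
    have "(\<eta> has_derivative (\<lambda>h. frechet_derivative \<phi> (at x) h - frechet_derivative \<psi> (at x) h)) (at x)"
      unfolding \<eta>_def[abs_def]
      by (intro has_derivative_diff smooth_UNIV_has_derivative \<phi>(1) \<psi>(1))
    from grad_eq[OF this] show ?thesis by (simp add: grad_def[of \<phi>] grad_def[of \<psi>] vec_eq_iff)
  qed
  have div_v: "divg v x = 0" for x
  proof -
    have "divg (\<lambda>x. v x + inverse (\<rho> x) *\<^sub>R grad \<psi> x) x = divg v x + divg (\<lambda>x. inverse (\<rho> x) *\<^sub>R grad \<psi> x) x"
      by (intro divg_add sv smooth_on_scaleR sm_inv smooth_grad \<psi>(1))
    moreover have "(\<lambda>x. v x + inverse (\<rho> x) *\<^sub>R grad \<psi> x) = (\<lambda>x. inverse (\<rho> x) *\<^sub>R grad \<phi> x)"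
      by (simp add: v_def grad_\<eta> scaleR_right_diff_distrib)
    ultimately show ?thesis
      using \<phi>(4)[of x] \<psi>(4)[of x] unfolding weighted_laplacian_def by simp
  qed
  have pg: "periodic (grad \<eta>)"
    using periodic_frechet_derivative[OF \<eta>] unfolding periodic_def grad_def by simp
  have "divg (\<lambda>x. \<eta> x *\<^sub>R v x) = (\<lambda>x. inverse (\<rho> x) * (grad \<eta> x \<bullet> grad \<eta> x))"
    by (rule ext) (simp add: divg_scaleR[OF \<eta>(1) sv] div_v, simp add: v_def)
  moreover have "torus_integral (divg (\<lambda>x. \<eta> x *\<^sub>R v x)) = 0"
  proof (rule torus_integral_divg)
    show "smooth_on UNIV (\<lambda>x. \<eta> x *\<^sub>R v x)" by (intro smooth_on_scaleR \<eta>(1) sv)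
    show "periodic (\<lambda>x. \<eta> x *\<^sub>R v x)" using \<eta>(2) pg \<rho>(2) by (simp add: periodic_def v_def)
  qed
  ultimately have "torus_integral (\<lambda>x. inverse (\<rho> x) * (grad \<eta> x \<bullet> grad \<eta> x)) = 0"
    by simp
  then have "inverse (\<rho> x) * (grad \<eta> x \<bullet> grad \<eta> x) = 0" for x
  proof (rule torus_integral_nonneg_eq_0[rotated 3])
    show "continuous_on UNIV (\<lambda>x. inverse (\<rho> x) * (grad \<eta> x \<bullet> grad \<eta> x))"
      by (intro smooth_on_continuous smooth_on_mult smooth_on_inner sm_inv smooth_grad \<eta>(1))
    show "periodic (\<lambda>x. inverse (\<rho> x) * (grad \<eta> x \<bullet> grad \<eta> x))"
      using pg \<rho>(2) by (simp add: periodic_def)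
    show "0 \<le> inverse (\<rho> x) * (grad \<eta> x \<bullet> grad \<eta> x)" for x
      using \<rho>(3)[of x] by (simp add: less_imp_le)
  qed
  then have g0: "grad \<eta> x = 0" for x
    using \<rho>(3)[of x] by (metis inner_eq_zero_iff inverse_nonzero_iff_nonzero less_irrefl mult_eq_0_iff)
  have "(\<eta> has_derivative (\<lambda>h. 0)) (at x within UNIV)" for x
  proof -
    have "frechet_derivative \<eta> (at x) = (\<lambda>h. 0)"
      using grad_inner[OF smooth_UNIV_has_derivative[OF \<eta>(1)], of x] g0[of x] by (simp add: fun_eq_iff)
    then show ?thesis using smooth_UNIV_has_derivative[OF \<eta>(1), of x] by simp
  qed
  then obtain c where c: "\<And>x. \<eta> x = c"
    using has_derivative_zero_constant[of UNIV \<eta>] by (metis convex_UNIV UNIV_I)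
  have "torus_integral \<eta> = 0"
    unfolding \<eta>_def[abs_def]
    using torus_integral_diff[OF smooth_on_continuous[OF \<phi>(1)] smooth_on_continuous[OF \<psi>(1)]] \<phi>(3) \<psi>(3) by simp
  moreover have "\<eta> = (\<lambda>x. c)" using c by (simp add: fun_eq_iff)
  ultimately have "c = 0" by (simp add: torus_integral_const)
  then show ?thesis using c by (simp add: \<eta>_def fun_eq_iff)
qed

section \<open>Conserved integrals and potentials of time-dependent fields\<close>

context time_interval
begin

lemma torus_integral_time_deriv:
  fixes h :: "real \<Rightarrow> real ^ 'n \<Rightarrow> real"
  assumes h: "smooth_on (I \<times> UNIV) (\<lambda>(t, x). h t x)"
    and const: "\<And>t. t \<in> I \<Longrightarrow> torus_integral (h t) = c" and t: "t \<in> I"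
  shows "torus_integral (time_deriv I h t) = 0"
proof -
  have "((\<lambda>t. integral (cbox 0 1) (h t)) has_vector_derivative integral (cbox 0 1) (time_deriv I h t)) (at t within I)"
  proof (rule leibniz_rule_vector_derivative[OF _ _ _ t])
    show "((\<lambda>t. h t x) has_vector_derivative time_deriv I h t x) (at t within I)" if "t \<in> I" for t x
      by (rule space_time_derivative(2)[OF h that])
    show "h t integrable_on cbox 0 1" if "t \<in> I" for t
      by (rule continuous_integrable_cbox[OF smooth_on_continuous[OF smooth_on_slice[OF h that]]])
    show "continuous_on (I \<times> cbox 0 1) (\<lambda>(t, x). time_deriv I h t x)"
      by (rule continuous_on_subset[OF smooth_on_continuous[OF space_time_derivative(4)[OF h]]]) auto
    show "convex I" using interval by (simp add: is_interval_convex)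
  qed
  then have d: "((\<lambda>t. torus_integral (h t)) has_vector_derivative torus_integral (time_deriv I h t)) (at t within I)"
    by (simp add: torus_integral_def)
  have "((\<lambda>t. torus_integral (h t)) has_vector_derivative 0) (at t within I)"
    by (rule has_vector_derivative_transform[OF t _ has_vector_derivative_const[of c]]) (simp add: const)
  with d show ?thesis
    using at_within_I[OF t] by (simp add: vector_derivative_unique_within)
qed

text \<open>Integrating along rays from the origin gives a potential \<open>q0\<close> that is
  jointly smooth, being a parametric integral. Since \<open>w\<close> is periodic, the increment of
  \<open>q0\<close> over a lattice vector \<open>k\<close> is constant; it equals the mean of
  \<open>w t x \<bullet> k\<close>, hence zero.\<close>

lemma periodic_potential:
  fixes w :: "real \<Rightarrow> real ^ 'n \<Rightarrow> real ^ 'n"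
  assumes w: "smooth_on (I \<times> UNIV) (\<lambda>(t, x). w t x)" and per: "\<And>t. t \<in> I \<Longrightarrow> periodic (w t)"
    and sym: "\<And>t x i j. t \<in> I \<Longrightarrow>
      frechet_derivative (w t) (at x) (axis i 1) $ j = frechet_derivative (w t) (at x) (axis j 1) $ i"
    and mean: "\<And>t e. t \<in> I \<Longrightarrow> torus_integral (\<lambda>x. w t x \<bullet> e) = 0"
  obtains q where "smooth_torus_field I q" "\<And>t. t \<in> I \<Longrightarrow> torus_integral (q t) = 0"
    "\<And>t x. t \<in> I \<Longrightarrow> (q t has_derivative (\<lambda>h. w t x \<bullet> h)) (at x)"
proof -
  define q0 where "q0 t x = integral {0..1} (\<lambda>s. w t (s *\<^sub>R x) \<bullet> x)" for t x
  have convex_S: "convex (I \<times> (UNIV :: (real ^ 'n) set))"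
    using interval by (intro convex_Times) (auto simp: is_interval_convex)
  have smooth_q0: "smooth_on (I \<times> UNIV) (\<lambda>(t, x). q0 t x)"
  proof -
    let ?D = "(I \<times> (UNIV :: (real ^ 'n) set)) \<times> cbox (0 :: real) 1"
    have "smooth_on ?D (\<lambda>z. (\<lambda>(t, x). w t x) (fst (fst z), snd z *\<^sub>R snd (fst z)))"
      by (rule smooth_on_compose[OF w])
        (intro smooth_on_Pair smooth_on_scaleR smooth_on_fst smooth_on_snd smooth_on_ident, auto)
    then have "smooth_on ?D (\<lambda>z. (\<lambda>(t, x). w t x) (fst (fst z), snd z *\<^sub>R snd (fst z)) \<bullet> snd (fst z))"
      by (intro smooth_on_inner smooth_on_fst smooth_on_snd smooth_on_ident)
    then have "smooth_on ?D (\<lambda>(y, s). w (fst y) (s *\<^sub>R snd y) \<bullet> snd y)"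
      by (simp add: case_prod_unfold)
    from smooth_on_integral[OF convex_S this] show ?thesis
      by (simp add: q0_def case_prod_unfold)
  qed
  have der_w: "(w t has_derivative frechet_derivative (w t) (at x)) (at x)" if "t \<in> I" for t x
    using space_time_derivative(3)[OF w that] .
  have sym': "frechet_derivative (w t) (at x) h \<bullet> y = frechet_derivative (w t) (at x) y \<bullet> h"
    if t: "t \<in> I" for t x h y
  proof -
    let ?D = "frechet_derivative (w t) (at x)"
    have lin: "linear ?D" using der_w[OF t] has_derivative_linear by blast
    have D: "?D h \<bullet> y = (\<Sum>i\<in>UNIV. \<Sum>j\<in>UNIV. h $ i * y $ j * ?D (axis i 1) $ j)" for h y
      by (subst linear_vec_expansion[OF lin])
        (simp add: inner_vec_def inner_sum_left sum_distrib_left sum_distrib_right mult_ac, rule sum.swap)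
    have "?D h \<bullet> y = (\<Sum>j\<in>UNIV. \<Sum>i\<in>UNIV. h $ i * y $ j * ?D (axis i 1) $ j)"
      unfolding D by (rule sum.swap)
    also have "\<dots> = (\<Sum>j\<in>UNIV. \<Sum>i\<in>UNIV. y $ j * h $ i * ?D (axis j 1) $ i)"
      by (intro sum.cong refl) (simp add: sym[OF t, of x] mult_ac)
    also have "\<dots> = ?D y \<bullet> h" by (rule D[symmetric])
    finally show ?thesis .
  qed
  have der_q0: "(q0 t has_derivative (\<lambda>h. w t x \<bullet> h)) (at x)" if t: "t \<in> I" for t x
  proof -
    note dq = space_time_derivative(3)[OF smooth_q0 t, of x]
    have cw: "continuous_on UNIV (w t)"
      by (rule smooth_on_continuous[OF smooth_on_slice[OF w t]])
    have cD: "continuous_on UNIV (\<lambda>y. frechet_derivative (w t) (at y) v)" for v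
      by (rule smooth_on_continuous[OF smooth_UNIV_frechet_derivative[OF smooth_on_slice[OF w t]]])
    have "frechet_derivative (q0 t) (at x) h = w t x \<bullet> h" for h
    proof -
      have line: "((\<lambda>r. x + r *\<^sub>R h) has_vector_derivative h) (at r)" for r
        by (auto intro!: derivative_eq_intros)
      have dq': "((\<lambda>r. q0 t (x + r *\<^sub>R h)) has_vector_derivative frechet_derivative (q0 t) (at x) h) (at 0)"
        using vector_derivative_diff_chain_within[OF line[of 0], of "q0 t" "frechet_derivative (q0 t) (at x)"] dq
        by (simp add: o_def has_derivative_at_withinI)
      define F where "F r s = frechet_derivative (w t) (at (s *\<^sub>R (x + r *\<^sub>R h))) (s *\<^sub>R h) \<bullet> (x + r *\<^sub>R h)
          + w t (s *\<^sub>R (x + r *\<^sub>R h)) \<bullet> h" for r s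
      have "((\<lambda>r. integral (cbox 0 1) (\<lambda>s. w t (s *\<^sub>R (x + r *\<^sub>R h)) \<bullet> (x + r *\<^sub>R h)))
          has_vector_derivative integral (cbox 0 1) (F 0)) (at 0 within UNIV)"
      proof (rule leibniz_rule_vector_derivative[of UNIV 0 1 _ F])
        fix r s :: real
        have "((\<lambda>r. s *\<^sub>R (x + r *\<^sub>R h)) has_vector_derivative s *\<^sub>R h) (at r)"
          by (rule bounded_linear.has_vector_derivative[OF bounded_linear_scaleR_right line])
        then have "((\<lambda>r. w t (s *\<^sub>R (x + r *\<^sub>R h))) has_vector_derivative
            frechet_derivative (w t) (at (s *\<^sub>R (x + r *\<^sub>R h))) (s *\<^sub>R h)) (at r)"
          using vector_derivative_diff_chain_within[of "\<lambda>r. s *\<^sub>R (x + r *\<^sub>R h)" "s *\<^sub>R h" r UNIV "w t"]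
            der_w[OF t] by (simp add: o_def has_derivative_at_withinI)
        from bounded_bilinear.has_vector_derivative[OF bounded_bilinear_inner this line]
        show "((\<lambda>r. w t (s *\<^sub>R (x + r *\<^sub>R h)) \<bullet> (x + r *\<^sub>R h)) has_vector_derivative F r s) (at r within UNIV)"
          by (simp add: F_def add.commute)
      next
        fix r :: real
        have "continuous_on (cbox 0 1) (\<lambda>s. w t (s *\<^sub>R (x + r *\<^sub>R h)))"
          by (rule continuous_on_compose2[OF cw]) (intro continuous_intros, simp)
        then show "(\<lambda>s. w t (s *\<^sub>R (x + r *\<^sub>R h)) \<bullet> (x + r *\<^sub>R h)) integrable_on cbox 0 1"
          by (intro integrable_continuous continuous_on_inner continuous_on_const)
      next
        have F: "F r s = s * (frechet_derivative (w t) (at (s *\<^sub>R (x + r *\<^sub>R h))) h \<bullet> (x + r *\<^sub>R h))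
            + w t (s *\<^sub>R (x + r *\<^sub>R h)) \<bullet> h" for r s
          unfolding F_def linear_cmul[OF has_derivative_linear[OF der_w[OF t]]] by simp
        have "continuous_on (UNIV \<times> cbox 0 1) (\<lambda>z. w t (snd z *\<^sub>R (x + fst z *\<^sub>R h)))"
          by (rule continuous_on_compose2[OF cw]) (intro continuous_intros, simp)
        moreover have "continuous_on (UNIV \<times> cbox 0 1)
            (\<lambda>z. frechet_derivative (w t) (at (snd z *\<^sub>R (x + fst z *\<^sub>R h))) h)"
          by (rule continuous_on_compose2[OF cD]) (intro continuous_intros, simp)
        ultimately show "continuous_on (UNIV \<times> cbox 0 1) (\<lambda>(r, s). F r s)"
          unfolding F case_prod_beta by (intro continuous_intros)
      qed auto
      then have "((\<lambda>r. q0 t (x + r *\<^sub>R h)) has_vector_derivative integral {0..1} (F 0)) (at 0)"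
        by (simp add: q0_def)
      with dq' have "frechet_derivative (q0 t) (at x) h = integral {0..1} (F 0)"
        by (rule vector_derivative_unique_at)
      also have "\<dots> = w t x \<bullet> h"
      proof (rule integral_unique)
        \<comment> \<open>Symmetry of the derivative turns \<open>F 0 s\<close> into the
          \<open>s\<close>-derivative of \<open>s * (w t (s *\<^sub>R x) \<bullet> h)\<close>, which
          vanishes at 0 and has the wanted value at 1.\<close>
        have "(F 0 has_integral 1 * (w t (1 *\<^sub>R x) \<bullet> h) - 0 * (w t (0 *\<^sub>R x) \<bullet> h)) {0..1}"
        proof (rule fundamental_theorem_of_calculus)
          fix s :: real
          have "((\<lambda>s. s *\<^sub>R x) has_vector_derivative x) (at s within {0..1})"
            by (auto intro!: derivative_eq_intros)
          then have "((\<lambda>s. w t (s *\<^sub>R x)) has_vector_derivative frechet_derivative (w t) (at (s *\<^sub>R x)) x) (at s within {0..1})"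
            using vector_derivative_diff_chain_within[of "\<lambda>s. s *\<^sub>R x" x s "{0..1}" "w t"]
              der_w[OF t] by (simp add: o_def has_derivative_at_withinI)
          from has_vector_derivative_mult[OF has_vector_derivative_id
              bounded_linear.has_vector_derivative[OF bounded_linear_inner_left this]]
          have "((\<lambda>s. s * (w t (s *\<^sub>R x) \<bullet> h)) has_vector_derivative
              s * (frechet_derivative (w t) (at (s *\<^sub>R x)) x \<bullet> h) + 1 * (w t (s *\<^sub>R x) \<bullet> h)) (at s within {0..1})"
            by simp
          moreover have "s * (frechet_derivative (w t) (at (s *\<^sub>R x)) x \<bullet> h) =
              frechet_derivative (w t) (at (s *\<^sub>R x)) (s *\<^sub>R h) \<bullet> x"
            unfolding sym'[OF t, of _ "s *\<^sub>R h"] by simp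
          ultimately show "((\<lambda>s. s * (w t (s *\<^sub>R x) \<bullet> h)) has_vector_derivative F 0 s) (at s within {0..1})"
            by (simp add: F_def)
        qed simp
        then show "(F 0 has_integral w t x \<bullet> h) {0..1}" by simp
      qed
      finally show ?thesis .
    qed
    then have "frechet_derivative (q0 t) (at x) = (\<lambda>h. w t x \<bullet> h)" by (simp add: fun_eq_iff)
    with dq show ?thesis by simp
  qed
  have per_q0: "periodic (q0 t)" if t: "t \<in> I" for t
    unfolding periodic_def
  proof (intro allI ballI)
    fix x k :: "real ^ 'n" assume k: "k \<in> int_lattice"
    have cw: "continuous_on UNIV (w t)" by (rule smooth_on_continuous[OF smooth_on_slice[OF w t]])
    have line: "q0 t (y + k) - q0 t y = integral {0..1} (\<lambda>\<tau>. w t (y + \<tau> *\<^sub>R k) \<bullet> k)" for y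
    proof -
      have "((\<lambda>\<tau>. w t (y + \<tau> *\<^sub>R k) \<bullet> k) has_integral q0 t (y + 1 *\<^sub>R k) - q0 t (y + 0 *\<^sub>R k)) {0..1}"
      proof (rule fundamental_theorem_of_calculus)
        fix \<tau> :: real
        have "((\<lambda>\<tau>. y + \<tau> *\<^sub>R k) has_vector_derivative k) (at \<tau> within {0..1})"
          by (auto intro!: derivative_eq_intros)
        then show "((\<lambda>\<tau>. q0 t (y + \<tau> *\<^sub>R k)) has_vector_derivative w t (y + \<tau> *\<^sub>R k) \<bullet> k) (at \<tau> within {0..1})"
          using vector_derivative_diff_chain_within[of "\<lambda>\<tau>. y + \<tau> *\<^sub>R k" k \<tau> "{0..1}" "q0 t" "\<lambda>h. w t (y + \<tau> *\<^sub>R k) \<bullet> h"]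
            der_q0[OF t] by (simp add: o_def has_derivative_at_withinI)
      qed simp
      then show ?thesis by (simp add: integral_unique)
    qed
    have "((\<lambda>y. q0 t (y + k) - q0 t y) has_derivative (\<lambda>h. 0)) (at y within UNIV)" for y
    proof -
      have "((\<lambda>y. y + k) has_derivative (\<lambda>h. h)) (at y)" by (auto intro!: derivative_eq_intros)
      from has_derivative_diff[OF has_derivative_compose[OF this der_q0[OF t]] der_q0[OF t]]
      show ?thesis using per[OF t] k by (simp add: periodic_def)
    qed
    then obtain c where c: "\<And>y. q0 t (y + k) - q0 t y = c"
      using has_derivative_zero_constant[of UNIV "\<lambda>y. q0 t (y + k) - q0 t y"] by (metis convex_UNIV UNIV_I)
    \<comment> \<open>Averaging the constant increment over the torus replaces each translate of
      \<open>w t\<close> by its mean.\<close>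
    have "c = torus_integral (\<lambda>y :: real ^ 'n. c)" by (simp add: torus_integral_const)
    also have "\<dots> = torus_integral (\<lambda>y. integral {0..1} (\<lambda>\<tau>. w t (y + \<tau> *\<^sub>R k) \<bullet> k))"
      by (simp add: line[symmetric] c)
    also have "\<dots> = integral {0..1} (\<lambda>\<tau>. torus_integral (\<lambda>y. w t (y + \<tau> *\<^sub>R k) \<bullet> k))"
    proof (rule torus_integral_swap)
      show "continuous_on (UNIV \<times> {0..1}) (\<lambda>(y, \<tau>). w t (y + \<tau> *\<^sub>R k) \<bullet> k)"
        unfolding case_prod_beta by (intro continuous_intros continuous_on_compose2[OF cw]) auto
    qed
    also have "\<dots> = 0"
    proof -
      have "torus_integral (\<lambda>y. w t (y + h) \<bullet> k) = 0" for h
        using torus_integral_translate[of "\<lambda>y. w t y \<bullet> k" h] mean[OF t, of k] per[OF t] cw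
        by (simp add: periodic_def continuous_on_inner)
      then show ?thesis by simp
    qed
    finally show "q0 t (x + k) = q0 t x" using c[of x] by simp
  qed
  \<comment> \<open>Zero mean is the normalisation in the weighted Poisson problem; the subtracted
    mean is smooth in \<open>t\<close>, again as a parametric integral.\<close>
  define q where "q t x = q0 t x - torus_integral (q0 t)" for t x
  have c0: "continuous_on UNIV (q0 t)" if "t \<in> I" for t
    by (rule smooth_on_continuous[OF smooth_on_slice[OF smooth_q0 that]])
  have "smooth_on (I \<times> UNIV) (\<lambda>(t, x). q t x)"
  proof -
    let ?D = "(I \<times> (UNIV :: (real ^ 'n) set)) \<times> cbox (0 :: real ^ 'n) 1"
    have "smooth_on ?D (\<lambda>z. (\<lambda>(t, x). q0 t x) (fst (fst z), snd z))"
      by (rule smooth_on_compose[OF smooth_q0])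
        (intro smooth_on_Pair smooth_on_fst smooth_on_snd smooth_on_ident, auto)
    then have "smooth_on ?D (\<lambda>(y, x). q0 (fst y) x)" by (simp add: case_prod_unfold)
    from smooth_on_integral[OF convex_S this]
    have "smooth_on (I \<times> (UNIV :: (real ^ 'n) set)) (\<lambda>y. torus_integral (q0 (fst y)))"
      by (simp add: torus_integral_def)
    from smooth_on_diff[OF smooth_q0 this] show ?thesis
      by (simp add: q_def case_prod_unfold)
  qed
  moreover have "periodic (q t)" if "t \<in> I" for t
    using per_q0[OF that] by (simp add: periodic_def q_def)
  ultimately have "smooth_torus_field I q" by (simp add: smooth_torus_field_def)
  moreover have "torus_integral (q t) = 0" if "t \<in> I" for t
    unfolding q_def using torus_integral_diff[OF c0[OF that] continuous_on_const]
    by (simp add: torus_integral_const)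
  moreover have "(q t has_derivative (\<lambda>h. w t x \<bullet> h)) (at x)" if "t \<in> I" for t x
    unfolding q_def using has_derivative_diff[OF der_q0[OF that] has_derivative_const] by simp
  ultimately show thesis using that by blast
qed

end

subsection \<open>Geodesics and the Euler equations\<close>

locale geodesic_flow = flow I X for I and X :: "real \<Rightarrow> real ^ 'n \<Rightarrow> real ^ 'n" +
  fixes \<rho>0 :: "real ^ 'n \<Rightarrow> real"
  assumes geodesic: "geodesic I \<rho>0 X"
    and smooth_\<rho>0: "smooth_on UNIV \<rho>0" and periodic_\<rho>0: "periodic \<rho>0" and pos_\<rho>0: "\<rho>0 x > 0"
begin

definition velocity :: "real \<Rightarrow> real ^ 'n \<Rightarrow> real ^ 'n" where
  "velocity t y = vel t (inv (X t) y)"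

definition density :: "real \<Rightarrow> real ^ 'n \<Rightarrow> real" where
  "density t y = \<rho>0 (inv (X t) y)"

definition force :: "real \<Rightarrow> real ^ 'n \<Rightarrow> real ^ 'n" where
  "force t y = density t y *\<^sub>R acc t (inv (X t) y)"

lemma smooth_velocity: "smooth_on (I \<times> UNIV) (\<lambda>(t, y). velocity t y)"
  unfolding velocity_def by (rule smooth_along_inverse[OF smooth_vel])

lemma smooth_density: "smooth_on (I \<times> UNIV) (\<lambda>(t, y). density t y)"
  unfolding density_def by (rule smooth_along_inverse[OF smooth_on_space[OF smooth_\<rho>0]])

lemma smooth_acc_inverse: "smooth_on (I \<times> UNIV) (\<lambda>(t, y). acc t (inv (X t) y))"
  by (rule smooth_along_inverse[OF smooth_acc])

lemma smooth_force: "smooth_on (I \<times> UNIV) (\<lambda>(t, y). force t y)"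
  using smooth_on_scaleR[OF smooth_density smooth_acc_inverse]
  by (simp add: force_def case_prod_unfold)

lemma periodic_velocity: "t \<in> I \<Longrightarrow> periodic (velocity t)"
  using vel_periodic[of t] by (simp add: periodic_def velocity_def inv_X_translate)

lemma periodic_density: "t \<in> I \<Longrightarrow> periodic (density t)"
  using periodic_\<rho>0 by (simp add: periodic_def density_def inv_X_translate)

lemma periodic_force: "t \<in> I \<Longrightarrow> periodic (force t)"
  using acc_periodic[of t] periodic_density[of t]
  by (simp add: periodic_def force_def inv_X_translate)

lemma density_pos: "density t y > 0"
  by (simp add: density_def pos_\<rho>0)

lemma smooth_slices:
  assumes "t \<in> I"
  shows "smooth_on UNIV (velocity t)" "smooth_on UNIV (density t)" "smooth_on UNIV (force t)"
    "smooth_on UNIV (\<lambda>y. acc t (inv (X t) y))"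
  using smooth_on_slice[OF smooth_velocity assms] smooth_on_slice[OF smooth_density assms]
    smooth_on_slice[OF smooth_force assms] smooth_on_slice[OF smooth_acc_inverse assms] by blast+

lemma material_derivative:
  fixes h :: "real \<Rightarrow> real ^ 'n \<Rightarrow> 'b::real_normed_vector"
  assumes h: "smooth_on (I \<times> UNIV) (\<lambda>(t, x). h t x)" and t: "t \<in> I"
  shows "((\<lambda>\<tau>. h \<tau> (X \<tau> x)) has_vector_derivative
    time_deriv I h t (X t x) + frechet_derivative (h t) (at (X t x)) (vel t x)) (at t within I)"
proof -
  have "((\<lambda>\<tau>. X \<tau> x) has_derivative (\<lambda>s. s *\<^sub>R vel t x)) (at t within I)"
    using space_time_derivative(2)[OF smooth_X t] by (simp add: has_vector_derivative_def)
  then have path: "((\<lambda>\<tau>. (\<tau>, X \<tau> x)) has_derivative (\<lambda>s. (s, s *\<^sub>R vel t x))) (at t within I)"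
    by (intro has_derivative_Pair has_derivative_ident)
  have "((\<lambda>(t, x). h t x) has_derivative
      (\<lambda>(\<tau>, v). \<tau> *\<^sub>R time_deriv I h t (X t x) + frechet_derivative (h t) (at (X t x)) v))
      (at (t, X t x) within (\<lambda>\<tau>. (\<tau>, X \<tau> x)) ` I)"
    by (rule has_derivative_subset[OF space_time_derivative(1)[OF h t]]) auto
  from diff_chain_within[OF path this]
  show ?thesis
    using linear_cmul[OF has_derivative_linear[OF space_time_derivative(3)[OF h t]]]
    by (simp add: has_vector_derivative_def o_def scaleR_right_distrib)
qed

text \<open>The trajectory through \<open>y\<close> at time \<open>t\<close> starts from
  \<open>inv (X t) y\<close>. Any other way to differentiate a field along it therefore determines
  the material derivative: \<open>density\<close> is constant on trajectories, and
  \<open>velocity\<close> is \<open>vel\<close> there.\<close>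

lemma material_derivative_unique:
  fixes h :: "real \<Rightarrow> real ^ 'n \<Rightarrow> 'b::real_normed_vector"
  assumes h: "smooth_on (I \<times> UNIV) (\<lambda>(t, x). h t x)" and t: "t \<in> I"
    and d: "((\<lambda>\<tau>. h \<tau> (X \<tau> (inv (X t) y))) has_vector_derivative d) (at t within I)"
  shows "time_deriv I h t y + frechet_derivative (h t) (at y) (velocity t y) = d"
proof (rule vector_derivative_unique_within[OF at_within_I[OF t] _ d])
  show "((\<lambda>\<tau>. h \<tau> (X \<tau> (inv (X t) y))) has_vector_derivative
      time_deriv I h t y + frechet_derivative (h t) (at y) (velocity t y)) (at t within I)"
    using material_derivative[OF h t, of "inv (X t) y"] inv_X(2)[OF t] by (simp add: velocity_def)
qed

lemma transport:
  assumes t: "t \<in> I"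
  shows "time_deriv I density t y + frechet_derivative (density t) (at y) (velocity t y) = 0"
proof (rule material_derivative_unique[OF smooth_density t])
  show "((\<lambda>\<tau>. density \<tau> (X \<tau> (inv (X t) y))) has_vector_derivative 0) (at t within I)"
    by (rule has_vector_derivative_transform[OF t _ has_vector_derivative_const[of "\<rho>0 (inv (X t) y)"]])
      (simp add: density_def inv_X(1))
qed

lemma acceleration:
  assumes t: "t \<in> I"
  shows "time_deriv I velocity t y + advect (velocity t) (velocity t) y = acc t (inv (X t) y)"
  unfolding advect_def
proof (rule material_derivative_unique[OF smooth_velocity t])
  show "((\<lambda>\<tau>. velocity \<tau> (X \<tau> (inv (X t) y))) has_vector_derivative acc t (inv (X t) y)) (at t within I)"
    by (rule has_vector_derivative_transform[OF t _ space_time_derivative(2)[OF smooth_vel t]])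
      (simp add: velocity_def inv_X(1))
qed

text \<open>The integral of a wave composed with \<open>X t\<close> is independent of
  \<open>t\<close>; its time derivative is, up to the factor \<open>2 * pi\<close>, the asserted
  integral in Lagrangian form. The phase \<open>\<theta> - pi / 2\<close> is chosen so that
  differentiation produces \<open>\<theta>\<close>.\<close>

lemma velocity_wave_orthogonal:
  assumes t: "t \<in> I" and k: "k \<in> int_lattice"
  shows "torus_integral (\<lambda>y. (k \<bullet> velocity t y) * wave k \<theta> y) = 0"
proof -
  let ?h = "\<lambda>t x. wave k (\<theta> - pi / 2) (X t x)"
  have sm: "smooth_on (I \<times> UNIV) (\<lambda>(t, x). ?h t x)"
    by (rule smooth_along_flow[OF smooth_on_space[OF smooth_wave]])
  have const: "torus_integral (?h t) = torus_integral (wave k (\<theta> - pi / 2))" if "t \<in> I" for t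
    by (rule torus_integral_X[OF that continuous_wave periodic_wave[OF k]])
  have "time_deriv I ?h t x = 2 * pi * ((k \<bullet> vel t x) * wave k \<theta> (X t x))" for x
  proof (rule time_deriv_eqI[OF _ t])
    have "((\<lambda>\<tau>. X \<tau> x) has_derivative (\<lambda>s. s *\<^sub>R vel t x)) (at t within I)"
      using space_time_derivative(2)[OF smooth_X t] by (simp add: has_vector_derivative_def)
    from has_derivative_compose[OF this wave_has_derivative[of k "\<theta> - pi / 2"]]
    show "((\<lambda>\<tau>. wave k (\<theta> - pi / 2) (X \<tau> x)) has_vector_derivative
        2 * pi * ((k \<bullet> vel t x) * wave k \<theta> (X t x))) (at t within I)"
      by (simp add: has_vector_derivative_def mult_ac)
  qed
  then have "time_deriv I ?h t = (\<lambda>x. 2 * pi * ((k \<bullet> vel t x) * wave k \<theta> (X t x)))"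
    by (rule ext)
  then have "torus_integral (\<lambda>x. 2 * pi * ((k \<bullet> vel t x) * wave k \<theta> (X t x))) = 0"
    using torus_integral_time_deriv[OF sm const t] by metis
  then have *: "torus_integral (\<lambda>x. (k \<bullet> vel t x) * wave k \<theta> (X t x)) = 0"
    unfolding torus_integral_cmult by simp
  let ?f = "\<lambda>y. (k \<bullet> velocity t y) * wave k \<theta> y"
  have "torus_integral (\<lambda>x. ?f (X t x)) = torus_integral ?f"
  proof (rule torus_integral_X[OF t])
    show "continuous_on UNIV ?f"
      by (intro continuous_intros continuous_wave smooth_on_continuous[OF smooth_slices(1)[OF t]])
    show "periodic ?f" using periodic_velocity[OF t] periodic_wave[OF k] by (simp add: periodic_def)
  qed
  with * show ?thesis by (simp add: velocity_def inv_X(1)[OF t])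
qed

lemma divg_velocity: "t \<in> I \<Longrightarrow> divg (velocity t) y = 0"
  by (rule divg_eq_0I[OF smooth_slices(1) periodic_velocity velocity_wave_orthogonal])

lemma periodic_time_deriv_velocity:
  assumes t: "t \<in> I"
  shows "periodic (time_deriv I velocity t)"
  unfolding periodic_def
proof (intro allI ballI)
  fix x k :: "real ^ 'n" assume k: "k \<in> int_lattice"
  have "((\<lambda>\<tau>. velocity \<tau> (x + k)) has_vector_derivative time_deriv I velocity t x) (at t within I)"
    by (rule has_vector_derivative_transform[OF t _ space_time_derivative(2)[OF smooth_velocity t]])
      (use periodic_velocity k in \<open>simp add: periodic_def\<close>)
  then show "time_deriv I velocity t (x + k) = time_deriv I velocity t x"
    by (rule time_deriv_eqI[OF _ t])
qed

text \<open>The weak form of incompressibility holds at all times of \<open>I\<close> and can be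
  differentiated in time; this replaces commuting the divergence with the time derivative.\<close>

lemma divg_time_deriv_velocity:
  assumes t: "t \<in> I"
  shows "divg (time_deriv I velocity t) y = 0"
proof (rule divg_eq_0I[OF smooth_on_slice[OF space_time_derivative(4)[OF smooth_velocity] t]
      periodic_time_deriv_velocity[OF t]])
  fix k :: "real ^ 'n" and \<theta> assume k: "k \<in> int_lattice"
  let ?h = "\<lambda>t y. (k \<bullet> velocity t y) * wave k \<theta> y"
  have sm: "smooth_on (I \<times> UNIV) (\<lambda>(t, y). ?h t y)"
    using smooth_on_mult[OF smooth_on_inner[OF smooth_on_const smooth_velocity] smooth_on_space[OF smooth_wave]]
    by (simp add: case_prod_unfold)
  have "time_deriv I ?h t y = (k \<bullet> time_deriv I velocity t y) * wave k \<theta> y" for y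
    by (rule time_deriv_eqI[OF bounded_linear.has_vector_derivative[OF bounded_linear_mult_left
          bounded_linear.has_vector_derivative[OF bounded_linear_inner_right
            space_time_derivative(2)[OF smooth_velocity t]]] t])
  then have "time_deriv I ?h t = (\<lambda>y. (k \<bullet> time_deriv I velocity t y) * wave k \<theta> y)"
    by (rule ext)
  then show "torus_integral (\<lambda>y. (k \<bullet> time_deriv I velocity t y) * wave k \<theta> y) = 0"
    using torus_integral_time_deriv[OF sm velocity_wave_orthogonal[OF _ k] t] by simp
qed

text \<open>The substitution \<open>y = X t x\<close> carries the Lagrangian orthogonality over to
  the Eulerian field; \<open>density t\<close> at \<open>X t x\<close> is
  \<open>\<rho>0 x\<close>.\<close>

lemma force_orthogonal:
  assumes t: "t \<in> I" and k: "k \<in> int_lattice" "k \<bullet> e = 0"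
  shows "torus_integral (\<lambda>y. (force t y \<bullet> e) * wave k \<theta> y) = 0"
proof -
  let ?f = "\<lambda>y. (force t y \<bullet> e) * wave k \<theta> y"
  have "torus_integral (\<lambda>x. ?f (X t x)) = torus_integral ?f"
  proof (rule torus_integral_X[OF t])
    show "continuous_on UNIV ?f"
      by (intro continuous_intros continuous_wave smooth_on_continuous[OF smooth_slices(3)[OF t]])
    show "periodic ?f" using periodic_force[OF t] periodic_wave[OF k(1)] by (simp add: periodic_def)
  qed
  moreover have "?f (X t x) = (acc t x \<bullet> e) * wave k \<theta> (X t x) * \<rho>0 x" for x
    by (simp add: force_def density_def inv_X(1)[OF t] mult_ac)
  ultimately show ?thesis
    using acceleration_orthogonal[OF geodesic smooth_on_continuous[OF smooth_\<rho>0] k t, of \<theta>] by simp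
qed

text \<open>For \<open>k = 0\<close> no direction \<open>e\<close> is excluded: constant fields are
  divergence free, and testing with them gives the mean.\<close>

lemma force_mean: "t \<in> I \<Longrightarrow> torus_integral (\<lambda>y. force t y \<bullet> e) = 0"
  using force_orthogonal[of t 0 e 0] int_lattice_0 by (simp add: wave_def)

text \<open>By parts, mode \<open>k\<close> of this curl component is a multiple of the pairing of a
  wave with \<open>k $ i * force t y $ j - k $ j * force t y $ i\<close>. That is the component of
  the force along \<open>?e\<close>, a vector orthogonal to \<open>k\<close>, so
  \<open>force_orthogonal\<close> applies.\<close>

lemma force_curl_free:
  assumes t: "t \<in> I"
  shows "frechet_derivative (force t) (at y) (axis i 1) $ j = frechet_derivative (force t) (at y) (axis j 1) $ i"
proof -
  note f = smooth_slices(3)[OF t] periodic_force[OF t]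
  let ?D = "\<lambda>y. frechet_derivative (force t) (at y)"
  have cD: "continuous_on UNIV (\<lambda>y. ?D y v $ i)" for v i
    by (rule smooth_on_continuous[OF smooth_on_nth[OF smooth_UNIV_frechet_derivative[OF f(1)]]])
  have cf: "continuous_on UNIV (\<lambda>y. force t y $ i)" for i
    by (rule smooth_on_continuous[OF smooth_on_nth[OF f(1)]])
  let ?F = "\<lambda>y. ?D y (axis i 1) $ j - ?D y (axis j 1) $ i"
  have "?F y = 0"
  proof (rule wave_complete[of ?F y])
    show "continuous_on UNIV ?F" by (intro continuous_intros cD)
    show "periodic ?F" using periodic_frechet_derivative[OF f] by (simp add: periodic_def)
    fix k :: "real ^ 'n" and \<theta> assume k: "k \<in> int_lattice"
    let ?e = "k $ i *\<^sub>R axis j 1 - k $ j *\<^sub>R axis i 1 :: real ^ 'n"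
    have ke: "k \<bullet> ?e = 0" by (simp add: inner_diff_right inner_axis)
    let ?w = "wave k (\<theta> + pi / 2)"
    have "torus_integral (\<lambda>y. ?F y * wave k \<theta> y) =
        torus_integral (\<lambda>y. ?D y (axis i 1) $ j * wave k \<theta> y) - torus_integral (\<lambda>y. ?D y (axis j 1) $ i * wave k \<theta> y)"
      by (simp only: left_diff_distrib, rule torus_integral_diff) (intro continuous_intros cD continuous_wave)+
    also have "\<dots> = - (2 * pi) * (torus_integral (\<lambda>y. k $ i * (force t y $ j * ?w y))
        - torus_integral (\<lambda>y. k $ j * (force t y $ i * ?w y)))"
      unfolding torus_integral_partial_wave[OF f k] torus_integral_cmult by (simp add: right_diff_distrib)
    also have "\<dots> = - (2 * pi) * torus_integral (\<lambda>y. k $ i * (force t y $ j * ?w y) - k $ j * (force t y $ i * ?w y))"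
      by (subst torus_integral_diff) (intro continuous_intros cf continuous_wave refl)+
    also have "(\<lambda>y. k $ i * (force t y $ j * ?w y) - k $ j * (force t y $ i * ?w y)) = (\<lambda>y. (force t y \<bullet> ?e) * ?w y)"
      by (simp add: inner_diff_right inner_axis algebra_simps)
    also have "torus_integral (\<lambda>y. (force t y \<bullet> ?e) * ?w y) = 0"
      by (rule force_orthogonal[OF t k ke])
    finally show "torus_integral (\<lambda>y. ?F y * wave k \<theta> y) = 0" by simp
  qed
  then show ?thesis by simp
qed

lemma weighted_laplacian_potential:
  assumes t: "t \<in> I" and q: "\<And>y. (q has_derivative (\<lambda>h. force t y \<bullet> h)) (at y)"
  shows "weighted_laplacian (density t) q y = divg (advect (velocity t) (velocity t)) y"
proof -
  have "inverse (density t y) *\<^sub>R grad q y = time_deriv I velocity t y + advect (velocity t) (velocity t) y" for y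
    unfolding grad_unique[OF q] acceleration[OF t] using density_pos[of t y] by (simp add: force_def)
  then have "weighted_laplacian (density t) q y =
      divg (\<lambda>y. time_deriv I velocity t y + advect (velocity t) (velocity t) y) y"
    unfolding weighted_laplacian_def by simp
  also have "\<dots> = divg (time_deriv I velocity t) y + divg (advect (velocity t) (velocity t)) y"
  proof (rule divg_add)
    show sm: "smooth_on UNIV (time_deriv I velocity t)"
      by (rule smooth_on_slice[OF space_time_derivative(4)[OF smooth_velocity] t])
    \<comment> \<open>\<open>advect\<close> differentiates in a direction that varies with the
      point; its smoothness is read off from the acceleration identity instead.\<close>
    have "advect (velocity t) (velocity t) = (\<lambda>y. acc t (inv (X t) y) - time_deriv I velocity t y)"
      unfolding acceleration[OF t, symmetric] by simp
    then show "smooth_on UNIV (advect (velocity t) (velocity t))"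
      using smooth_on_diff[OF smooth_slices(4)[OF t] sm] by simp
  qed
  finally show ?thesis by (simp add: divg_time_deriv_velocity[OF t])
qed

text \<open>The product rule regroups the left side into \<open>density\<close> times the material
  acceleration plus \<open>velocity\<close> times the material derivative of \<open>density\<close>,
  which is zero; the term with the divergence of \<open>velocity\<close> drops out.\<close>

lemma momentum:
  assumes t: "t \<in> I"
  shows "time_deriv I (\<lambda>\<tau> y. density \<tau> y *\<^sub>R velocity \<tau> y) t y
    + divg_tensor (\<lambda>y. density t y *\<^sub>R tensor (velocity t y) (velocity t y)) y = force t y"
proof -
  let ?u = "velocity t" and ?\<rho> = "density t"
  note su = smooth_slices(1)[OF t] and s\<rho> = smooth_slices(2)[OF t]
  have time: "time_deriv I (\<lambda>\<tau> y. density \<tau> y *\<^sub>R velocity \<tau> y) t y =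
      ?\<rho> y *\<^sub>R time_deriv I velocity t y + time_deriv I density t y *\<^sub>R ?u y"
    by (rule time_deriv_eqI[OF bounded_bilinear.has_vector_derivative[OF bounded_bilinear_scaleR
          space_time_derivative(2)[OF smooth_density t] space_time_derivative(2)[OF smooth_velocity t]] t])
  have "divg (\<lambda>y. (?\<rho> y *\<^sub>R tensor (?u y) (?u y)) $ i) y =
      ?\<rho> y * advect ?u ?u y $ i + frechet_derivative ?\<rho> (at y) (?u y) * ?u y $ i" for i
  proof -
    have sm: "smooth_on UNIV (\<lambda>y. ?\<rho> y * ?u y $ i)" by (intro smooth_on_mult s\<rho> smooth_on_nth su)
    have "(\<lambda>y. (?\<rho> y *\<^sub>R tensor (?u y) (?u y)) $ i) = (\<lambda>y. (?\<rho> y * ?u y $ i) *\<^sub>R ?u y)"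
      by (simp add: tensor_def vec_eq_iff fun_eq_iff)
    then have "divg (\<lambda>y. (?\<rho> y *\<^sub>R tensor (?u y) (?u y)) $ i) y = ?u y \<bullet> grad (\<lambda>y. ?\<rho> y * ?u y $ i) y"
      using divg_scaleR[OF sm su, of y] divg_velocity[OF t, of y] by simp
    also have "\<dots> = ?\<rho> y * frechet_derivative ?u (at y) (?u y) $ i + frechet_derivative ?\<rho> (at y) (?u y) * ?u y $ i"
      by (rule grad_inner[symmetric])
        (rule has_derivative_mult[OF smooth_UNIV_has_derivative[OF s\<rho>] component_has_derivative[OF su]])
    finally show ?thesis by (simp add: advect_def)
  qed
  then have "divg_tensor (\<lambda>y. ?\<rho> y *\<^sub>R tensor (?u y) (?u y)) y =
      ?\<rho> y *\<^sub>R advect ?u ?u y + frechet_derivative ?\<rho> (at y) (?u y) *\<^sub>R ?u y"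
    by (simp add: divg_tensor_def vec_eq_iff)
  then have "time_deriv I (\<lambda>\<tau> y. density \<tau> y *\<^sub>R velocity \<tau> y) t y
      + divg_tensor (\<lambda>y. ?\<rho> y *\<^sub>R tensor (?u y) (?u y)) y =
      ?\<rho> y *\<^sub>R (time_deriv I velocity t y + advect ?u ?u y)
      + (time_deriv I density t y + frechet_derivative ?\<rho> (at y) (?u y)) *\<^sub>R ?u y"
    unfolding time by (simp add: algebra_simps)
  then show ?thesis
    unfolding transport[OF t] acceleration[OF t] by (simp add: force_def)
qed

theorem pressure_exists:
  "\<exists>p. smooth_torus_field I p \<and>
      (\<forall>t\<in>I. \<forall>x. \<rho>0 x *\<^sub>R acc t x = - grad (p t) (X t x)) \<and>
      (\<forall>t\<in>I. (\<exists>!\<phi>. weighted_poisson_solution (density t) (divg (advect (velocity t) (velocity t))) \<phi>) \<and>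
        (\<forall>x. p t x = - inv_weighted_laplacian (density t) (divg (advect (velocity t) (velocity t))) x)) \<and>
      inhomogeneous_euler I velocity density p"
proof -
  obtain q where q: "smooth_torus_field I q" "\<And>t. t \<in> I \<Longrightarrow> torus_integral (q t) = 0"
    "\<And>t y. t \<in> I \<Longrightarrow> (q t has_derivative (\<lambda>h. force t y \<bullet> h)) (at y)"
    using periodic_potential[OF smooth_force periodic_force force_curl_free force_mean] by metis
  have smooth_q: "smooth_on (I \<times> UNIV) (\<lambda>(t, y). q t y)" and periodic_q: "\<And>t. t \<in> I \<Longrightarrow> periodic (q t)"
    using q(1) unfolding smooth_torus_field_def by blast+
  \<comment> \<open>\<open>q\<close> is a potential of the force and the pressure one of its
    negative; hence \<open>q\<close> itself solves the Poisson equation, and \<open>p\<close>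
    carries the minus sign in front of the inverse Laplacian.\<close>
  define p where "p t y = - q t y" for t y
  have p: "smooth_torus_field I p"
    unfolding smooth_torus_field_def
  proof
    show "smooth_on (I \<times> UNIV) (\<lambda>(t, y). p t y)"
      using smooth_on_minus[OF smooth_q] by (simp add: p_def case_prod_unfold)
    show "\<forall>t\<in>I. periodic (p t)" using periodic_q by (simp add: periodic_def p_def)
  qed
  have grad_p: "grad (p t) y = - force t y" if "t \<in> I" for t y
  proof (rule grad_unique)
    show "(p t has_derivative (\<lambda>h. - force t y \<bullet> h)) (at y)"
      unfolding p_def[abs_def] using has_derivative_minus[OF q(3)[OF that]] by simp
  qed
  have sol: "weighted_poisson_solution (density t) (divg (advect (velocity t) (velocity t))) (q t)" if t: "t \<in> I" for t
    unfolding weighted_poisson_solution_def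
    using smooth_on_slice[OF smooth_q t] periodic_q[OF t] q(2)[OF t] weighted_laplacian_potential[OF t q(3)[OF t]]
    by blast
  have unique: "\<phi> = q t"
    if "t \<in> I" "weighted_poisson_solution (density t) (divg (advect (velocity t) (velocity t))) \<phi>" for t \<phi>
    by (rule weighted_poisson_unique[OF smooth_slices(2)[OF that(1)] periodic_density[OF that(1)] density_pos that(2) sol[OF that(1)]])
  have "inv_weighted_laplacian (density t) (divg (advect (velocity t) (velocity t))) = q t" if "t \<in> I" for t
    unfolding inv_weighted_laplacian_def by (rule the_equality) (rule sol[OF that], rule unique[OF that])
  moreover have "\<exists>!\<phi>. weighted_poisson_solution (density t) (divg (advect (velocity t) (velocity t))) \<phi>" if "t \<in> I" for t
    by (rule ex1I) (rule sol[OF that], rule unique[OF that])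
  moreover have "\<rho>0 x *\<^sub>R acc t x = - grad (p t) (X t x)" if "t \<in> I" for t x
    by (simp add: grad_p[OF that] force_def density_def inv_X(1)[OF that])
  moreover have "inhomogeneous_euler I velocity density p"
    unfolding inhomogeneous_euler_def
  proof (intro conjI ballI allI p)
    show "smooth_torus_field I velocity" "smooth_torus_field I density"
      unfolding smooth_torus_field_def
      using smooth_velocity smooth_density periodic_velocity periodic_density by blast+
    fix t x assume t: "t \<in> I"
    show "time_deriv I (\<lambda>\<tau> y. density \<tau> y *\<^sub>R velocity \<tau> y) t x
        + divg_tensor (\<lambda>y. density t y *\<^sub>R tensor (velocity t y) (velocity t y)) x + grad (p t) x = 0"
      unfolding momentum[OF t] grad_p[OF t] by simp
    show "divg (velocity t) x = 0" by (rule divg_velocity[OF t])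
    show "time_deriv I density t x + velocity t x \<bullet> grad (density t) x = 0"
      using transport[OF t, of x] grad_inner[OF smooth_UNIV_has_derivative[OF smooth_slices(2)[OF t]]] by simp
  qed
  ultimately show ?thesis
    using p by (intro exI[of _ p]) (simp add: p_def)
qed

end

theorem theorem2p4:
  fixes I :: "real set"
    and \<rho>0 :: "real ^ 'n \<Rightarrow> real"
    and C1 :: real
    and X :: "real \<Rightarrow> real ^ 'n \<Rightarrow> real ^ 'n"
    and u :: "real \<Rightarrow> real ^ 'n \<Rightarrow> real ^ 'n"
    and \<rho> :: "real \<Rightarrow> real ^ 'n \<Rightarrow> real"
  assumes "is_interval I" and "interior I \<noteq> {}" and "0 \<in> I"
    and "smooth_on UNIV \<rho>0" and "periodic \<rho>0" and "torus_integral \<rho>0 = 1"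
    and "C1 > 1" and "\<And>x. 1 / C1 \<le> \<rho>0 x \<and> \<rho>0 x \<le> C1"
    and "geodesic I \<rho>0 X" and "torus_eq (X 0) id"
    and u_def: "\<And>t. u t = time_deriv I X t \<circ> inv (X t)"
    and rho_def: "\<And>t. \<rho> t = \<rho>0 \<circ> inv (X t)"
  shows "\<exists>p :: real \<Rightarrow> real ^ 'n \<Rightarrow> real.
      smooth_torus_field I p \<and>
      (\<forall>t\<in>I. \<forall>x. \<rho>0 x *\<^sub>R time_deriv I (time_deriv I X) t x = - grad (p t) (X t x)) \<and>
      (\<forall>t\<in>I. (\<exists>!\<phi>. weighted_poisson_solution (\<rho> t) (divg (advect (u t) (u t))) \<phi>) \<and>
        (\<forall>x. p t x = - inv_weighted_laplacian (\<rho> t) (divg (advect (u t) (u t))) x)) \<and>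
      inhomogeneous_euler I u \<rho> p"
proof -
  have curve: "smooth_curve I X" using assms(9) unfolding geodesic_def by blast
  interpret geodesic_flow I X \<rho>0
  proof unfold_locales
    show "smooth_on (I \<times> UNIV) (\<lambda>(t, x). X t x)" using curve unfolding smooth_curve_def by blast
    show "X t \<in> SDiff" if "t \<in> I" for t using curve that unfolding smooth_curve_def by blast
    \<comment> \<open>The initial condition enters here, in its torus form: the lift
      \<open>X 0\<close> is the identity only modulo the lattice.\<close>
    show "X t (x + k) = X t x + k" if "t \<in> I" "k \<in> int_lattice" for t x k
      by (rule lattice_translation_curve[OF assms(1,3) curve assms(10) that])
    show "0 < \<rho>0 x" for x
    proof -
      have "0 < 1 / C1" using assms(7) by simp
      then show ?thesis using assms(8)[of x] by linarith
    qed
  qed (rule assms)+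
  have "u = velocity" "\<rho> = density"
    by (simp_all add: fun_eq_iff u_def rho_def velocity_def density_def)
  then show ?thesis using pressure_exists by simp
qed

end
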